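(* Let $g$ be a Carathéodory function on $\Omega \times \mathbb{R}$ satisfying $g(x,t) = o(t)$ as $t \to 0$, uniformly a.e. in $\Omega$, and $|g(x,t)| \le c_8 |t|^{p-1} + c_9$ for a.a. $x \in \Omega$ and all $t \in \mathbb{R}$, for some constants $c_8, c_9 > 0$ and $2 < p < 2^*$. If $\gamma = 2^*/2$, $a = 0$, and $b > S^{-2^*/2}$, then the problem \[ \left\{\begin{aligned} - \left[a + b \left(\int_\Omega |\nabla u|^2\, dx\right)^{\gamma-1}\right] \Delta u & = \lambda u + g(x,u) + |u|^{2^*-2}\, u && \text{in } \Omega\\ u & = 0 && \text{on } \partial\Omega \end{aligned}\right. \] has a nontrivial weak solution for all $\lambda > 0$.
   Context: $\Omega$ is a bounded domain in $\mathbb{R}^N$, $N \ge 3$, and $2^* = 2N/(N-2)$. The best Sobolev constant is $S = \inf_{u \in H^1_0(\Omega) \setminus \{0\}} \int_\Omega |\nabla u|^2\, dx \big/ \left(\int_\Omega |u|^{2^*} dx\right)^{2/2^*}$. A weak solution is a function $u \in H^1_0(\Omega)$ such that $\left[a + b \left(\int_\Omega |\nabla u|^2\, dx\right)^{\gamma-1}\right] \int_\Omega \nabla u \cdot \nabla v\, dx = \int_\Omega \left(\lambda u + g(x,u) + |u|^{2^*-2} u\right) v\, dx$ for all $v \in H^1_0(\Omega)$; it is nontrivial if $u \neq 0$. *)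

theory Defs
  imports "HOL-Analysis.Analysis"
begin

text \<open>
  Functions on \<open>\<Omega>\<close> are total functions on \<open>\<real>\<^sup>N\<close> (\<open>N = CARD('n)\<close>) of which only the values on \<open>\<Omega>\<close>
  are used. Elements of the function spaces are representatives, not equivalence classes modulo
  a.e. equality, so that \<open>u \<noteq> 0\<close> is expressed as \<open>\<not> (AE x in lebesgue_on \<Omega>. u x = 0)\<close>.
\<close>

definition bounded_domain :: "(real ^ 'n) set \<Rightarrow> bool" where
  "bounded_domain \<Omega> \<longleftrightarrow> open \<Omega> \<and> connected \<Omega> \<and> bounded \<Omega> \<and> \<Omega> \<noteq> {}"

definition partial_deriv :: "'n \<Rightarrow> (real ^ 'n \<Rightarrow> real) \<Rightarrow> real ^ 'n \<Rightarrow> real" where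
  "partial_deriv i f x = frechet_derivative f (at x) (axis i 1)"

fun Ck :: "nat \<Rightarrow> (real ^ 'n \<Rightarrow> real) \<Rightarrow> bool" where
  "Ck 0 f \<longleftrightarrow> continuous_on UNIV f"
| "Ck (Suc k) f \<longleftrightarrow> f differentiable_on UNIV \<and> (\<forall>i. Ck k (partial_deriv i f))"

definition test_functions :: "(real ^ 'n) set \<Rightarrow> (real ^ 'n \<Rightarrow> real) set" where
  "test_functions \<Omega> =
     {\<phi>. (\<forall>k. Ck k \<phi>) \<and> compact (closure {x. \<phi> x \<noteq> 0}) \<and> closure {x. \<phi> x \<noteq> 0} \<subseteq> \<Omega>}"

definition L2 :: "(real ^ 'n) set \<Rightarrow> (real ^ 'n \<Rightarrow> 'b::euclidean_space) set" where
  "L2 \<Omega> = {f. f \<in> borel_measurable (lebesgue_on \<Omega>) \<and>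
              integrable (lebesgue_on \<Omega>) (\<lambda>x. (norm (f x))\<^sup>2)}"

definition has_weak_gradient ::
    "(real ^ 'n) set \<Rightarrow> (real ^ 'n \<Rightarrow> real) \<Rightarrow> (real ^ 'n \<Rightarrow> real ^ 'n) \<Rightarrow> bool" where
  "has_weak_gradient \<Omega> u G \<longleftrightarrow> G \<in> L2 \<Omega> \<and>
     (\<forall>\<phi>\<in>test_functions \<Omega>. \<forall>i.
        (LINT x|lebesgue_on \<Omega>. u x * partial_deriv i \<phi> x) = - (LINT x|lebesgue_on \<Omega>. G x $ i * \<phi> x))"

definition H1 :: "(real ^ 'n) set \<Rightarrow> (real ^ 'n \<Rightarrow> real) set" where
  "H1 \<Omega> = {u \<in> L2 \<Omega>. \<exists>G. has_weak_gradient \<Omega> u G}"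

text \<open>On \<open>H1 \<Omega>\<close> the weak gradient is unique up to a.e. equality; the choice below picks one.\<close>

definition weak_grad :: "(real ^ 'n) set \<Rightarrow> (real ^ 'n \<Rightarrow> real) \<Rightarrow> real ^ 'n \<Rightarrow> real ^ 'n" where
  "weak_grad \<Omega> u = (SOME G. has_weak_gradient \<Omega> u G)"

definition H1_norm :: "(real ^ 'n) set \<Rightarrow> (real ^ 'n \<Rightarrow> real) \<Rightarrow> real" where
  "H1_norm \<Omega> u =
     sqrt ((LINT x|lebesgue_on \<Omega>. (u x)\<^sup>2) + (LINT x|lebesgue_on \<Omega>. (norm (weak_grad \<Omega> u x))\<^sup>2))"

text \<open>The closure of the test functions in the \<open>H1\<close> norm.\<close>

definition H10 :: "(real ^ 'n) set \<Rightarrow> (real ^ 'n \<Rightarrow> real) set" where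
  "H10 \<Omega> = {u \<in> H1 \<Omega>. \<forall>\<epsilon>>0. \<exists>\<phi>\<in>test_functions \<Omega>. H1_norm \<Omega> (\<lambda>x. u x - \<phi> x) < \<epsilon>}"

definition dirichlet_integral :: "(real ^ 'n) set \<Rightarrow> (real ^ 'n \<Rightarrow> real) \<Rightarrow> real" where
  "dirichlet_integral \<Omega> u = (LINT x|lebesgue_on \<Omega>. (norm (weak_grad \<Omega> u x))\<^sup>2)"

text \<open>\<open>2\<^sup>* = 2N / (N - 2)\<close>, where \<open>N\<close> is the dimension.\<close>

definition crit_exp :: "nat \<Rightarrow> real" where
  "crit_exp N = 2 * real N / (real N - 2)"

text \<open>
  By the Sobolev embedding, for \<open>N \<ge> 3\<close> the integrals in the denominators are finite, and they are
  positive since \<open>u \<noteq> 0\<close>; so the infimum is over a nonempty set of genuine nonnegative quotients.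
\<close>

definition best_sobolev_const :: "(real ^ 'n) set \<Rightarrow> real" where
  "best_sobolev_const \<Omega> =
     Inf {dirichlet_integral \<Omega> u /
            (LINT x|lebesgue_on \<Omega>. \<bar>u x\<bar> powr crit_exp CARD('n)) powr (2 / crit_exp CARD('n)) | u.
          u \<in> H10 \<Omega> \<and> \<not> (AE x in lebesgue_on \<Omega>. u x = 0)}"

definition caratheodory :: "(real ^ 'n) set \<Rightarrow> (real ^ 'n \<Rightarrow> real \<Rightarrow> real) \<Rightarrow> bool" where
  "caratheodory \<Omega> g \<longleftrightarrow>
     (\<forall>t. (\<lambda>x. g x t) \<in> borel_measurable (lebesgue_on \<Omega>)) \<and>
     (AE x in lebesgue_on \<Omega>. continuous_on UNIV (g x))"

definition kirchhoff_rhs ::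
    "real \<Rightarrow> (real ^ 'n \<Rightarrow> real \<Rightarrow> real) \<Rightarrow> (real ^ 'n \<Rightarrow> real) \<Rightarrow> real ^ 'n \<Rightarrow> real" where
  "kirchhoff_rhs lam g u x =
     lam * u x + g x (u x) + \<bar>u x\<bar> powr (crit_exp CARD('n) - 2) * u x"

text \<open>
  Integrability of the right-hand side is stated explicitly because the Lebesgue integral of a
  non-integrable function is \<open>0\<close> by convention. The left-hand integrand is integrable automatically,
  both gradients being in \<open>L2 \<Omega>\<close>.
\<close>

definition weak_solution ::
    "(real ^ 'n) set \<Rightarrow> real \<Rightarrow> real \<Rightarrow> real \<Rightarrow> real \<Rightarrow> (real ^ 'n \<Rightarrow> real \<Rightarrow> real) \<Rightarrow>
     (real ^ 'n \<Rightarrow> real) \<Rightarrow> bool" where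
  "weak_solution \<Omega> a b \<gamma> lam g u \<longleftrightarrow> u \<in> H10 \<Omega> \<and>
     (\<forall>v\<in>H10 \<Omega>.
        integrable (lebesgue_on \<Omega>) (\<lambda>x. kirchhoff_rhs lam g u x * v x) \<and>
        (a + b * dirichlet_integral \<Omega> u powr (\<gamma> - 1)) *
          (LINT x|lebesgue_on \<Omega>. weak_grad \<Omega> u x \<bullet> weak_grad \<Omega> v x) =
        (LINT x|lebesgue_on \<Omega>. kirchhoff_rhs lam g u x * v x))"

end

theory Submission
  imports Defs "HOL-Complex_Analysis.Great_Picard" "HOL-Library.Diagonal_Subsequence"
begin

text \<open>
  Solutions are critical points of
  \<open>E u = b / q * D u powr (q / 2) - \<integral> H x (u x)\<close> with \<open>q = 2\<^sup>*\<close>, \<open>D\<close> the Dirichlet integral and \<open>H x\<close> the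
  primitive of \<open>t \<mapsto> lam * t + g x t + \<bar>t\<bar> powr (q - 2) * t\<close>. As \<open>\<gamma> = q / 2\<close>, the Kirchhoff term and the
  critical term are homogeneous of the same degree, and \<open>b > S powr (- q / 2)\<close> (\<open>S\<close> the Sobolev constant) says that the
  Sobolev inequality leaves a positive multiple of \<open>D u powr (q / 2)\<close>; so \<open>E\<close> is coercive. For a minimizing
  sequence \<open>\<phi>\<^sub>n\<close> converging weakly and a.e. to \<open>u\<close>, the critical mass of \<open>\<phi>\<^sub>n - u\<close> is paid for by its
  Dirichlet integral: with \<open>\<epsilon>\<close> such that \<open>(1 + \<epsilon>) * S powr (- q / 2) = b\<close>, the functions
  \<open>H x \<phi>\<^sub>n - (1 + \<epsilon>) / q * \<bar>\<phi>\<^sub>n - u\<bar> powr q\<close> are bounded above by a fixed integrable function, and the reverse Fatou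
  lemma together with the superadditivity of \<open>s \<mapsto> s powr (q / 2)\<close> gives \<open>E u \<le> lim E \<phi>\<^sub>n\<close>. Thus \<open>E\<close> has a
  global minimizer, and it is nonzero because \<open>E\<close> is negative at small multiples of any nonzero test function, where
  the term \<open>lam / 2 * u\<^sup>2\<close> dominates.
\<close>

section \<open>Test functions\<close>

text \<open>The obstacle is that \<open>H10\<close> does not embed compactly into the critical
  space: along a minimizing sequence the mass of \<open>\<bar>\<phi>\<bar> powr q\<close> may
  concentrate, and this term enters \<open>E\<close> with a minus sign. The strict gap between
  \<open>b\<close> and \<open>S powr (- q / 2)\<close> is spent twice: half of it on coercivity, and
  all of it, as the factor \<open>1 + \<epsilon>\<close>, on absorbing the subcritical terms and the
  mixed terms of \<open>\<bar>(\<phi> - u) + u\<bar> powr q\<close>. What remains to be known about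
  the sequence is its a.e. limit and the limit of one scalar product, that of its gradients with the
  limit gradient; for this, compactness in \<open>L\<^sup>1\<close> and convex combinations suffice.
  The minimization runs over test functions, whose gradients are classical. Passing to all of
  \<open>H10\<close> needs only the inequality of Fatou's lemma, because the Dirichlet integral
  converges under approximation in the norm and \<open>H\<close> is bounded below. As elements are
  representatives, limits obtained in different ways are identified through a.e.
  convergence.\<close>

definition grad :: "(real ^ 'n \<Rightarrow> real) \<Rightarrow> real ^ 'n \<Rightarrow> real ^ 'n" where
  "grad f x = (\<chi> i. partial_deriv i f x)"

lemma has_derivative_grad:
  fixes f :: "real ^ 'n \<Rightarrow> real"
  assumes "f differentiable (at x)"
  shows "(f has_derivative (\<lambda>h. grad f x \<bullet> h)) (at x)"
proof -
  let ?D = "frechet_derivative f (at x)"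
  have D: "(f has_derivative ?D) (at x)"
    using assms frechet_derivative_works by blast
  then have lin: "linear ?D" by (rule has_derivative_linear)
  have "?D h = grad f x \<bullet> h" for h
  proof -
    have "?D h = ?D (\<Sum>i\<in>UNIV. (h $ i) *\<^sub>R axis i 1)"
      using basis_expansion[of h] by (simp add: scalar_mult_eq_scaleR)
    also have "\<dots> = (\<Sum>i\<in>UNIV. h $ i * ?D (axis i 1))"
      by (simp add: linear_sum[OF lin] linear_cmul[OF lin])
    finally show ?thesis
      by (simp add: grad_def partial_deriv_def inner_vec_def mult.commute)
  qed
  then show ?thesis using D by (metis (no_types, lifting) ext)
qed

lemma grad_unique:
  fixes f :: "real ^ 'n \<Rightarrow> real"
  assumes "(f has_derivative (\<lambda>h. v \<bullet> h)) (at x)"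
  shows "grad f x = v"
proof -
  have "frechet_derivative f (at x) = (\<lambda>h. v \<bullet> h)"
    using assms frechet_derivative_at by metis
  then show ?thesis
    by (simp add: grad_def partial_deriv_def vec_eq_iff inner_axis)
qed

lemma partial_deriv_unique:
  fixes f :: "real ^ 'n \<Rightarrow> real"
  assumes "(f has_derivative f') (at x)"
  shows "partial_deriv i f x = f' (axis i 1)"
  using assms frechet_derivative_at unfolding partial_deriv_def by metis

lemma partial_deriv_grad: "partial_deriv i f x = grad f x $ i"
  by (simp add: grad_def)

text \<open>\<open>Ck\<close> recurses through \<open>partial_deriv\<close>, so the induction ranges
  over all pairs of functions. It serves both the vector space structure of the test functions and
  the smoothness of the bumps, whose derivatives are linear combinations of bumps.\<close>

lemma Ck_linear:
  fixes f g :: "real ^ 'n \<Rightarrow> real"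
  assumes "Ck k f" "Ck k g"
  shows "Ck k (\<lambda>x. \<alpha> * f x + \<beta> * g x)"
  using assms
proof (induction k arbitrary: f g)
  case 0
  then show ?case by (auto intro!: continuous_intros)
next
  case (Suc k)
  have df: "f differentiable (at x)" and dg: "g differentiable (at x)" for x
    using Suc.prems by (auto simp: differentiable_on_def)
  have "((\<lambda>x. \<alpha> * f x + \<beta> * g x) has_derivative (\<lambda>h. \<alpha> * (grad f x \<bullet> h) + \<beta> * (grad g x \<bullet> h))) (at x)" for x
    by (intro derivative_intros has_derivative_grad df dg)
  then have *: "((\<lambda>x. \<alpha> * f x + \<beta> * g x) has_derivative (\<lambda>h. (\<alpha> *\<^sub>R grad f x + \<beta> *\<^sub>R grad g x) \<bullet> h)) (at x)" for x
    by (simp add: inner_add_left)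
  then have "partial_deriv i (\<lambda>x. \<alpha> * f x + \<beta> * g x) = (\<lambda>x. \<alpha> * partial_deriv i f x + \<beta> * partial_deriv i g x)" for i
    using grad_unique[OF *] by (auto simp: partial_deriv_grad)
  moreover have "Ck k (\<lambda>x. \<alpha> * partial_deriv i f x + \<beta> * partial_deriv i g x)" for i
    using Suc by simp
  moreover have "(\<lambda>x. \<alpha> * f x + \<beta> * g x) differentiable_on UNIV"
    using * by (auto simp: differentiable_on_def differentiable_def)
  ultimately show ?case by simp
qed

text \<open>The class for all classical calculus on the whole space: integration by parts, the
  Sobolev inequality and the translation estimates use no more than this. Higher smoothness and the
  position of the support inside the domain stay in \<open>test_functions\<close>.\<close>

definition C1c :: "(real ^ 'n \<Rightarrow> real) \<Rightarrow> bool" where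
  "C1c f \<longleftrightarrow> f differentiable_on UNIV \<and> continuous_on UNIV (grad f) \<and> bounded {x. f x \<noteq> 0}"

lemma C1cD:
  assumes "C1c f"
  shows "(f has_derivative (\<lambda>h. grad f x \<bullet> h)) (at x)" "continuous_on UNIV f"
    "continuous_on UNIV (grad f)" "bounded {x. f x \<noteq> 0}"
proof -
  show d: "(f has_derivative (\<lambda>h. grad f x \<bullet> h)) (at x)" for x
    using assms by (intro has_derivative_grad) (auto simp: C1c_def differentiable_on_def)
  show "continuous_on UNIV f"
    using has_derivative_continuous[OF d] by (auto intro!: continuous_at_imp_continuous_on)
qed (use assms in \<open>auto simp: C1c_def\<close>)

lemma C1cI:
  assumes "\<And>x. (f has_derivative (\<lambda>h. G x \<bullet> h)) (at x)" "continuous_on UNIV G" "bounded {x. f x \<noteq> 0}"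
  shows "C1c f" "grad f = G"
proof -
  show *: "grad f = G" using grad_unique[OF assms(1)] by auto
  show "C1c f" using assms by (auto simp: C1c_def * differentiable_on_def differentiable_def)
qed

lemma grad_zero_outside:
  assumes "open U" "x \<in> U" "\<And>y. y \<in> U \<Longrightarrow> f y = 0"
  shows "grad f x = 0"
proof (rule grad_unique)
  have "((\<lambda>x. 0) has_derivative (\<lambda>h. 0 \<bullet> h)) (at x)" by simp
  then show "(f has_derivative (\<lambda>h. 0 \<bullet> h)) (at x)"
    using has_derivative_transform_within_open[OF _ assms(1,2), of "\<lambda>x. 0" _ UNIV f] assms(3) by auto
qed

lemma test_functionsD:
  assumes "\<phi> \<in> test_functions \<Omega>"
  shows "C1c \<phi>" "x \<notin> \<Omega> \<Longrightarrow> \<phi> x = 0" "x \<notin> \<Omega> \<Longrightarrow> grad \<phi> x = 0"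
proof -
  let ?K = "closure {x. \<phi> x \<noteq> 0}"
  have K: "compact ?K" "?K \<subseteq> \<Omega>" and C: "Ck k \<phi>" for k
    using assms by (auto simp: test_functions_def)
  have "continuous_on UNIV (partial_deriv i \<phi>)" for i
    using C[of "Suc 0"] by auto
  then have "continuous_on UNIV (grad \<phi>)"
    unfolding grad_def by (intro continuous_intros) auto
  moreover have "bounded {x. \<phi> x \<noteq> 0}"
    by (rule bounded_subset[OF compact_imp_bounded[OF K(1)] closure_subset])
  ultimately show "C1c \<phi>" using C[of 1] by (auto simp: C1c_def)
  show "\<phi> x = 0" if "x \<notin> \<Omega>"
    using K(2) that closure_subset[of "{x. \<phi> x \<noteq> 0}"] by auto
  show "grad \<phi> x = 0" if "x \<notin> \<Omega>"
  proof (rule grad_zero_outside)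
    show "open (- ?K)" by auto
    show "x \<in> - ?K" using that K by auto
    show "\<phi> y = 0" if "y \<in> - ?K" for y
      using that closure_subset[of "{x. \<phi> x \<noteq> 0}"] by auto
  qed
qed

lemma test_functions_linear:
  assumes "\<phi> \<in> test_functions \<Omega>" "\<psi> \<in> test_functions \<Omega>"
  shows "(\<lambda>x. \<alpha> * \<phi> x + \<beta> * \<psi> x) \<in> test_functions \<Omega>"
proof -
  let ?f = "\<lambda>x. \<alpha> * \<phi> x + \<beta> * \<psi> x"
  have "{x. ?f x \<noteq> 0} \<subseteq> {x. \<phi> x \<noteq> 0} \<union> {x. \<psi> x \<noteq> 0}" by auto
  then have *: "closure {x. ?f x \<noteq> 0} \<subseteq> closure {x. \<phi> x \<noteq> 0} \<union> closure {x. \<psi> x \<noteq> 0}"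
    using closure_mono[of "{x. ?f x \<noteq> 0}"] by (simp flip: closure_Un)
  moreover have "compact (closure {x. \<phi> x \<noteq> 0} \<union> closure {x. \<psi> x \<noteq> 0})"
    using assms by (intro compact_Un) (auto simp: test_functions_def)
  ultimately have "compact (closure {x. ?f x \<noteq> 0})"
    using bounded_subset[OF compact_imp_bounded *] closed_closure compact_eq_bounded_closed by blast
  then show ?thesis using * assms Ck_linear[of _ \<phi> \<psi>] by (auto simp: test_functions_def)
qed

lemma grad_linear:
  assumes "C1c \<phi>" "C1c \<psi>"
  shows "grad (\<lambda>x. \<alpha> * \<phi> x + \<beta> * \<psi> x) x = \<alpha> *\<^sub>R grad \<phi> x + \<beta> *\<^sub>R grad \<psi> x"
proof (rule grad_unique)
  have "((\<lambda>x. \<alpha> * \<phi> x + \<beta> * \<psi> x) has_derivative (\<lambda>h. \<alpha> * (grad \<phi> x \<bullet> h) + \<beta> * (grad \<psi> x \<bullet> h))) (at x)"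
    by (intro derivative_intros C1cD assms)
  then show "((\<lambda>x. \<alpha> * \<phi> x + \<beta> * \<psi> x) has_derivative (\<lambda>h. (\<alpha> *\<^sub>R grad \<phi> x + \<beta> *\<^sub>R grad \<psi> x) \<bullet> h)) (at x)"
    by (simp add: inner_add_left)
qed

lemma C1c_mult:
  assumes "C1c f" "C1c g"
  shows "C1c (\<lambda>x. f x * g x)" "grad (\<lambda>x. f x * g x) = (\<lambda>x. f x *\<^sub>R grad g x + g x *\<^sub>R grad f x)"
proof -
  have d: "((\<lambda>x. f x * g x) has_derivative (\<lambda>h. (f x *\<^sub>R grad g x + g x *\<^sub>R grad f x) \<bullet> h)) (at x)" for x
    by (rule has_derivative_eq_rhs[OF has_derivative_mult[OF C1cD(1)[OF assms(1)] C1cD(1)[OF assms(2)]]])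
       (auto simp: inner_add_left)
  have c: "continuous_on UNIV (\<lambda>x. f x *\<^sub>R grad g x + g x *\<^sub>R grad f x)"
    by (intro continuous_intros C1cD assms)
  have b: "bounded {x. f x * g x \<noteq> 0}"
    using C1cD(4)[OF assms(1)] by (rule bounded_subset) auto
  show "C1c (\<lambda>x. f x * g x)" "grad (\<lambda>x. f x * g x) = (\<lambda>x. f x *\<^sub>R grad g x + g x *\<^sub>R grad f x)"
    using C1cI[OF d c b] by auto
qed

text \<open>
  Up to linear combinations, the family \<open>flat_exp c n\<close>, \<open>n = 0, 1, \<dots>\<close>, is closed under differentiation; hence so
  is the family of the products \<open>bump c a b m n\<close> under partial derivatives, which makes them smooth.
\<close>

definition flat_exp :: "real \<Rightarrow> nat \<Rightarrow> real \<Rightarrow> real" where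
  "flat_exp c n x = (if x > 0 then exp (- c / x) * (1 / x) ^ n else 0)"

text \<open>A single term of the exponential series,
  \<open>exp y \<ge> y ^ (n + 2) / fact (n + 2)\<close> at \<open>y = c / x\<close>. The exponent
  \<open>n + 2\<close> leaves a factor \<open>x\<^sup>2\<close>, one power more than the difference
  quotient at 0 consumes.\<close>

lemma flat_exp_bound:
  assumes "c > 0"
  shows "\<bar>flat_exp c n x\<bar> \<le> fact (n + 2) / c ^ (n + 2) * x\<^sup>2"
proof (cases "x > 0")
  case True
  define y where "y = c / x"
  have y: "y > 0" using True assms by (simp add: y_def)
  have "y ^ (n + 2) / fact (n + 2) \<le> exp y"
  proof -
    have s: "summable (\<lambda>k. y ^ k /\<^sub>R fact k)" by (rule summable_exp_generic)
    have "(\<Sum>k\<in>{n+2}. y ^ k /\<^sub>R fact k) \<le> (\<Sum>k. y ^ k /\<^sub>R fact k)"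
      by (rule sum_le_suminf[OF s]) (use y in auto)
    then show ?thesis by (simp add: exp_def divide_inverse mult.commute)
  qed
  then have "exp (- y) * y ^ (n + 2) \<le> fact (n + 2)"
    by (simp add: exp_minus divide_simps mult.commute del: fact_Suc add_2_eq_Suc')
  then have "exp (- y) * y ^ (n + 2) * (x\<^sup>2 / c ^ (n + 2)) \<le> fact (n + 2) * (x\<^sup>2 / c ^ (n + 2))"
    by (rule mult_right_mono) (use assms in auto)
  moreover have "exp (- y) * y ^ (n + 2) * (x\<^sup>2 / c ^ (n + 2)) = flat_exp c n x"
    using True assms by (simp add: y_def flat_exp_def field_simps power2_eq_square)
  moreover have "flat_exp c n x \<ge> 0" by (simp add: flat_exp_def)
  ultimately show ?thesis by simp
qed (use assms in \<open>auto simp: flat_exp_def\<close>)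

lemma flat_exp_deriv:
  assumes "c > 0"
  shows "(flat_exp c n has_real_derivative (c * flat_exp c (n + 2) x - n * flat_exp c (n + 1) x)) (at x)"
proof -
  consider "x > 0" | "x < 0" | "x = 0" by linarith
  then show ?thesis
  proof cases
    case 1
    have "((\<lambda>x. exp (- c / x) * (1 / x) ^ n) has_real_derivative
        (c * flat_exp c (n + 2) x - n * flat_exp c (n + 1) x)) (at x)"
    \<comment> \<open>The power rule produces the exponent \<open>n - 1\<close>, which is truncated
      at \<open>n = 0\<close>.\<close>
    proof (cases n)
      case 0
      then show ?thesis
        using 1 by (auto intro!: derivative_eq_intros simp: flat_exp_def divide_simps power2_eq_square)
    next
      case (Suc k)
      then have *: "n - Suc 0 = k" by simp
      show ?thesis
        using 1 by (auto intro!: derivative_eq_intros simp: flat_exp_def *)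
          (use Suc in \<open>simp add: divide_simps power2_eq_square\<close>)
    qed
    then show ?thesis
      by (rule has_field_derivative_transform_within_open[where S = "{0<..}"])
         (use 1 in \<open>auto simp: flat_exp_def\<close>)
  next
    case 2
    have "((\<lambda>x. 0) has_real_derivative 0) (at x)" by simp
    then have "(flat_exp c n has_real_derivative 0) (at x)"
      by (rule has_field_derivative_transform_within_open[where S = "{..<0}"])
         (use 2 in \<open>auto simp: flat_exp_def\<close>)
    then show ?thesis using 2 by (simp add: flat_exp_def)
  next
    case 3
    define C where "C = fact (n + 2) / c ^ (n + 2)"
    have "(\<lambda>h. flat_exp c n h / h) \<midarrow>0\<rightarrow> 0"
    proof (rule Lim_null_comparison)
      show "\<forall>\<^sub>F h in at 0. norm (flat_exp c n h / h) \<le> C * \<bar>h\<bar>"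
      proof (rule eventuallyI)
        fix h :: real
        show "norm (flat_exp c n h / h) \<le> C * \<bar>h\<bar>"
          using flat_exp_bound[OF assms, of n h, folded C_def]
          by (cases "h = 0") (auto simp: divide_simps power2_eq_square abs_mult_self_eq mult.assoc)
      qed
      show "(\<lambda>h. C * \<bar>h\<bar>) \<midarrow>0\<rightarrow> 0" by (auto intro!: tendsto_eq_intros)
    qed
    then show ?thesis using 3 by (simp add: DERIV_def flat_exp_def)
  qed
qed

definition bump1 :: "real \<Rightarrow> real \<Rightarrow> real \<Rightarrow> nat \<Rightarrow> nat \<Rightarrow> real \<Rightarrow> real" where
  "bump1 c a b m n t = flat_exp c m (t - a) * flat_exp c n (b - t)"

lemma bump1_deriv:
  assumes "c > 0"
  shows "(bump1 c a b m n has_real_derivative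
     (c * bump1 c a b (m + 2) n t - m * bump1 c a b (m + 1) n t
      - (c * bump1 c a b m (n + 2) t - n * bump1 c a b m (n + 1) t))) (at t)"
  unfolding bump1_def
  by (rule derivative_eq_intros DERIV_chain'[OF _ flat_exp_deriv[OF assms], of _ _ _ UNIV] refl)+
     (simp add: algebra_simps)

text \<open>The parameter \<open>c\<close> is there for approximation: \<open>flat_exp c 0\<close>
  tends to the indicator of the positive half-line as \<open>c\<close> tends to 0, so bumps with
  exponents 0 approximate indicators of boxes.\<close>

definition bump :: "real \<Rightarrow> real ^ 'n \<Rightarrow> real ^ 'n \<Rightarrow> ('n \<Rightarrow> nat) \<Rightarrow> ('n \<Rightarrow> nat) \<Rightarrow> real ^ 'n \<Rightarrow> real" where
  "bump c a b m n x = (\<Prod>i\<in>UNIV. bump1 c (a $ i) (b $ i) (m i) (n i) (x $ i))"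

text \<open>Direction \<open>j\<close> differentiates the \<open>j\<close>-th factor alone, whence
  the four bumps with one raised exponent. Only the values at unit vectors matter, so the derivative
  itself is existentially quantified.\<close>

lemma bump_has_derivative:
  assumes "c > 0"
  shows "\<exists>f'. (bump c a b m n has_derivative f') (at x) \<and>
     f' (axis j 1) = c * bump c a b (m(j := m j + 2)) n x - m j * bump c a b (m(j := m j + 1)) n x
      - (c * bump c a b m (n(j := n j + 2)) x - n j * bump c a b m (n(j := n j + 1)) x)"
proof -
  let ?g = "\<lambda>i. bump1 c (a $ i) (b $ i)"
  let ?d = "\<lambda>i. c * ?g i (m i + 2) (n i) (x $ i) - m i * ?g i (m i + 1) (n i) (x $ i)
      - (c * ?g i (m i) (n i + 2) (x $ i) - n i * ?g i (m i) (n i + 1) (x $ i))"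
  have 1: "((\<lambda>x. ?g i (m i) (n i) (x $ i)) has_derivative (\<lambda>h. ?d i * h $ i)) (at x)" for i
    using bump1_deriv[OF assms, of "a $ i" "b $ i" "m i" "n i" "x $ i"]
    by (auto intro!: has_derivative_compose[of "\<lambda>x. x $ i" "\<lambda>h. h $ i", unfolded o_def] derivative_intros
        bounded_linear_imp_has_derivative bounded_linear_vec_nth simp: has_field_derivative_def)
  have prod_upd: "(\<Prod>i\<in>UNIV. ?g i ((m(j := k)) i) ((n(j := l)) i) (x $ i)) = 
      ?g j k l (x $ j) * (\<Prod>i\<in>UNIV - {j}. ?g i (m i) (n i) (x $ i))" for k l
    by (subst prod.remove[of _ j]) (auto intro!: prod.cong)
  have upd1: "bump c a b (m(j := k)) n x = ?g j k (n j) (x $ j) * (\<Prod>i\<in>UNIV - {j}. ?g i (m i) (n i) (x $ i))" for k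
    using prod_upd[of k "n j"] by (simp add: bump_def)
  have upd2: "bump c a b m (n(j := k)) x = ?g j (m j) k (x $ j) * (\<Prod>i\<in>UNIV - {j}. ?g i (m i) (n i) (x $ i))" for k
    using prod_upd[of "m j" k] by (simp add: bump_def)
  have "(bump c a b m n has_derivative
     (\<lambda>h. \<Sum>i\<in>UNIV. (?d i * h $ i) * (\<Prod>j\<in>UNIV - {i}. ?g j (m j) (n j) (x $ j)))) (at x)"
    unfolding bump_def[abs_def] by (intro has_derivative_prod 1)
  moreover have "(\<Sum>i\<in>UNIV. (?d i * axis j 1 $ i) * (\<Prod>j\<in>UNIV - {i}. ?g j (m j) (n j) (x $ j)))
     = ?d j * (\<Prod>i\<in>UNIV - {j}. ?g i (m i) (n i) (x $ i))"
  proof -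
    have "(\<Sum>i\<in>UNIV. (?d i * axis j 1 $ i) * (\<Prod>j\<in>UNIV - {i}. ?g j (m j) (n j) (x $ j)))
      = (\<Sum>i\<in>UNIV. if i = j then ?d j * (\<Prod>i\<in>UNIV - {j}. ?g i (m i) (n i) (x $ i)) else 0)"
      by (rule sum.cong) (auto simp: axis_def)
    then show ?thesis by simp
  qed
  ultimately show ?thesis unfolding upd1 upd2 by (auto simp: algebra_simps intro!: exI)
qed

lemma Ck_bump:
  assumes "c > 0"
  shows "Ck k (bump c a b m n)"
proof (induction k arbitrary: m n)
  case 0
  show ?case
    using bump_has_derivative[OF assms] has_derivative_continuous
    by (auto intro!: continuous_at_imp_continuous_on) blast
next
  case (Suc k)
  have "bump c a b m n differentiable_on UNIV"
    using bump_has_derivative[OF assms] by (auto simp: differentiable_on_def differentiable_def) blast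
  moreover have "Ck k (partial_deriv j (bump c a b m n))" for j
  proof -
    \<comment> \<open>The coefficients 1 and -1 give the right-hand side the shape of nested
      instances of \<open>Ck_linear\<close>.\<close>
    have "partial_deriv j (bump c a b m n) = (\<lambda>x. 1 * (c * bump c a b (m(j := m j + 2)) n x + (- m j) * bump c a b (m(j := m j + 1)) n x)
      + (-1) * (c * bump c a b m (n(j := n j + 2)) x + (- n j) * bump c a b m (n(j := n j + 1)) x))" (is "_ = ?R")
    proof
      fix x
      show "partial_deriv j (bump c a b m n) x = ?R x"
        using bump_has_derivative[OF assms, of a b m n x j] partial_deriv_unique[of "bump c a b m n"] by fastforce
    qed
    moreover have "Ck k ?R" by (intro Ck_linear Suc)
    ultimately show ?thesis by simp
  qed
  ultimately show ?case by simp
qed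

lemma bump_nonzero_iff: "bump c a b m n x \<noteq> 0 \<longleftrightarrow> x \<in> box a b"
  by (auto simp: bump_def bump1_def flat_exp_def mem_box_cart)

lemma bump_test_function:
  assumes "c > 0" "cbox a b \<subseteq> \<Omega>"
  shows "bump c a b m n \<in> test_functions \<Omega>"
proof -
  have "closure {x. bump c a b m n x \<noteq> 0} \<subseteq> cbox a b"
    by (rule closure_minimal) (auto simp: bump_nonzero_iff box_subset_cbox[THEN subsetD])
  moreover from this have "compact (closure {x. bump c a b m n x \<noteq> 0})"
    by (meson bounded_cbox bounded_subset closed_closure compact_eq_bounded_closed)
  ultimately show ?thesis using assms Ck_bump by (auto simp: test_functions_def)
qed

lemma bump_bound:
  assumes "c > 0"
  shows "\<bar>bump c a b (\<lambda>_. 0) (\<lambda>_. 0) x\<bar> \<le> 1"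
proof -
  have "\<bar>flat_exp c 0 t\<bar> \<le> 1" for t using assms by (auto simp: flat_exp_def)
  then have "\<bar>bump1 c s t 0 0 u\<bar> \<le> 1" for s t u
    by (auto simp: bump1_def abs_mult intro!: mult_le_one)
  then show ?thesis by (auto simp: bump_def abs_prod intro!: prod_le_1)
qed

text \<open>The box shrinks while the bumps steepen. Their supports are then closed boxes inside
  \<open>box a b\<close>, so they are test functions on every open set containing the open box, even
  if it does not contain the closed one.\<close>

lemma inner_bump_tendsto:
  fixes a b :: "real ^ 'n"
  shows "(\<lambda>k. bump (1 / real (Suc k)) (a + vec (1 / real (Suc k))) (b - vec (1 / real (Suc k))) (\<lambda>_. 0) (\<lambda>_. 0) x)
     \<longlonglongrightarrow> indicator (box a b) x"
proof -
  have lim: "(\<lambda>k. 1 / real (Suc k)) \<longlonglongrightarrow> 0"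
    using LIMSEQ_Suc[OF lim_1_over_n] .
  have *: "(\<lambda>k. flat_exp (1 / real (Suc k)) 0 (t - 1 / real (Suc k))) \<longlonglongrightarrow> indicator {0<..} t" for t
  proof (cases "t > 0")
    case True
    have "(\<lambda>k. exp (- (1 / real (Suc k)) / (t - 1 / real (Suc k)))) \<longlonglongrightarrow> exp (- 0 / (t - 0))"
      by (intro tendsto_intros lim) (use True in auto)
    moreover have "\<forall>\<^sub>F k in sequentially. 1 / real (Suc k) < t"
      using order_tendstoD(2)[OF lim True] .
    then have "\<forall>\<^sub>F k in sequentially. exp (- (1 / real (Suc k)) / (t - 1 / real (Suc k))) =
        flat_exp (1 / real (Suc k)) 0 (t - 1 / real (Suc k))"
      by eventually_elim (simp add: flat_exp_def)
    ultimately show ?thesis using True by (simp add: Lim_transform_eventually)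
  next
    case False
    then have "flat_exp (1 / real (Suc k)) 0 (t - 1 / real (Suc k)) = 0" for k
      by (auto simp: flat_exp_def not_less intro: order_trans)
    then show ?thesis using False by simp
  qed
  have "(\<lambda>k. bump (1 / real (Suc k)) (a + vec (1 / real (Suc k))) (b - vec (1 / real (Suc k))) (\<lambda>_. 0) (\<lambda>_. 0) x) \<longlonglongrightarrow>
     (\<Prod>i\<in>UNIV. indicator {0<..} (x $ i - a $ i) * indicator {0<..} (b $ i - x $ i))"
    unfolding bump_def bump1_def
    using tendsto_prod[OF tendsto_mult[OF *[of "x $ _ - a $ _"] *[of "b $ _ - x $ _"]]]
    by (simp add: algebra_simps)
  moreover have "(\<Prod>i\<in>UNIV. indicator {0<..} (x $ i - a $ i) * indicator {0<..} (b $ i - x $ i)) = (indicator (box a b) x :: real)"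
    by (auto simp: indicator_def mem_box_cart)
  ultimately show ?thesis by simp
qed

section \<open>Weak gradients and the fundamental lemma\<close>

text \<open>The definitions integrate over \<open>lebesgue_on \<Omega>\<close>, whereas translation
  invariance and Fubini arguments run over \<open>lborel\<close>. For a Borel function vanishing
  outside the domain, neither the restriction nor the completion changes the integral.\<close>

lemma nn_integral_lebesgue_on:
  fixes f :: "'a::euclidean_space \<Rightarrow> ennreal"
  assumes "f \<in> borel_measurable borel" "\<Omega> \<in> sets lebesgue" "\<And>x. x \<notin> \<Omega> \<Longrightarrow> f x = 0"
  shows "(\<integral>\<^sup>+x. f x \<partial>lebesgue_on \<Omega>) = (\<integral>\<^sup>+x. f x \<partial>lborel)"
proof -
  have "(\<integral>\<^sup>+x. f x \<partial>lebesgue_on \<Omega>) = (\<integral>\<^sup>+x. f x * indicator \<Omega> x \<partial>lebesgue)"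
    using assms(2) by (subst nn_integral_restrict_space) (auto simp: mult.commute)
  also have "\<dots> = (\<integral>\<^sup>+x. f x \<partial>lebesgue)"
    by (rule nn_integral_cong) (use assms(3) in \<open>auto simp: indicator_def\<close>)
  finally show ?thesis by (simp add: nn_integral_completion)
qed

lemma integral_lebesgue_on:
  fixes f :: "'a::euclidean_space \<Rightarrow> 'b::{banach, second_countable_topology}"
  assumes "f \<in> borel_measurable borel" "\<Omega> \<in> sets lebesgue" "\<And>x. x \<notin> \<Omega> \<Longrightarrow> f x = 0"
  shows "integral\<^sup>L (lebesgue_on \<Omega>) f = integral\<^sup>L lborel f"
    and "integrable (lebesgue_on \<Omega>) f \<longleftrightarrow> integrable lborel f"
proof -
  have *: "(\<lambda>x. indicator \<Omega> x *\<^sub>R f x) = f"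
    using assms(3) by (auto simp: indicator_def)
  show "integral\<^sup>L (lebesgue_on \<Omega>) f = integral\<^sup>L lborel f"
    using assms by (simp add: integral_restrict_space * integral_completion)
  show "integrable (lebesgue_on \<Omega>) f \<longleftrightarrow> integrable lborel f"
    using assms by (simp add: integrable_restrict_space * integrable_completion)
qed

lemma integrable_continuous_bounded_support:
  fixes f :: "'a::euclidean_space \<Rightarrow> 'b::{banach, second_countable_topology}"
  assumes "continuous_on UNIV f" "bounded {x. f x \<noteq> 0}"
  shows "integrable lborel f"
proof -
  let ?K = "closure {x. f x \<noteq> 0}"
  have "integrable lborel (\<lambda>x. indicator ?K x *\<^sub>R f x)"
    using assms by (intro borel_integrable_compact) (auto simp: compact_closure intro: continuous_on_subset)
  moreover have "(\<lambda>x. indicator ?K x *\<^sub>R f x) = f"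
    using closure_subset[of "{x. f x \<noteq> 0}"] by (auto simp: indicator_def fun_eq_iff)
  ultimately show ?thesis by simp
qed

lemma C1c_grad_support:
  assumes "C1c f"
  shows "bounded {x. grad f x \<noteq> 0}"
proof -
  have "{x. grad f x \<noteq> 0} \<subseteq> closure {x. f x \<noteq> 0}"
  proof (rule ccontr)
    assume "\<not> {x. grad f x \<noteq> 0} \<subseteq> closure {x. f x \<noteq> 0}"
    then obtain x where x: "grad f x \<noteq> 0" "x \<in> - closure {x. f x \<noteq> 0}" by auto
    have "grad f x = 0"
      by (rule grad_zero_outside[OF _ x(2)]) (use closure_subset[of "{x. f x \<noteq> 0}"] in auto)
    with x show False by simp
  qed
  then show ?thesis
    using C1cD(4)[OF assms] bounded_closure bounded_subset by blast
qed

lemma bounded_range_of_support: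
  fixes f :: "'a::euclidean_space \<Rightarrow> 'b::real_normed_vector"
  assumes "continuous_on UNIV f" "bounded {x. f x \<noteq> 0}"
  obtains B where "B > 0" "\<And>x. norm (f x) \<le> B"
proof -
  have "compact (f ` closure {x. f x \<noteq> 0})"
    using assms by (intro compact_continuous_image) (auto simp: compact_closure intro: continuous_on_subset)
  then obtain B where B: "B > 0" "\<And>y. y \<in> f ` closure {x. f x \<noteq> 0} \<Longrightarrow> norm y \<le> B"
    using compact_imp_bounded bounded_pos by metis
  have "norm (f x) \<le> B" for x
    using B closure_subset[of "{x. f x \<noteq> 0}"] by (cases "f x = 0") auto
  then show ?thesis using B that by blast
qed

lemma C1c_lipschitz:
  assumes "C1c f" "\<And>x. norm (grad f x) \<le> B"
  shows "\<bar>f x - f y\<bar> \<le> B * norm (x - y)"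
proof -
  have "norm (f x - f y) \<le> B * norm (x - y)"
  proof (rule differentiable_bound[of UNIV])
    show "(f has_derivative (\<lambda>h. grad f x \<bullet> h)) (at x within UNIV)" for x
      using C1cD(1)[OF assms(1)] by simp
    show "onorm (\<lambda>h. grad f x \<bullet> h) \<le> B" for x
    proof (rule onorm_le)
      fix h
      show "norm (grad f x \<bullet> h) \<le> B * norm h"
        using Cauchy_Schwarz_ineq2[of "grad f x" h] mult_right_mono[OF assms(2)[of x], of "norm h"] by auto
    qed
  qed auto
  then show ?thesis by simp
qed

lemma integral_partial_deriv_eq_0:
  assumes f: "C1c f"
  shows "(LINT x|lborel. grad f x $ i) = 0"
proof -
  obtain B where B: "B > 0" "\<And>x. norm (grad f x) \<le> B"
    using bounded_range_of_support[OF C1cD(3)[OF f] C1c_grad_support[OF f]] by blast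
  obtain R where R: "\<And>x. f x \<noteq> 0 \<Longrightarrow> norm x \<le> R"
    using C1cD(4)[OF f] by (auto simp: bounded_iff)
  have int: "integrable lborel f"
    using C1cD[OF f] by (intro integrable_continuous_bounded_support)
  have [measurable]: "f \<in> borel_measurable borel" "(\<lambda>x. grad f x $ i) \<in> borel_measurable borel"
    by (intro borel_measurable_continuous_onI continuous_intros C1cD[OF f])+
  define h where "h k = (1 / real (Suc k)) *\<^sub>R (axis i 1 :: real ^ 'a)" for k
  have nh: "norm (h k) = 1 / real (Suc k)" for k by (simp add: h_def)
  define F where "F k x = real (Suc k) * (f (h k + x) - f x)" for k x
  have int': "integrable lborel (\<lambda>x. f (h k + x))" "(LINT x|lborel. f (h k + x)) = (LINT x|lborel. f x)" for k
  proof -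
    have "integrable (distr lborel borel ((+) (h k))) f" using int by (simp add: lborel_distr_plus)
    then show "integrable lborel (\<lambda>x. f (h k + x))" by (subst (asm) integrable_distr_eq) auto
    have "(LINT x|lborel. f x) = (LINT x|distr lborel borel ((+) (h k)). f x)" by (simp add: lborel_distr_plus)
    also have "\<dots> = (LINT x|lborel. f (h k + x))" by (subst integral_distr) auto
    finally show "(LINT x|lborel. f (h k + x)) = (LINT x|lborel. f x)" by simp
  qed
  have 0: "(LINT x|lborel. F k x) = 0" for k
    using int int' by (simp add: F_def)
  \<comment> \<open>By translation invariance, all difference quotients have integral 0.\<close>
  have "(\<lambda>k. LINT x|lborel. F k x) \<longlonglongrightarrow> (LINT x|lborel. grad f x $ i)"
  \<comment> \<open>The Lipschitz constant \<open>B\<close> bounds every difference quotient, and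
    the shifts \<open>h k\<close> have length at most 1, so all quotients vanish outside the ball of
    radius \<open>R + 1\<close>.\<close>
  proof (rule integral_dominated_convergence[where w = "\<lambda>x. indicator (cball 0 (R + 1)) x * B"])
    show "F k \<in> borel_measurable lborel" for k
      unfolding F_def by measurable
    show "integrable lborel (\<lambda>x :: real^'a. indicator (cball 0 (R + 1)) x * B)"
      using emeasure_bounded_finite[of "cball (0 :: real^'a) (R + 1)"] by simp
    show "AE x in lborel. norm (F k x) \<le> indicator (cball 0 (R + 1)) x * B" for k
    proof (rule AE_I2)
      fix x
      show "norm (F k x) \<le> indicator (cball 0 (R + 1)) x * B"
      proof (cases "x \<in> cball 0 (R + 1)")
        case True
        have "\<bar>f (h k + x) - f x\<bar> \<le> B * norm (h k)"
          using C1c_lipschitz[OF f B(2), of "h k + x" x] by simp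
        then have "real (Suc k) * \<bar>f (h k + x) - f x\<bar> \<le> real (Suc k) * (B * norm (h k))"
          by (intro mult_left_mono) auto
        then show ?thesis using True by (simp add: F_def nh abs_mult del: of_nat_Suc)
      next
        case False
        then have "norm x > R + 1" by simp
        moreover have "norm x \<le> norm (h k + x) + norm (h k)" by norm
        moreover have "norm (h k) \<le> 1" by (simp add: nh)
        ultimately have "f x = 0" "f (h k + x) = 0"
          using R[of x] R[of "h k + x"] by linarith+
        then show ?thesis using B(1) by (simp add: F_def indicator_def)
      qed
    qed
    show "AE x in lborel. (\<lambda>k. F k x) \<longlonglongrightarrow> grad f x $ i"
    proof (rule AE_I2)
      fix x
      have "((\<lambda>t. f (x + t *\<^sub>R axis i 1)) has_derivative (\<lambda>t. grad f x \<bullet> (t *\<^sub>R axis i 1))) (at 0)"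
      proof -
        have 1: "((\<lambda>t. x + t *\<^sub>R axis i 1) has_derivative (\<lambda>t. t *\<^sub>R axis i 1)) (at 0)"
          by (auto intro!: derivative_eq_intros)
        show ?thesis
          using has_derivative_compose[OF 1, of f "\<lambda>h. grad f x \<bullet> h"] C1cD(1)[OF f, of x] by simp
      qed
      then have "((\<lambda>t. f (x + t *\<^sub>R axis i 1)) has_real_derivative grad f x $ i) (at 0)"
        unfolding has_field_derivative_def by (rule has_derivative_eq_rhs) (simp add: inner_axis fun_eq_iff)
      then have "(\<lambda>t. (f (x + t *\<^sub>R axis i 1) - f x) / t) \<midarrow>0\<rightarrow> grad f x $ i"
        by (simp add: DERIV_def)
      moreover have "filterlim (\<lambda>k. 1 / real (Suc k)) (at 0) sequentially"
        using LIMSEQ_Suc[OF lim_1_over_n] by (auto simp: filterlim_at intro!: always_eventually)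
      ultimately have "(\<lambda>k. (f (x + (1 / real (Suc k)) *\<^sub>R axis i 1) - f x) / (1 / real (Suc k))) \<longlonglongrightarrow> grad f x $ i"
        by (rule filterlim_compose)
      then show "(\<lambda>k. F k x) \<longlonglongrightarrow> grad f x $ i"
        by (simp add: F_def h_def add.commute mult.commute)
    qed
  qed measurable
  then show ?thesis using 0 by (simp add: LIMSEQ_const_iff)
qed

lemma integral_by_parts:
  assumes "C1c f" "C1c g"
  shows "(LINT x|lborel. f x * grad g x $ i) = - (LINT x|lborel. grad f x $ i * g x)"
proof -
  have 1: "integrable lborel (\<lambda>x. f x * grad g x $ i)" "integrable lborel (\<lambda>x. grad f x $ i * g x)"
    by (intro integrable_continuous_bounded_support continuous_intros C1cD assms
        bounded_subset[OF C1cD(4)[OF assms(1)]]; force)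
       (intro integrable_continuous_bounded_support continuous_intros C1cD assms
        bounded_subset[OF C1cD(4)[OF assms(2)]]; force)
  have "0 = (LINT x|lborel. f x * grad g x $ i + grad f x $ i * g x)"
    using integral_partial_deriv_eq_0[OF C1c_mult(1)[OF assms], of i]
    by (simp add: C1c_mult(2)[OF assms] mult.commute)
  then show ?thesis using 1 by simp
qed

text \<open>Open boxes form an intersection-stable generator of the Borel sets; by induction over
  disjoint unions and complements \<open>f\<close> has integral 0 over every Borel set, which forces
  it to vanish a.e.\<close>

lemma AE_zero_of_box_integrals:
  fixes f :: "'a::euclidean_space \<Rightarrow> real"
  assumes f: "integrable lborel f"
    and box: "\<And>a b. (LINT x|lborel. indicator (box a b) x * f x) = 0"
  shows "AE x in lborel. f x = 0"
proof (rule sigma_finite_measure.density_zero[OF sigma_finite_lborel f])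
  have [measurable]: "f \<in> borel_measurable borel" using f by auto
  let ?G = "range (\<lambda>(a, b). box a b :: 'a set)"
  have G: "Int_stable ?G" "?G \<subseteq> Pow UNIV"
    by (auto simp: Int_stable_def box_Int_box)
  have int: "integrable lborel (\<lambda>x. indicator A x * f x)" if "A \<in> sets borel" for A
    using integrable_mult_indicator[of A lborel f] f that by simp
  \<comment> \<open>The complement step of the induction subtracts from the integral over the whole
    space, which is obtained by exhausting the space with boxes.\<close>
  have all: "(LINT x|lborel. f x) = 0"
  proof -
    let ?A = "\<lambda>n::nat. box (- (real n *\<^sub>R One)) (real n *\<^sub>R One) :: 'a set"
    have "(\<lambda>n. LINT x|lborel. indicator (?A n) x * f x) \<longlonglongrightarrow> (LINT x|lborel. f x)"
    proof (rule integral_dominated_convergence[where w = "\<lambda>x. \<bar>f x\<bar>"])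
      show "AE x in lborel. (\<lambda>n. indicator (?A n) x * f x) \<longlonglongrightarrow> f x"
      proof (rule AE_I2)
        fix x :: 'a
        have "x \<in> (\<Union>n. ?A n)" unfolding UN_box_eq_UNIV by simp
        then obtain N where N: "x \<in> ?A N" by auto
        have "x \<in> ?A n" if "n \<ge> N" for n
        proof -
          have "?A N \<subseteq> ?A n" using that by (intro subset_box_imp) auto
          with N show ?thesis by auto
        qed
        then have "\<forall>\<^sub>F n in sequentially. indicator (?A n) x * f x = f x"
          by (auto simp: eventually_sequentially intro!: exI[of _ N])
        then show "(\<lambda>n. indicator (?A n) x * f x) \<longlonglongrightarrow> f x"
          by (rule tendsto_eventually)
      qed
    qed (use f in \<open>auto simp: indicator_def\<close>)
    then show ?thesis by (simp add: box LIMSEQ_const_iff)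
  qed
  fix A assume "A \<in> sets (lborel :: 'a measure)"
  then have "A \<in> sigma_sets UNIV ?G" by (simp add: borel_eq_box)
  with G have "(LINT x|lborel. indicator A x * f x) = 0"
  proof (induction rule: sigma_sets_induct_disjoint)
    case (basic A)
    then show ?case using box by auto
  next
    case (compl A)
    then have A: "A \<in> sets borel" by (simp add: borel_eq_box)
    have "(LINT x|lborel. indicator (UNIV - A) x * f x) = (LINT x|lborel. f x - indicator A x * f x)"
      by (intro Bochner_Integration.integral_cong) (auto simp: indicator_def)
    then show ?case using f int[OF A] compl all by simp
  next
    case (union A)
    then have A: "A i \<in> sets borel" for i by (auto simp: borel_eq_box)
    have "(\<lambda>n. LINT x|lborel. (\<Sum>i<n. indicator (A i) x * f x)) \<longlonglongrightarrow> (LINT x|lborel. indicator (\<Union>i. A i) x * f x)"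
    proof (rule integral_dominated_convergence[where w = "\<lambda>x. \<bar>f x\<bar>"])
      have eq: "(\<Sum>i<n. indicator (A i) x * f x) = indicator (\<Union>i<n. A i) x * f x" for n x
        unfolding sum_distrib_right[symmetric]
        by (subst indicator_UN_disjoint) (use union(1) in \<open>auto simp: disjoint_family_on_def\<close>)
      show "AE x in lborel. norm (\<Sum>i<n. indicator (A i) x * f x) \<le> \<bar>f x\<bar>" for n
        unfolding eq by (auto simp: indicator_def)
      show "AE x in lborel. (\<lambda>n. \<Sum>i<n. indicator (A i) x * f x) \<longlonglongrightarrow> indicator (\<Union>i. A i) x * f x"
        unfolding eq by (intro AE_I2 tendsto_intros LIMSEQ_indicator_UN)
    qed (use f A in auto)
    moreover have "(LINT x|lborel. (\<Sum>i<n. indicator (A i) x * f x)) = 0" for n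
      using union(3) int[OF A] by (subst Bochner_Integration.integral_sum) auto
    ultimately show ?case by (simp add: LIMSEQ_const_iff del: sum_mult_indicator)
  qed simp
  then show "set_lebesgue_integral lborel A f = 0"
    by (simp add: set_lebesgue_integral_def)
qed

text \<open>The fundamental lemma of the calculus of variations. Bumps bounded by 1 approximate the
  indicator of any open box in the domain, with \<open>\<bar>f x\<bar>\<close> as dominating
  function, so all integrals of \<open>f\<close> over such boxes vanish.\<close>

lemma test_functions_separate:
  fixes f :: "real ^ 'n \<Rightarrow> real"
  assumes \<Omega>: "open \<Omega>" and f: "integrable (lebesgue_on \<Omega>) f"
    and zero: "\<And>\<phi>. \<phi> \<in> test_functions \<Omega> \<Longrightarrow> (LINT x|lebesgue_on \<Omega>. f x * \<phi> x) = 0"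
  shows "AE x in lebesgue_on \<Omega>. f x = 0"
proof -
  have \<Omega>s: "\<Omega> \<in> sets lebesgue" using \<Omega> by auto
  have fm[measurable]: "f \<in> borel_measurable (lebesgue_on \<Omega>)" using f by auto
  have box: "(LINT x|lebesgue_on \<Omega>. indicator (box a b) x * f x) = 0" if "box a b \<subseteq> \<Omega>" for a b
  proof -
    let ?e = "\<lambda>k. 1 / real (Suc k)"
    let ?b = "\<lambda>k. bump (?e k) (a + vec (?e k)) (b - vec (?e k)) (\<lambda>_. 0) (\<lambda>_. 0)"
    have t: "?b k \<in> test_functions \<Omega>" for k
    proof (rule bump_test_function)
      have "cbox (a + vec (?e k)) (b - vec (?e k)) \<subseteq> box a b"
      proof
        fix x assume x: "x \<in> cbox (a + vec (?e k)) (b - vec (?e k))"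
        have "a $ i < x $ i \<and> x $ i < b $ i" for i
        proof -
          have "a $ i + ?e k \<le> x $ i" "x $ i \<le> b $ i - ?e k" "0 < ?e k"
            using x by (simp_all add: mem_box_cart)
          then show ?thesis by linarith
        qed
        then show "x \<in> box a b" by (simp add: mem_box_cart)
      qed
      then show "cbox (a + vec (?e k)) (b - vec (?e k)) \<subseteq> \<Omega>" using that by auto
    qed auto
    have "(\<lambda>k. LINT x|lebesgue_on \<Omega>. ?b k x * f x) \<longlonglongrightarrow> (LINT x|lebesgue_on \<Omega>. indicator (box a b) x * f x)"
    proof (rule integral_dominated_convergence[where w = "\<lambda>x. \<bar>f x\<bar>"])
      show "AE x in lebesgue_on \<Omega>. (\<lambda>k. ?b k x * f x) \<longlonglongrightarrow> indicator (box a b) x * f x"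
        by (intro AE_I2 tendsto_intros inner_bump_tendsto)
      show "AE x in lebesgue_on \<Omega>. norm (?b k x * f x) \<le> \<bar>f x\<bar>" for k
        using bump_bound[of "?e k"] by (intro AE_I2) (auto simp: abs_mult intro!: mult_left_le_one_le)
      show "(\<lambda>x. ?b k x * f x) \<in> borel_measurable (lebesgue_on \<Omega>)" for k
        by (intro borel_measurable_times fm continuous_imp_measurable_on_sets_lebesgue \<Omega>s
            continuous_on_subset[OF C1cD(2)[OF test_functionsD(1)[OF t[of k]]]]) simp
      show "(\<lambda>x. indicator (box a b) x * f x) \<in> borel_measurable (lebesgue_on \<Omega>)"
        by (intro borel_measurable_times fm measurable_restrict_space1 measurable_completion) simp
    qed (use f in auto)
    moreover have "(LINT x|lebesgue_on \<Omega>. ?b k x * f x) = 0" for k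
      using zero[OF t[of k]] by (simp add: mult.commute)
    ultimately show ?thesis by (simp add: LIMSEQ_const_iff)
  qed
  \<comment> \<open>The criterion on boxes lives on \<open>lborel\<close>, so \<open>f\<close>,
    extended by 0, is replaced by a Borel representative \<open>F\<close>.\<close>
  have f0: "integrable lebesgue (\<lambda>x. indicator \<Omega> x * f x)"
    using f \<Omega>s by (simp add: integrable_restrict_space)
  then obtain F where F[measurable]: "F \<in> borel_measurable borel" and eq: "AE x in lborel. indicator \<Omega> x * f x = F x"
    using completion_ex_borel_measurable_real[of "\<lambda>x. indicator \<Omega> x * f x" lborel] by auto
  have eq': "AE x in lebesgue. indicator \<Omega> x * f x = F x" using eq by (rule AE_completion)
  have "integrable lebesgue F"
    using f0 eq' borel_measurable_integrable[OF f0]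
    by (subst (asm) integrable_cong_AE) (auto simp: measurable_completion)
  then have Fi: "integrable lborel F" by (simp add: integrable_completion)
  have z: "AE x in lborel. x \<in> box a b \<longrightarrow> F x = 0" if "box a b \<subseteq> \<Omega>" for a b
  proof -
    have "AE x in lborel. indicator (box a b) x * F x = 0"
    proof (rule AE_zero_of_box_integrals)
      show "integrable lborel (\<lambda>x. indicator (box a b) x * F x)"
        using integrable_mult_indicator[of "box a b" lborel F] Fi by simp
      fix c d
      obtain s t where st: "box c d \<inter> box a b = box s t" by (rule that[OF box_Int_box])
      have "(LINT x|lborel. indicator (box c d) x * (indicator (box a b) x * F x)) = (LINT x|lborel. indicator (box s t) x * F x)"
        by (intro Bochner_Integration.integral_cong) (auto simp: st[symmetric] indicator_def)
      also have "\<dots> = (LINT x|lebesgue. indicator (box s t) x * F x)"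
        by (rule integral_completion[symmetric]) simp
      also have "\<dots> = (LINT x|lebesgue. indicator (box s t) x * (indicator \<Omega> x * f x))"
      proof (rule integral_cong_AE)
        show "(\<lambda>x. indicator (box s t) x * F x) \<in> borel_measurable lebesgue"
          by (rule measurable_completion) simp
        show "(\<lambda>x. indicator (box s t) x * (indicator \<Omega> x * f x)) \<in> borel_measurable lebesgue"
          by (intro borel_measurable_times borel_measurable_integrable[OF f0] measurable_completion) simp
        show "AE x in lebesgue. indicator (box s t) x * F x = indicator (box s t) x * (indicator \<Omega> x * f x)"
          using eq' by eventually_elim simp
      qed
      also have "\<dots> = (LINT x|lebesgue. indicator \<Omega> x * (indicator (box s t) x * f x))"
        by (simp add: mult.left_commute)
      also have "\<dots> = (LINT x|lebesgue_on \<Omega>. indicator (box s t) x * f x)"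
        using \<Omega>s by (simp add: integral_restrict_space)
      also have "\<dots> = 0" using st that by (intro box) auto
      finally show "(LINT x|lborel. indicator (box c d) x * (indicator (box a b) x * F x)) = 0" .
    qed
    then show ?thesis by (rule eventually_mono) (auto simp: indicator_def)
  qed
  \<comment> \<open>Only boxes inside the domain are available; countably many of them cover it, so
    their null sets add up to a null set.\<close>
  obtain D where D: "countable D" "D \<subseteq> Pow \<Omega>" "\<And>X. X \<in> D \<Longrightarrow> \<exists>a b. X = box a b" "\<Union>D = \<Omega>"
    using open_countable_Union_open_box[OF \<Omega>] by blast
  have "AE x in lborel. \<forall>X\<in>D. x \<in> X \<longrightarrow> F x = 0"
    unfolding AE_ball_countable[OF D(1)]
  proof
    fix X assume X: "X \<in> D"
    then obtain a b where ab: "X = box a b" using D(3) by blast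
    show "AE x in lborel. x \<in> X \<longrightarrow> F x = 0"
      unfolding ab by (rule z) (use X D(2) ab in auto)
  qed
  then have "AE x in lborel. x \<in> \<Omega> \<longrightarrow> f x = 0"
    using eq by eventually_elim (use D(4) in \<open>auto simp: indicator_def\<close>)
  then have "AE x in lebesgue. x \<in> \<Omega> \<longrightarrow> f x = 0" by (rule AE_completion)
  then show ?thesis using \<Omega>s by (simp add: AE_restrict_space_iff)
qed

section \<open>The Gagliardo--Nirenberg--Sobolev inequality\<close>

lemma powr_power_pos: "n > 0 \<Longrightarrow> (z powr u) ^ n = z powr (real n * u)" for z u :: real
  by (cases "z = 0") (auto simp: powr_power zero_power)

lemma prod_mono_ennreal:
  fixes f g :: "'a \<Rightarrow> ennreal"
  assumes "\<And>i. i \<in> A \<Longrightarrow> f i \<le> g i"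
  shows "prod f A \<le> prod g A"
  using assms by (induction A rule: infinite_finite_induct) (auto intro!: mult_mono)

text \<open>
  Hoelder's inequality for \<open>card K\<close> equal exponents, raised to the power \<open>card K\<close>: extended nonnegative reals have
  no real powers in the library.
\<close>

lemma nn_integral_Hoelder_prod:
  fixes F :: "'i \<Rightarrow> 'a \<Rightarrow> ennreal" and H :: "'a \<Rightarrow> ennreal"
  assumes K: "finite K" "K \<noteq> {}"
    and [measurable]: "\<And>i. i \<in> K \<Longrightarrow> F i \<in> borel_measurable M"
    and [measurable]: "H \<in> borel_measurable M"
    and le: "\<And>x. x \<in> space M \<Longrightarrow> H x ^ card K \<le> c * (\<Prod>i\<in>K. F i x)"
  shows "(\<integral>\<^sup>+x. H x \<partial>M) ^ card K \<le> c * (\<Prod>i\<in>K. \<integral>\<^sup>+x. F i x \<partial>M)"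
proof -
  define m where "m = card K"
  have m: "m > 0" using K by (simp add: m_def card_gt_0_iff)
  let ?a = "\<lambda>i. \<integral>\<^sup>+x. F i x \<partial>M"
  have H0: "(\<integral>\<^sup>+x. H x \<partial>M) ^ card K \<le> c * (\<Prod>i\<in>K. ?a i)" if "AE x in M. H x = 0"
  proof -
    have "(\<integral>\<^sup>+x. H x \<partial>M) = 0" using that by (simp add: nn_integral_0_iff_AE)
    then show ?thesis using m by (simp add: m_def zero_power)
  qed
  \<comment> \<open>The values 0 and infinity are treated apart, so that in the last case
    \<open>c\<close> and all integrals are positive reals and roots can be taken.\<close>
  consider "c = 0" | i where "i \<in> K" "?a i = 0"
    | "c \<noteq> 0" "\<And>i. i \<in> K \<Longrightarrow> ?a i \<noteq> 0" "c = top \<or> (\<exists>i\<in>K. ?a i = top)"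
    | "c \<noteq> 0" "\<And>i. i \<in> K \<Longrightarrow> ?a i \<noteq> 0" "c \<noteq> top" "\<And>i. i \<in> K \<Longrightarrow> ?a i \<noteq> top"
    by blast
  then show ?thesis
  proof cases
    case 1
    show ?thesis
      by (rule H0) (use le 1 m in \<open>auto simp: m_def\<close>)
  next
    case (2 i)
    then have "AE x in M. F i x = 0" by (simp add: nn_integral_0_iff_AE)
    then have "AE x in M. H x = 0"
    proof (rule AE_mp, intro AE_I2 impI)
      fix x assume x: "x \<in> space M" "F i x = 0"
      then have z: "(\<Prod>i\<in>K. F i x) = 0" using K 2 by auto
      have "H x ^ card K \<le> 0" using le[OF x(1)] unfolding z by simp
      then show "H x = 0" using m by (simp add: m_def)
    qed
    then show ?thesis by (rule H0)
  next
    case 3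
    have "(\<Prod>i\<in>K. ?a i) \<noteq> 0" using 3(2) K by simp
    moreover have "(\<Prod>i\<in>K. ?a i) = top" if "\<exists>i\<in>K. ?a i = top"
      using that 3(2) K by (auto simp: ennreal_prod_eq_top)
    ultimately have "c * (\<Prod>i\<in>K. ?a i) = top"
      using 3(1,3) by (auto simp: ennreal_mult_eq_top_iff)
    then show ?thesis by simp
  next
    case 4
    define cr where "cr = enn2real c"
    define ar where "ar i = enn2real (?a i)" for i
    have c: "c = ennreal cr" "cr > 0"
      using 4(1,3) by (auto simp: cr_def enn2real_positive_iff top.not_eq_extremum zero_less_iff_neq_zero)
    have a: "?a i = ennreal (ar i)" "ar i > 0" if "i \<in> K" for i
      using 4(2,4)[OF that] by (auto simp: ar_def enn2real_positive_iff top.not_eq_extremum zero_less_iff_neq_zero)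
    \<comment> \<open>\<open>T\<close> is the bound to be reached for the integral of
      \<open>H\<close>. With each \<open>F i\<close> divided by its integral \<open>ar i\<close>,
      the arithmetic-geometric mean inequality bounds \<open>H\<close> pointwise by \<open>T\<close>
      times the mean of functions of integral 1.\<close>
    define T where "T = (cr * (\<Prod>i\<in>K. ar i)) powr (1 / m)"
    have P: "(\<Prod>i\<in>K. ar i) > 0" using a(2) by (intro prod_pos) auto
    have T: "T > 0" "T ^ m = cr * (\<Prod>i\<in>K. ar i)"
      using c(2) P m by (simp_all add: T_def powr_power)
    have pw: "H x \<le> ennreal (T / m) * (\<Sum>i\<in>K. ennreal (1 / ar i) * F i x)" if x: "x \<in> space M" for x
    proof (cases "\<exists>i\<in>K. F i x = top")
      case True
      then obtain i where i: "i \<in> K" "F i x = top" by auto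
      have "(\<Sum>i\<in>K. ennreal (1 / ar i) * F i x) = top"
        using i K a(2)[OF i(1)] by (auto simp: ennreal_mult_eq_top_iff intro!: bexI[of _ i])
      then show ?thesis using T m by (simp add: ennreal_mult_eq_top_iff)
    next
      case False
      define f where "f i = enn2real (F i x)" for i
      have f: "F i x = ennreal (f i)" "f i \<ge> 0" if "i \<in> K" for i
        using False that by (auto simp: f_def top.not_eq_extremum)
      have "(\<Prod>i\<in>K. F i x) = ennreal (\<Prod>i\<in>K. f i)"
        using f by (simp add: prod_ennreal)
      then have le': "H x ^ m \<le> ennreal (cr * (\<Prod>i\<in>K. f i))"
        using le[OF x] c f(2) by (simp add: m_def ennreal_mult prod_nonneg)
      then have "H x ^ m \<noteq> top" by (auto simp: top_unique)
      then have "H x \<noteq> top" using m by (auto simp: power_eq_top_ennreal)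
      then obtain h where h: "H x = ennreal h" "h \<ge> 0" by (cases "H x") auto
      have le2: "h ^ m \<le> cr * (\<Prod>i\<in>K. f i)"
        using le' h c f(2) by (simp add: ennreal_power prod_nonneg)
      define y where "y i = f i / ar i" for i
      have y: "y i \<ge> 0" if "i \<in> K" for i using f(2) a(2) that by (simp add: y_def less_imp_le)
      have "cr * (\<Prod>i\<in>K. f i) = T ^ m * (\<Prod>i\<in>K. y i)"
        using P by (simp add: T(2) y_def prod_dividef)
      then have "h ^ m \<le> (T * (\<Prod>i\<in>K. y i) powr (1 / m)) ^ m"
        using le2 m y by (cases "(\<Prod>i\<in>K. y i) = 0") (auto simp: power_mult_distrib powr_power prod_nonneg zero_power)
      then have "h \<le> T * (\<Prod>i\<in>K. y i) powr (1 / m)"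
        using T(1) m by (subst (asm) power_mono_iff) (auto simp: h)
      also have "\<dots> \<le> T * (\<Sum>i\<in>K. y i / m)"
        using arith_geom_mean[OF K y] T(1) by (intro mult_left_mono) (auto simp: m_def)
      also have "\<dots> = T / m * (\<Sum>i\<in>K. 1 / ar i * f i)"
        by (simp add: y_def sum_divide_distrib sum_distrib_left mult.commute)
      finally have "H x \<le> ennreal (T / m * (\<Sum>i\<in>K. 1 / ar i * f i))"
        using h by (simp add: ennreal_leI)
      also have "\<dots> = ennreal (T / m) * (\<Sum>i\<in>K. ennreal (1 / ar i * f i))"
        using T f(2) a(2) by (subst ennreal_mult) (auto simp: sum_nonneg less_imp_le)
      also have "(\<Sum>i\<in>K. ennreal (1 / ar i * f i)) = (\<Sum>i\<in>K. ennreal (1 / ar i) * F i x)"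
        by (rule sum.cong) (use f a(2) in \<open>auto simp flip: ennreal_mult simp: less_imp_le\<close>)
      finally show ?thesis .
    qed
    have "(\<integral>\<^sup>+x. H x \<partial>M) \<le> (\<integral>\<^sup>+x. ennreal (T / m) * (\<Sum>i\<in>K. ennreal (1 / ar i) * F i x) \<partial>M)"
      by (intro nn_integral_mono pw)
    also have "\<dots> = ennreal (T / m) * (\<Sum>i\<in>K. ennreal (1 / ar i) * ?a i)"
      by (subst nn_integral_cmult, simp, subst nn_integral_sum) (auto simp: nn_integral_cmult)
    also have "(\<Sum>i\<in>K. ennreal (1 / ar i) * ?a i) = (\<Sum>i\<in>K. 1)"
    proof (rule sum.cong)
      fix i assume "i \<in> K"
      show "ennreal (1 / ar i) * ?a i = 1"
        using a[OF \<open>i \<in> K\<close>] by (simp flip: ennreal_mult)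
    qed simp
    also have "ennreal (T / m) * (\<Sum>i\<in>K. 1) = ennreal T"
      using m T by (simp add: m_def flip: ennreal_of_nat_eq_real_of_nat) (simp add: ennreal_of_nat_eq_real_of_nat flip: ennreal_mult)
    finally have "(\<integral>\<^sup>+x. H x \<partial>M) ^ m \<le> ennreal T ^ m" by (rule power_mono) simp
    also have "\<dots> = ennreal (cr * (\<Prod>i\<in>K. ar i))"
      using T by (simp add: ennreal_power)
    also have "\<dots> = c * (\<Prod>i\<in>K. ?a i)"
      using c a P by (simp add: ennreal_mult less_imp_le flip: prod_ennreal)
    finally show ?thesis by (simp add: m_def)
  qed
qed

section \<open>Iterated integration over the coordinates\<close>

definition coord_upd :: "real ^ 'n \<Rightarrow> 'n \<Rightarrow> real \<Rightarrow> real ^ 'n" where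
  "coord_upd x i t = (\<chi> j. if j = i then t else x $ j)"

lemma coord_upd_simps[simp]:
  "coord_upd x i t $ j = (if j = i then t else x $ j)"
  "coord_upd (coord_upd x i s) i t = coord_upd x i t"
  "coord_upd x i (x $ i) = x"
  by (auto simp: coord_upd_def vec_eq_iff)

lemma coord_upd_commute: "i \<noteq> j \<Longrightarrow> coord_upd (coord_upd x i s) j t = coord_upd (coord_upd x j t) i s"
  by (auto simp: vec_eq_iff)

lemma coord_upd_measurable[measurable]:
  "(\<lambda>p. coord_upd (fst p) i (snd p)) \<in> borel_measurable (borel \<Otimes>\<^sub>M borel)"
proof -
  have "continuous_on UNIV (\<lambda>p. coord_upd (fst p) i (snd p) $ j)" for j
    by (cases "j = i") (auto intro!: continuous_intros)
  then have "continuous_on UNIV (\<lambda>p :: (real ^ 'a) \<times> real. coord_upd (fst p) i (snd p))"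
    by (auto simp: coord_upd_def intro!: continuous_on_vec_lambda)
  then show ?thesis unfolding borel_prod by (rule borel_measurable_continuous_onI)
qed

lemma coord_upd_measurable2[measurable]: "coord_upd x i \<in> borel_measurable borel"
  using measurable_compose[OF _ coord_upd_measurable[of i], of "\<lambda>t. (x, t)" borel] by simp

text \<open>The result remains a function on the full space, constant in the coordinate
  \<open>i\<close>. Partial integrals over any set of coordinates thus have one type and can be
  multiplied pointwise and exchanged.\<close>

definition coord_integral :: "'n \<Rightarrow> (real ^ 'n \<Rightarrow> ennreal) \<Rightarrow> real ^ 'n \<Rightarrow> ennreal" where
  "coord_integral i f x = (\<integral>\<^sup>+t. f (coord_upd x i t) \<partial>lborel)"

lemma coord_integral_measurable[measurable]:
  assumes [measurable]: "f \<in> borel_measurable borel"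
  shows "coord_integral i f \<in> borel_measurable borel"
proof -
  have "(\<lambda>p. f (coord_upd (fst p) i (snd p))) \<in> borel_measurable (borel \<Otimes>\<^sub>M lborel)"
    using coord_upd_measurable[of i] by measurable
  then show ?thesis
    unfolding coord_integral_def by (intro lborel.borel_measurable_nn_integral) (simp add: case_prod_beta)
qed

lemma coord_integral_upd[simp]: "coord_integral i f (coord_upd x i t) = coord_integral i f x"
  by (simp add: coord_integral_def)

lemma coord_integral_commute:
  assumes "i \<noteq> j" and [measurable]: "f \<in> borel_measurable borel"
  shows "coord_integral i (coord_integral j f) = coord_integral j (coord_integral i f)"
proof
  fix x
  have m: "(\<lambda>p. f (coord_upd (coord_upd x i (fst p)) j (snd p))) \<in> borel_measurable (lborel \<Otimes>\<^sub>M lborel)"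
  proof -
    have "(\<lambda>p. (coord_upd x i (fst p), snd p)) \<in> (lborel \<Otimes>\<^sub>M lborel) \<rightarrow>\<^sub>M (borel \<Otimes>\<^sub>M borel)"
      by measurable
    from measurable_compose[OF measurable_compose[OF this coord_upd_measurable[of j]] assms(2)] show ?thesis
      by simp
  qed
  have "coord_integral i (coord_integral j f) x = (\<integral>\<^sup>+s. \<integral>\<^sup>+t. f (coord_upd (coord_upd x i s) j t) \<partial>lborel \<partial>lborel)"
    by (simp add: coord_integral_def)
  also have "\<dots> = (\<integral>\<^sup>+t. \<integral>\<^sup>+s. f (coord_upd (coord_upd x i s) j t) \<partial>lborel \<partial>lborel)"
    using m by (intro lborel_pair.Fubini'[symmetric]) (simp add: case_prod_beta)
  also have "\<dots> = coord_integral j (coord_integral i f) x"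
    using assms(1) by (simp add: coord_integral_def coord_upd_commute)
  finally show "coord_integral i (coord_integral j f) x = coord_integral j (coord_integral i f) x" .
qed

primrec coord_integrals :: "'n list \<Rightarrow> (real ^ 'n \<Rightarrow> ennreal) \<Rightarrow> real ^ 'n \<Rightarrow> ennreal" where
  "coord_integrals [] f = f"
| "coord_integrals (i # is) f = coord_integral i (coord_integrals is f)"

lemma coord_integrals_measurable[measurable]:
  "f \<in> borel_measurable borel \<Longrightarrow> coord_integrals J f \<in> borel_measurable borel"
  by (induction J) auto

lemma coord_integrals_commute:
  assumes "f \<in> borel_measurable borel" "j \<notin> set J"
  shows "coord_integrals J (coord_integral j f) = coord_integral j (coord_integrals J f)"
  using assms(2)
proof (induction J)
  case (Cons i J)
  then show ?case
    using coord_integral_commute[of i j "coord_integrals J f"] assms(1) by auto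
qed simp

lemma vec_lambda_measurable:
  fixes f :: "'n::finite \<Rightarrow> 'a \<Rightarrow> real"
  assumes "\<And>i. f i \<in> borel_measurable M"
  shows "(\<lambda>x. \<chi> i. f i x) \<in> borel_measurable M"
  by (subst borel_measurable_euclidean_space) (auto simp: Basis_vec_def inner_axis assms)

text \<open>By induction on the list, one factor of the product measure is split off per coordinate.
  With \<open>lborel_eq_distr_PiM\<close> it identifies the integral over all coordinates with the
  Lebesgue integral.\<close>

lemma coord_integrals_PiM:
  assumes "distinct J" and f[measurable]: "f \<in> borel_measurable borel"
  shows "coord_integrals J f x = (\<integral>\<^sup>+y. f (\<chi> i. if i \<in> set J then y i else x $ i) \<partial>(\<Pi>\<^sub>M i\<in>set J. lborel))"
  using assms(1)
proof (induction J arbitrary: x)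
  case Nil
  show ?case by (simp add: PiM_empty nn_integral_count_space_finite)
next
  case (Cons j J)
  interpret product_sigma_finite "\<lambda>_. lborel :: real measure" ..
  let ?h = "\<lambda>y. f (\<chi> i. if i \<in> insert j (set J) then y i else x $ i)"
  have m: "?h \<in> borel_measurable (\<Pi>\<^sub>M i\<in>insert j (set J). lborel)"
  proof (rule measurable_compose[OF _ f], rule vec_lambda_measurable)
    fix i
    show "(\<lambda>y. if i \<in> insert j (set J) then y i else x $ i) \<in> borel_measurable (\<Pi>\<^sub>M i\<in>insert j (set J). lborel)"
      by (cases "i \<in> insert j (set J)") (auto intro: measurable_component_singleton[of i _ "\<lambda>_. lborel", simplified])
  qed
  have "coord_integrals (j # J) f x = (\<integral>\<^sup>+t. coord_integrals J f (coord_upd x j t) \<partial>lborel)"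
    by (simp add: coord_integral_def)
  also have "\<dots> = (\<integral>\<^sup>+t. \<integral>\<^sup>+y. ?h (y(j := t)) \<partial>(\<Pi>\<^sub>M i\<in>set J. lborel) \<partial>lborel)"
  proof (rule nn_integral_cong)
    fix t
    have "(\<chi> i. if i \<in> set J then y i else coord_upd x j t $ i) =
        (\<chi> i. if i \<in> insert j (set J) then (y(j := t)) i else x $ i)" for y
      using Cons.prems by (auto simp: vec_eq_iff)
    then show "coord_integrals J f (coord_upd x j t) = (\<integral>\<^sup>+y. ?h (y(j := t)) \<partial>(\<Pi>\<^sub>M i\<in>set J. lborel))"
      using Cons by simp
  qed
  also have "\<dots> = (\<integral>\<^sup>+y. ?h y \<partial>(\<Pi>\<^sub>M i\<in>insert j (set J). lborel))"
    using Cons.prems m by (subst product_nn_integral_insert_rev) auto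
  finally show ?case by simp
qed

text \<open>Lebesgue measure is determined by its values on boxes, and there the product measure
  gives the product of the side lengths.\<close>

lemma lborel_eq_distr_PiM:
  "(lborel :: (real ^ 'n) measure) = distr (\<Pi>\<^sub>M i\<in>UNIV. lborel) borel (\<lambda>y. \<chi> i. y i)"
proof (rule lborel_eqI)
  interpret finite_product_sigma_finite "\<lambda>_. lborel :: real measure" "UNIV :: 'n set" by standard simp
  have m: "(\<lambda>y. \<chi> i. y i) \<in> borel_measurable (\<Pi>\<^sub>M i\<in>(UNIV :: 'n set). (lborel :: real measure))"
    by (rule vec_lambda_measurable) measurable
  have B: "(Basis :: (real ^ 'n) set) = (\<lambda>i. axis i 1) ` UNIV"
    by (auto simp: Basis_vec_def)
  have inj: "inj (\<lambda>i :: 'n. axis i (1 :: real))"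
    by (auto simp: inj_on_def axis_eq_axis)
  fix l u :: "real ^ 'n" assume lu: "\<And>b. b \<in> Basis \<Longrightarrow> l \<bullet> b \<le> u \<bullet> b"
  then have lu': "l $ i \<le> u $ i" for i using lu[of "axis i 1"] by (simp add: inner_axis B)
  have "emeasure (distr (\<Pi>\<^sub>M i\<in>UNIV. lborel) borel (\<lambda>y. \<chi> i. y i)) (box l u) =
      emeasure (\<Pi>\<^sub>M i\<in>UNIV. lborel) ((\<lambda>y. \<chi> i. y i) -` box l u \<inter> space (\<Pi>\<^sub>M i\<in>UNIV. lborel))"
    using m by (subst emeasure_distr) auto
  also have "(\<lambda>y. \<chi> i. y i) -` box l u \<inter> space (\<Pi>\<^sub>M i\<in>(UNIV :: 'n set). (lborel :: real measure)) = (\<Pi>\<^sub>E i\<in>UNIV. box (l $ i) (u $ i))"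
    by (auto simp: space_PiM mem_box_cart PiE_def Pi_def)
  also have "emeasure (\<Pi>\<^sub>M i\<in>UNIV. lborel) (\<Pi>\<^sub>E i\<in>UNIV. box (l $ i) (u $ i)) = (\<Prod>i\<in>UNIV. emeasure lborel (box (l $ i) (u $ i)))"
    by (subst measure_times) auto
  also have "\<dots> = (\<Prod>i\<in>UNIV. ennreal (u $ i - l $ i))"
    using lu' by (simp add: box_real)
  also have "\<dots> = ennreal (\<Prod>i\<in>UNIV. u $ i - l $ i)"
    using lu' by (simp add: prod_ennreal)
  also have "(\<Prod>i\<in>UNIV. u $ i - l $ i) = (\<Prod>b\<in>Basis. (u - l) \<bullet> b)"
    unfolding B by (subst prod.reindex[OF inj]) (simp add: inner_axis)
  finally show "emeasure (distr (\<Pi>\<^sub>M i\<in>UNIV. lborel) borel (\<lambda>y. \<chi> i. y i)) (box l u) = (\<Prod>b\<in>Basis. (u - l) \<bullet> b)" .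
qed simp

lemma coord_integrals_UNIV:
  fixes f :: "real ^ 'n \<Rightarrow> ennreal"
  assumes "distinct J" "set J = UNIV" and f[measurable]: "f \<in> borel_measurable borel"
  shows "coord_integrals J f x = (\<integral>\<^sup>+y. f y \<partial>lborel)"
proof -
  have m: "(\<lambda>y. \<chi> i. y i) \<in> borel_measurable (\<Pi>\<^sub>M i\<in>(UNIV :: 'n set). (lborel :: real measure))"
    by (rule vec_lambda_measurable) measurable
  have "(\<integral>\<^sup>+y. f y \<partial>lborel) = (\<integral>\<^sup>+y. f (\<chi> i. y i) \<partial>(\<Pi>\<^sub>M i\<in>UNIV. lborel))"
    using m by (subst lborel_eq_distr_PiM, subst nn_integral_distr) auto
  then show ?thesis
    using coord_integrals_PiM[OF assms(1) f, of x] assms(2) by simp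
qed

text \<open>
  The coordinates are integrated one after the other. After those in \<open>J\<close>, the \<open>i\<close>-th factor is \<open>C J i\<close>; integrating
  the coordinate \<open>j\<close> leaves \<open>C J j\<close> alone, which does not depend on it, and Hoelder's inequality applies to the
  \<open>CARD('n) - 1\<close> other factors.
\<close>

lemma gagliardo:
  fixes F :: "real ^ 'n \<Rightarrow> ennreal" and g :: "'n \<Rightarrow> real ^ 'n \<Rightarrow> ennreal"
  assumes n: "CARD('n) \<ge> 2"
    and [measurable]: "F \<in> borel_measurable borel" "\<And>i. g i \<in> borel_measurable borel"
    and le: "\<And>x. F x ^ (CARD('n) - 1) \<le> (\<Prod>i\<in>UNIV. coord_integral i (g i) x)"
  shows "(\<integral>\<^sup>+x. F x \<partial>lborel) ^ (CARD('n) - 1) \<le> (\<Prod>i\<in>UNIV. \<integral>\<^sup>+x. g i x \<partial>lborel)"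
proof -
  define C where "C J i = (if i \<in> set J then coord_integrals J (g i) else coord_integrals J (coord_integral i (g i)))" for J i
  have Cm[measurable]: "C J i \<in> borel_measurable borel" for J i by (simp add: C_def)
  have *: "coord_integrals J F x ^ (CARD('n) - 1) \<le> (\<Prod>i\<in>UNIV. C J i x)" if "distinct J" for J x
    using that
  proof (induction J arbitrary: x)
    case Nil
    then show ?case using le by (simp add: C_def)
  next
    case (Cons j J)
    let ?K = "UNIV - {j}"
    have K: "card ?K = CARD('n) - 1" "?K \<noteq> {}"
    proof -
      show c: "card ?K = CARD('n) - 1" by simp
      show "?K \<noteq> {}" using n c by (metis One_nat_def Suc_1 card.empty diff_is_0_eq not_less_eq_eq)
    qed
    \<comment> \<open>Since \<open>j\<close> does not occur in \<open>J\<close>, its integration can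
      be moved outermost, which makes this factor constant along the line of integration.\<close>
    have Cj: "C J j = coord_integral j (coord_integrals J (g j))"
      using Cons.prems by (simp add: C_def coord_integrals_commute)
    have "(\<integral>\<^sup>+t. coord_integrals J F (coord_upd x j t) \<partial>lborel) ^ card ?K \<le>
        C J j x * (\<Prod>i\<in>?K. \<integral>\<^sup>+t. C J i (coord_upd x j t) \<partial>lborel)"
    proof (rule nn_integral_Hoelder_prod)
      fix t
      have "coord_integrals J F (coord_upd x j t) ^ card ?K \<le> (\<Prod>i\<in>UNIV. C J i (coord_upd x j t))"
        using Cons K by simp
      also have "\<dots> = C J j (coord_upd x j t) * (\<Prod>i\<in>?K. C J i (coord_upd x j t))"
        by (subst prod.remove[of UNIV j]) auto
      also have "C J j (coord_upd x j t) = C J j x" by (simp add: Cj)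
      finally show "coord_integrals J F (coord_upd x j t) ^ card ?K \<le> C J j x * (\<Prod>i\<in>?K. C J i (coord_upd x j t))" .
    qed (use K in auto)
    also have "(\<Prod>i\<in>?K. \<integral>\<^sup>+t. C J i (coord_upd x j t) \<partial>lborel) = (\<Prod>i\<in>?K. C (j # J) i x)"
      by (rule prod.cong) (auto simp: C_def coord_integral_def)
    also have "C J j x = C (j # J) j x"
      unfolding Cj by (simp add: C_def)
    also have "C (j # J) j x * (\<Prod>i\<in>?K. C (j # J) i x) = (\<Prod>i\<in>UNIV. C (j # J) i x)"
      by (subst prod.remove[of UNIV j]) auto
    finally show ?case by (simp add: K(1) coord_integral_def)
  qed
  obtain J where J: "distinct J" "set J = (UNIV :: 'n set)"
    using finite_distinct_list[of "UNIV :: 'n set"] by auto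
  show ?thesis
    using *[OF J(1), of 0] J by (simp add: coord_integrals_UNIV C_def)
qed

text \<open>At \<open>y = 0\<close> the formula evaluates to 0 whatever the sign of
  \<open>s - 2\<close>, which is the right value for \<open>s > 1\<close>. Exponents between 1 and 2
  do occur: the Kirchhoff term is differentiated with exponent \<open>q / 2\<close>, possibly where
  the Dirichlet integral vanishes.\<close>

lemma has_real_derivative_abs_powr:
  fixes y s :: real
  assumes "s > 1"
  shows "((\<lambda>y. \<bar>y\<bar> powr s) has_real_derivative (s * \<bar>y\<bar> powr (s - 2) * y)) (at y)"
proof -
  consider "y > 0" | "y < 0" | "y = 0" by linarith
  then show ?thesis
  proof cases
    case 1
    have "((\<lambda>y. y powr s) has_real_derivative (s * y powr (s - 2) * y)) (at y)"
      using 1 by (auto intro!: derivative_eq_intros simp: powr_diff divide_simps power2_eq_square powr_numeral)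
    then show ?thesis
      by (rule has_field_derivative_transform_within_open[where S = "{0<..}", THEN DERIV_cong]) (use 1 in auto)
  next
    case 2
    have "((\<lambda>y. (- y) powr s) has_real_derivative (s * (- y) powr (s - 2) * y)) (at y)"
      using 2 by (auto intro!: derivative_eq_intros simp: powr_diff divide_simps power2_eq_square powr_numeral)
    then show ?thesis
      by (rule has_field_derivative_transform_within_open[where S = "{..<0}", THEN DERIV_cong]) (use 2 in auto)
  next
    case 3
    have "(\<lambda>h. \<bar>h\<bar> powr s / h) \<midarrow>0\<rightarrow> 0"
    proof (rule Lim_null_comparison)
      show "\<forall>\<^sub>F h in at 0. norm (\<bar>h\<bar> powr s / h) \<le> \<bar>h\<bar> powr (s - 1)"
        by (intro always_eventually allI) (auto simp: powr_diff)
      have "((\<lambda>h. \<bar>h\<bar> powr (s - 1)) \<longlongrightarrow> \<bar>0\<bar> powr (s - 1)) (at (0 :: real))"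
        using assms by (intro tendsto_powr' tendsto_intros) auto
      then show "((\<lambda>h. \<bar>h\<bar> powr (s - 1)) \<longlongrightarrow> 0) (at (0 :: real))" by simp
    qed
    then show ?thesis using 3 assms by (simp add: DERIV_def)
  qed
qed

text \<open>Holds without a condition on \<open>r\<close>: at \<open>y = 0\<close> both sides are 0,
  as \<open>0 powr r = 0\<close> for every \<open>r\<close>.\<close>

lemma abs_powr_mult_abs: "\<bar>y\<bar> powr (r - 1) * \<bar>y\<bar> = \<bar>y\<bar> powr (r :: real)" for y :: real
  by (cases "y = 0") (auto simp: powr_diff)

text \<open>The fundamental theorem of calculus along the \<open>i\<close>-th coordinate line,
  started outside the support. With \<open>s > 2\<close> the derivative of
  \<open>\<bar>\<phi>\<bar> powr s\<close> along the line is continuous.\<close>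

lemma abs_powr_le_coord_integral:
  fixes \<phi> :: "real ^ 'n \<Rightarrow> real"
  assumes \<phi>: "C1c \<phi>" and s: "s > 2"
  shows "ennreal (\<bar>\<phi> x\<bar> powr s) \<le> coord_integral i (\<lambda>x. ennreal (s * \<bar>\<phi> x\<bar> powr (s - 1) * \<bar>grad \<phi> x $ i\<bar>)) x"
proof -
  obtain R where R: "\<And>x. \<phi> x \<noteq> 0 \<Longrightarrow> norm x \<le> R"
    using C1cD(4)[OF \<phi>] by (auto simp: bounded_iff)
  define w where "w t = \<bar>\<phi> (coord_upd x i t)\<bar> powr s" for t
  define w' where "w' t = s * \<bar>\<phi> (coord_upd x i t)\<bar> powr (s - 2) * \<phi> (coord_upd x i t) * grad \<phi> (coord_upd x i t) $ i" for t
  \<comment> \<open>A starting point to the left of \<open>x $ i\<close> whose modulus exceeds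
    \<open>R\<close>, hence outside the support.\<close>
  define t0 where "t0 = - (\<bar>x $ i\<bar> + \<bar>R\<bar> + 1)"
  have t0: "t0 \<le> x $ i" by (simp add: t0_def)
  define z where "z = coord_upd x i 0"
  have upd: "coord_upd x i = (\<lambda>t. z + t *\<^sub>R axis i 1)"
    by (auto simp: vec_eq_iff axis_def z_def)
  have du: "(coord_upd x i has_derivative (\<lambda>h. h *\<^sub>R axis i 1)) (at t)" for t
    unfolding upd by (auto intro!: derivative_eq_intros)
  have cu: "continuous_on S (coord_upd x i)" for S
    unfolding upd by (intro continuous_intros)
  have d\<phi>: "((\<lambda>t. \<phi> (coord_upd x i t)) has_real_derivative (grad \<phi> (coord_upd x i t) $ i)) (at t)" for t
    unfolding has_field_derivative_def
    by (rule has_derivative_eq_rhs[OF has_derivative_compose[OF du C1cD(1)[OF \<phi>]]]) (simp add: inner_axis fun_eq_iff)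
  have dw: "(w has_real_derivative w' t) (at t)" for t
    unfolding w_def[abs_def] w'_def
    by (rule DERIV_chain2[OF has_real_derivative_abs_powr d\<phi>]) (use s in auto)
  have cw: "continuous_on {t0..x $ i} w'"
    unfolding w'_def
    by (intro continuous_intros continuous_on_powr' continuous_on_compose2[OF C1cD(2)[OF \<phi>] cu] continuous_on_compose2[OF C1cD(3)[OF \<phi>] cu])
       (use s in auto)
  have "\<phi> (coord_upd x i t0) = 0"
  proof (rule ccontr)
    assume "\<phi> (coord_upd x i t0) \<noteq> 0"
    then have "norm (coord_upd x i t0) \<le> R" by (rule R)
    moreover have "\<bar>coord_upd x i t0 $ i\<bar> \<le> norm (coord_upd x i t0)" by (rule component_le_norm_cart)
    ultimately show False by (simp add: t0_def)
  qed
  then have "w t0 = 0" by (simp add: w_def)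
  then have eq: "(LINT t|lborel. indicator {t0..x $ i} t *\<^sub>R w' t) = w (x $ i)"
    using integral_FTC_atLeastAtMost[OF t0 _ cw, of w] dw
    by (simp add: has_field_derivative_at_within has_real_derivative_iff_has_vector_derivative[symmetric])
  have int: "integrable lborel (\<lambda>t. indicator {t0..x $ i} t *\<^sub>R w' t)"
    by (rule borel_integrable_compact[OF compact_Icc cw])
  have "ennreal (\<bar>\<phi> x\<bar> powr s) = ennreal (norm (LINT t|lborel. indicator {t0..x $ i} t *\<^sub>R w' t))"
    unfolding eq by (simp add: w_def)
  also have "\<dots> \<le> (\<integral>\<^sup>+t. ennreal (norm (indicator {t0..x $ i} t *\<^sub>R w' t)) \<partial>lborel)"
    by (rule integral_norm_bound_ennreal[OF int])
  also have "\<dots> \<le> (\<integral>\<^sup>+t. ennreal (s * \<bar>\<phi> (coord_upd x i t)\<bar> powr (s - 1) * \<bar>grad \<phi> (coord_upd x i t) $ i\<bar>) \<partial>lborel)"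
  proof (intro nn_integral_mono ennreal_leI)
    fix t
    have "norm (w' t) = s * \<bar>\<phi> (coord_upd x i t)\<bar> powr (s - 1) * \<bar>grad \<phi> (coord_upd x i t) $ i\<bar>"
      using s abs_powr_mult_abs[of "\<phi> (coord_upd x i t)" "s - 1"] by (simp add: w'_def abs_mult mult.assoc)
    moreover have "norm (indicator {t0..x $ i} t *\<^sub>R w' t) \<le> norm (w' t)" by (auto simp: indicator_def)
    ultimately show "norm (indicator {t0..x $ i} t *\<^sub>R w' t) \<le> s * \<bar>\<phi> (coord_upd x i t)\<bar> powr (s - 1) * \<bar>grad \<phi> (coord_upd x i t) $ i\<bar>"
      by simp
  qed
  finally show ?thesis by (simp add: coord_integral_def)
qed

text \<open>The exponent \<open>s\<close> satisfies both \<open>s * N = q * (N - 1)\<close> and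
  \<open>2 * (s - 1) = q\<close>. By the first identity Gagliardo's inequality applies to
  \<open>\<bar>\<phi>\<bar> powr q\<close> with factors \<open>s * \<bar>\<phi>\<bar> powr (s - 1) *
  \<bar>grad \<phi> x $ i\<bar>\<close>; by the second, the Cauchy-Schwarz inequality for these
  factors reproduces the integral \<open>a\<close> that is being estimated.\<close>

lemma sobolev_C1c:
  fixes \<phi> :: "real ^ 'n \<Rightarrow> real"
  assumes N: "CARD('n) \<ge> 3" and \<phi>: "C1c \<phi>"
  defines "N \<equiv> real CARD('n)"
  defines "s \<equiv> 2 * (N - 1) / (N - 2)" and "q \<equiv> crit_exp CARD('n)"
  shows "(LINT x|lborel. \<bar>\<phi> x\<bar> powr q) \<le> (s\<^sup>2 * (LINT x|lborel. (norm (grad \<phi> x))\<^sup>2)) powr (q / 2)"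
proof -
  define n where "n = CARD('n)"
  have n: "n \<ge> 3" "N = real n" using N by (simp_all add: N_def n_def)
  have s: "s > 2" using n by (simp add: s_def field_simps)
  have q: "q > 2" "q = s * N / (N - 1)" "q = 2 * s - 2" "q / 2 = N / (N - 2)"
  proof -
    have N3: "N - 2 > 0" "N - 1 > 0" using n by auto
    have qN: "q = 2 * N / (N - 2)" by (simp add: q_def crit_exp_def N_def)
    show "q > 2" using N3 by (simp add: qN field_simps)
    have "q * (N - 1) = s * N" by (simp add: qN s_def algebra_simps)
    then show "q = s * N / (N - 1)" using N3 by (simp add: nonzero_eq_divide_eq)
    show "q = 2 * s - 2" using N3 by (simp add: qN s_def field_simps)
    show "q / 2 = N / (N - 2)" using N3 by (simp add: qN field_simps)
  qed
  have [measurable]: "\<phi> \<in> borel_measurable borel" "\<And>i. (\<lambda>x. grad \<phi> x $ i) \<in> borel_measurable borel" "grad \<phi> \<in> borel_measurable borel"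
    by (intro borel_measurable_continuous_onI continuous_intros C1cD[OF \<phi>])+
  have int: "integrable lborel (\<lambda>x. \<bar>\<phi> x\<bar> powr q)"
    by (intro integrable_continuous_bounded_support continuous_on_powr' continuous_intros C1cD[OF \<phi>])
       (use q C1cD(4)[OF \<phi>] in auto)
  have intD: "integrable lborel (\<lambda>x. (norm (grad \<phi> x))\<^sup>2)"
    by (intro integrable_continuous_bounded_support continuous_intros C1cD[OF \<phi>])
       (use C1c_grad_support[OF \<phi>] in auto)
  define a where "a = (LINT x|lborel. \<bar>\<phi> x\<bar> powr q)"
  define d where "d = (LINT x|lborel. (norm (grad \<phi> x))\<^sup>2)"
  have a0: "a \<ge> 0" and d0: "d \<ge> 0" by (simp_all add: a_def d_def)
  have A: "(\<integral>\<^sup>+x. ennreal (\<bar>\<phi> x\<bar> powr q) \<partial>lborel) = ennreal a"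
    unfolding a_def by (rule nn_integral_eq_integral[OF int]) simp
  have D: "(\<integral>\<^sup>+x. ennreal ((norm (grad \<phi> x))\<^sup>2) \<partial>lborel) = ennreal d"
    unfolding d_def by (rule nn_integral_eq_integral[OF intD]) simp
  define g where "g i x = ennreal (s * \<bar>\<phi> x\<bar> powr (s - 1) * \<bar>grad \<phi> x $ i\<bar>)" for i x
  have gm[measurable]: "g i \<in> borel_measurable borel" for i unfolding g_def by measurable
  have B: "(\<integral>\<^sup>+x. g i x \<partial>lborel)\<^sup>2 \<le> ennreal (s\<^sup>2 * a * d)" for i
  proof -
    have "(\<integral>\<^sup>+x. g i x \<partial>lborel)\<^sup>2 = (\<integral>\<^sup>+x. ennreal (s * \<bar>\<phi> x\<bar> powr (s - 1)) * ennreal \<bar>grad \<phi> x $ i\<bar> \<partial>lborel)\<^sup>2"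
      unfolding g_def using s by (simp add: ennreal_mult)
    also have "\<dots> \<le> (\<integral>\<^sup>+x. (ennreal (s * \<bar>\<phi> x\<bar> powr (s - 1)))\<^sup>2 \<partial>lborel) * (\<integral>\<^sup>+x. (ennreal \<bar>grad \<phi> x $ i\<bar>)\<^sup>2 \<partial>lborel)"
      by (rule Cauchy_Schwarz_nn_integral) measurable
    also have "(\<integral>\<^sup>+x. (ennreal (s * \<bar>\<phi> x\<bar> powr (s - 1)))\<^sup>2 \<partial>lborel) = (\<integral>\<^sup>+x. ennreal (s\<^sup>2) * ennreal (\<bar>\<phi> x\<bar> powr q) \<partial>lborel)"
    proof (rule nn_integral_cong)
      fix x
      have "(\<bar>\<phi> x\<bar> powr (s - 1))\<^sup>2 = \<bar>\<phi> x\<bar> powr q"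
        by (simp add: power2_eq_square q(3) flip: powr_add)
      then show "(ennreal (s * \<bar>\<phi> x\<bar> powr (s - 1)))\<^sup>2 = ennreal (s\<^sup>2) * ennreal (\<bar>\<phi> x\<bar> powr q)"
        using s by (simp add: ennreal_power power_mult_distrib flip: ennreal_mult)
    qed
    also have "\<dots> = ennreal (s\<^sup>2) * ennreal a" by (simp add: nn_integral_cmult A)
    also have "(\<integral>\<^sup>+x. (ennreal \<bar>grad \<phi> x $ i\<bar>)\<^sup>2 \<partial>lborel) \<le> ennreal d"
      unfolding D[symmetric]
      by (intro nn_integral_mono, subst ennreal_power, simp, intro ennreal_leI power_mono component_le_norm_cart abs_ge_zero)
    finally show ?thesis using a0 d0 by (simp add: ennreal_mult mult_left_mono)
  qed
  have "(\<integral>\<^sup>+x. ennreal (\<bar>\<phi> x\<bar> powr q) \<partial>lborel) ^ (CARD('n) - 1) \<le> (\<Prod>i\<in>UNIV. \<integral>\<^sup>+x. g i x \<partial>lborel)"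
  proof (rule gagliardo)
    fix x
    have "ennreal (\<bar>\<phi> x\<bar> powr q) ^ (CARD('n) - 1) = ennreal (\<bar>\<phi> x\<bar> powr (s * n))"
    proof -
      have "real (n - 1) * q = s * n" using n by (simp add: q(2) of_nat_diff field_simps)
      moreover have "(\<bar>\<phi> x\<bar> powr q) ^ (n - 1) = \<bar>\<phi> x\<bar> powr (real (n - 1) * q)"
        using n by (simp add: powr_power_pos)
      ultimately show ?thesis by (simp only: ennreal_power powr_ge_zero n_def[symmetric])
    qed
    also have "\<dots> = (\<Prod>i\<in>(UNIV :: 'n set). ennreal (\<bar>\<phi> x\<bar> powr s))"
      using n by (simp add: ennreal_power powr_power_pos n_def[symmetric] mult.commute)
    also have "\<dots> \<le> (\<Prod>i\<in>UNIV. coord_integral i (g i) x)"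
      unfolding g_def by (intro prod_mono_ennreal abs_powr_le_coord_integral \<phi> s)
    finally show "ennreal (\<bar>\<phi> x\<bar> powr q) ^ (CARD('n) - 1) \<le> (\<Prod>i\<in>UNIV. coord_integral i (g i) x)" .
  qed (use N in auto)
  then have "ennreal a ^ (n - 1) \<le> (\<Prod>i\<in>UNIV. \<integral>\<^sup>+x. g i x \<partial>lborel)" by (simp add: A n_def)
  then have "(ennreal a ^ (n - 1))\<^sup>2 \<le> (\<Prod>i\<in>UNIV. \<integral>\<^sup>+x. g i x \<partial>lborel)\<^sup>2" by (rule power_mono) simp
  also have "\<dots> = (\<Prod>i\<in>UNIV. (\<integral>\<^sup>+x. g i x \<partial>lborel)\<^sup>2)" by (simp add: prod_power_distrib)
  also have "\<dots> \<le> (\<Prod>i\<in>(UNIV :: 'n set). ennreal (s\<^sup>2 * a * d))"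
    by (intro prod_mono_ennreal B)
  also have "\<dots> = ennreal ((s\<^sup>2 * a * d) ^ n)"
    using a0 d0 by (simp add: n_def ennreal_power)
  finally have "(a ^ (n - 1))\<^sup>2 \<le> (s\<^sup>2 * a * d) ^ n"
    using a0 d0 by (simp add: ennreal_power)
  then have le: "a ^ (2 * (n - 1)) \<le> (s\<^sup>2 * d) ^ n * a ^ n"
    by (simp add: power_mult[symmetric] mult.commute power_mult_distrib mult.left_commute)
  have "a \<le> (s\<^sup>2 * d) powr (q / 2)"
  proof (cases "a = 0")
    case False
    then have a: "a > 0" using a0 by simp
    \<comment> \<open>The right-hand side contains \<open>a ^ n\<close>. Cancelling it leaves the
      power \<open>n - 2\<close> on the left, whose root gives the exponent
      \<open>N / (N - 2) = q / 2\<close>.\<close>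
    have "2 * (n - 1) = (n - 2) + n" using n by simp
    then have "a ^ (n - 2) * a ^ n \<le> (s\<^sup>2 * d) ^ n * a ^ n" using le by (simp only: power_add)
    then have le3: "a ^ (n - 2) \<le> (s\<^sup>2 * d) ^ n" using a by (simp add: mult_le_cancel_right)
    then have sd: "s\<^sup>2 * d > 0"
      using a n d0 s zero_less_power[OF a, of "n - 2"] by (cases "d = 0") (auto simp: power_0_left)
    have "a powr (N - 2) \<le> (s\<^sup>2 * d) powr N"
      using le3 a sd n by (simp add: powr_realpow[symmetric] of_nat_diff)
    then have "(a powr (N - 2)) powr (1 / (N - 2)) \<le> ((s\<^sup>2 * d) powr N) powr (1 / (N - 2))"
      using n by (intro powr_mono2) auto
    then show ?thesis using a n by (simp add: powr_powr q(4))
  qed simp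
  then show "(LINT x|lborel. \<bar>\<phi> x\<bar> powr q) \<le> (s\<^sup>2 * (LINT x|lborel. (norm (grad \<phi> x))\<^sup>2)) powr (q / 2)"
    by (simp add: a_def d_def)
qed

section \<open>Compactness in \<open>L\<^sup>1\<close>\<close>

lemma nn_integral_translate:
  fixes f :: "'a::euclidean_space \<Rightarrow> ennreal"
  assumes [measurable]: "f \<in> borel_measurable borel"
  shows "(\<integral>\<^sup>+x. f (c + x) \<partial>lborel) = (\<integral>\<^sup>+x. f x \<partial>lborel)"
proof -
  have "(\<integral>\<^sup>+x. f x \<partial>lborel) = (\<integral>\<^sup>+x. f x \<partial>distr lborel borel ((+) c))" by (simp add: lborel_distr_plus)
  also have "\<dots> = (\<integral>\<^sup>+x. f (c + x) \<partial>lborel)" by (subst nn_integral_distr) auto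
  finally show ?thesis by simp
qed

text \<open>The increment is the integral of the gradient along the segment; exchanging the
  integrals and shifting back leaves the factor \<open>norm z\<close>. The modulus of continuity in
  \<open>L\<^sup>1\<close> is thus uniform over functions with bounded gradient norm.\<close>

lemma C1c_translation_L1:
  fixes \<phi> :: "real ^ 'n \<Rightarrow> real"
  assumes \<phi>: "C1c \<phi>"
  shows "(\<integral>\<^sup>+x. ennreal \<bar>\<phi> (x + z) - \<phi> x\<bar> \<partial>lborel) \<le> ennreal (norm z) * (\<integral>\<^sup>+x. ennreal (norm (grad \<phi> x)) \<partial>lborel)"
proof -
  have [measurable]: "grad \<phi> \<in> borel_measurable borel"
    by (intro borel_measurable_continuous_onI C1cD[OF \<phi>])
  let ?g = "\<lambda>t x. indicator {0..1::real} t * (ennreal (norm z) * ennreal (norm (grad \<phi> (t *\<^sub>R z + x))))"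
  have m: "(\<lambda>p. ?g (fst p) (snd p)) \<in> borel_measurable (borel \<Otimes>\<^sub>M borel)"
    by measurable
  have pw: "ennreal \<bar>\<phi> (x + z) - \<phi> x\<bar> \<le> (\<integral>\<^sup>+t. ?g t x \<partial>lborel)" for x
  proof -
    define w' where "w' t = grad \<phi> (t *\<^sub>R z + x) \<bullet> z" for t
    have d: "((\<lambda>t. \<phi> (t *\<^sub>R z + x)) has_real_derivative w' t) (at t)" for t
    proof -
      have 1: "((\<lambda>t. t *\<^sub>R z + x) has_derivative (\<lambda>h. h *\<^sub>R z)) (at t)"
        by (auto intro!: derivative_eq_intros)
      show ?thesis
        unfolding has_field_derivative_def
        by (rule has_derivative_eq_rhs[OF has_derivative_compose[OF 1 C1cD(1)[OF \<phi>]]]) (simp add: w'_def fun_eq_iff)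
    qed
    have c: "continuous_on {0..1} w'"
      unfolding w'_def by (intro continuous_intros continuous_on_compose2[OF C1cD(3)[OF \<phi>]]) auto
    have "(LINT t|lborel. indicator {0..1} t *\<^sub>R w' t) = \<phi> (1 *\<^sub>R z + x) - \<phi> (0 *\<^sub>R z + x)"
      using d by (intro integral_FTC_atLeastAtMost c)
         (auto simp: has_field_derivative_at_within has_real_derivative_iff_has_vector_derivative[symmetric])
    then have "ennreal \<bar>\<phi> (x + z) - \<phi> x\<bar> = ennreal (norm (LINT t|lborel. indicator {0..1} t *\<^sub>R w' t))"
      by (simp add: add.commute)
    also have "\<dots> \<le> (\<integral>\<^sup>+t. ennreal (norm (indicator {0..1} t *\<^sub>R w' t)) \<partial>lborel)"
      by (rule integral_norm_bound_ennreal[OF borel_integrable_compact[OF compact_Icc c]])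
    also have "\<dots> \<le> (\<integral>\<^sup>+t. ?g t x \<partial>lborel)"
    proof (rule nn_integral_mono)
      fix t
      have "ennreal (norm (w' t)) \<le> ennreal (norm z) * ennreal (norm (grad \<phi> (t *\<^sub>R z + x)))"
        using Cauchy_Schwarz_ineq2[of "grad \<phi> (t *\<^sub>R z + x)" z]
        by (simp add: w'_def mult.commute ennreal_leI flip: ennreal_mult)
      then show "ennreal (norm (indicator {0..1} t *\<^sub>R w' t)) \<le> ?g t x"
        by (auto simp: indicator_def)
    qed
    finally show ?thesis .
  qed
  have "(\<integral>\<^sup>+x. ennreal \<bar>\<phi> (x + z) - \<phi> x\<bar> \<partial>lborel) \<le> (\<integral>\<^sup>+x. \<integral>\<^sup>+t. ?g t x \<partial>lborel \<partial>lborel)"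
    by (intro nn_integral_mono pw)
  also have "\<dots> = (\<integral>\<^sup>+t. \<integral>\<^sup>+x. ?g t x \<partial>lborel \<partial>lborel)"
  proof -
    have "pair_sigma_finite (lborel :: real measure) (lborel :: (real ^ 'n) measure)"
      by (intro pair_sigma_finite.intro sigma_finite_lborel)
    then show ?thesis by (rule pair_sigma_finite.Fubini') (use m in \<open>simp add: case_prod_beta\<close>)
  qed
  also have "\<dots> = (\<integral>\<^sup>+t. indicator {0..1::real} t * (ennreal (norm z) * (\<integral>\<^sup>+x. ennreal (norm (grad \<phi> x)) \<partial>lborel)) \<partial>lborel)"
  proof (rule nn_integral_cong)
    fix t :: real
    have "(\<integral>\<^sup>+x. ennreal (norm (grad \<phi> (t *\<^sub>R z + x))) \<partial>lborel) = (\<integral>\<^sup>+x. ennreal (norm (grad \<phi> x)) \<partial>lborel)"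
      by (rule nn_integral_translate) measurable
    then show "(\<integral>\<^sup>+x. ?g t x \<partial>lborel) = indicator {0..1} t * (ennreal (norm z) * (\<integral>\<^sup>+x. ennreal (norm (grad \<phi> x)) \<partial>lborel))"
      by (subst nn_integral_cmult, measurable, subst nn_integral_cmult) auto
  qed
  also have "\<dots> = ennreal (norm z) * (\<integral>\<^sup>+x. ennreal (norm (grad \<phi> x)) \<partial>lborel)"
    by (subst nn_integral_multc) auto
  finally show ?thesis .
qed

text \<open>
  Not divided by the volume of the ball, so that translation invariance alone bounds \<open>ball_avg h \<phi>\<close> by the
  \<open>L\<^sup>1\<close> norm of \<open>\<phi>\<close>. For fixed \<open>h\<close> the averages of a sequence bounded in \<open>W\<^sup>1\<^sup>,\<^sup>1\<close> are equi-Lipschitz, and they are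
  uniformly close in \<open>L\<^sup>1\<close> to multiples of the functions themselves as \<open>h \<rightarrow> 0\<close>.
\<close>

definition ball_avg :: "real \<Rightarrow> ('a::euclidean_space \<Rightarrow> real) \<Rightarrow> 'a \<Rightarrow> real" where
  "ball_avg h \<phi> x = (LINT z|lborel. indicator (cball 0 h) z * \<phi> (x + z))"

lemma ball_avg_integrable:
  fixes \<phi> :: "'a::euclidean_space \<Rightarrow> real"
  assumes "continuous_on UNIV \<phi>"
  shows "integrable lborel (\<lambda>z. indicator (cball 0 h) z * \<phi> (x + z))"
  using borel_integrable_compact[of "cball 0 h" "\<lambda>z. \<phi> (x + z)"]
  by (simp add: continuous_on_compose2[OF assms] continuous_intros)

lemma ball_avg_bound:
  fixes \<phi> :: "'a::euclidean_space \<Rightarrow> real"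
  assumes c: "continuous_on UNIV \<phi>"
  shows "ennreal \<bar>ball_avg h \<phi> x\<bar> \<le> (\<integral>\<^sup>+x. ennreal \<bar>\<phi> x\<bar> \<partial>lborel)"
proof -
  have [measurable]: "\<phi> \<in> borel_measurable borel" using c by (rule borel_measurable_continuous_onI)
  have "ennreal \<bar>ball_avg h \<phi> x\<bar> \<le> (\<integral>\<^sup>+z. ennreal (norm (indicator (cball 0 h) z * \<phi> (x + z))) \<partial>lborel)"
    unfolding ball_avg_def real_norm_def[symmetric] by (rule integral_norm_bound_ennreal[OF ball_avg_integrable[OF c]])
  also have "\<dots> \<le> (\<integral>\<^sup>+z. ennreal \<bar>\<phi> (x + z)\<bar> \<partial>lborel)"
    by (intro nn_integral_mono ennreal_leI) (auto simp: indicator_def)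
  also have "\<dots> = (\<integral>\<^sup>+x. ennreal \<bar>\<phi> x\<bar> \<partial>lborel)"
    by (rule nn_integral_translate) measurable
  finally show ?thesis .
qed

text \<open>A difference of averages is an average of differences under the shift by
  \<open>x - y\<close>, to which the translation estimate applies.\<close>

lemma ball_avg_lipschitz:
  fixes \<phi> :: "real ^ 'n \<Rightarrow> real"
  assumes \<phi>: "C1c \<phi>"
  shows "ennreal \<bar>ball_avg h \<phi> x - ball_avg h \<phi> y\<bar> \<le> ennreal (norm (x - y)) * (\<integral>\<^sup>+x. ennreal (norm (grad \<phi> x)) \<partial>lborel)"
proof -
  note c = C1cD(2)[OF \<phi>]
  have [measurable]: "\<phi> \<in> borel_measurable borel" using c by (rule borel_measurable_continuous_onI)
  have eq: "ball_avg h \<phi> x - ball_avg h \<phi> y = (LINT z|lborel. indicator (cball 0 h) z * \<phi> (x + z) - indicator (cball 0 h) z * \<phi> (y + z))"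
    unfolding ball_avg_def by (intro Bochner_Integration.integral_diff[symmetric] ball_avg_integrable c)
  have "ennreal \<bar>ball_avg h \<phi> x - ball_avg h \<phi> y\<bar> \<le> (\<integral>\<^sup>+z. ennreal (norm (indicator (cball 0 h) z * \<phi> (x + z) - indicator (cball 0 h) z * \<phi> (y + z))) \<partial>lborel)"
    unfolding eq real_norm_def[symmetric]
    by (intro integral_norm_bound_ennreal Bochner_Integration.integrable_diff ball_avg_integrable c)
  also have "\<dots> \<le> (\<integral>\<^sup>+z. ennreal \<bar>\<phi> ((y + z) + (x - y)) - \<phi> (y + z)\<bar> \<partial>lborel)"
    by (intro nn_integral_mono ennreal_leI) (auto simp: indicator_def algebra_simps)
  also have "\<dots> = (\<integral>\<^sup>+z. ennreal \<bar>\<phi> (z + (x - y)) - \<phi> z\<bar> \<partial>lborel)"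
    by (rule nn_integral_translate) measurable
  also have "\<dots> \<le> ennreal (norm (x - y)) * (\<integral>\<^sup>+x. ennreal (norm (grad \<phi> x)) \<partial>lborel)"
    by (rule C1c_translation_L1[OF \<phi>])
  finally show ?thesis .
qed

text \<open>The translation estimate integrated over all shifts \<open>z\<close> in the ball, each
  contributing at most \<open>h\<close> times the gradient norm.\<close>

lemma ball_avg_L1:
  fixes \<phi> :: "real ^ 'n \<Rightarrow> real"
  assumes \<phi>: "C1c \<phi>" and h: "h \<ge> 0"
  defines "\<mu> \<equiv> measure lborel (cball (0 :: real ^ 'n) h)"
  shows "(\<integral>\<^sup>+x. ennreal \<bar>ball_avg h \<phi> x - \<mu> * \<phi> x\<bar> \<partial>lborel) \<le> ennreal (\<mu> * h) * (\<integral>\<^sup>+x. ennreal (norm (grad \<phi> x)) \<partial>lborel)"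
proof -
  note c = C1cD(2)[OF \<phi>]
  have [measurable]: "\<phi> \<in> borel_measurable borel" using c by (rule borel_measurable_continuous_onI)
  have fin: "emeasure lborel (cball (0 :: real ^ 'n) h) < \<infinity>" by (rule emeasure_bounded_finite) simp
  then have \<mu>: "emeasure lborel (cball (0 :: real ^ 'n) h) = ennreal \<mu>"
    unfolding \<mu>_def by (intro emeasure_eq_ennreal_measure) auto
  have \<mu>0: "\<mu> \<ge> 0" by (simp add: \<mu>_def)
  let ?K = "\<integral>\<^sup>+x. ennreal (norm (grad \<phi> x)) \<partial>lborel"
  have [measurable]: "cball (0 :: real ^ 'n) h \<in> sets borel" by simp
  have pw: "ennreal \<bar>ball_avg h \<phi> x - \<mu> * \<phi> x\<bar> \<le> (\<integral>\<^sup>+z. indicator (cball 0 h) z * ennreal \<bar>\<phi> (x + z) - \<phi> x\<bar> \<partial>lborel)" for x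
  proof -
    have i: "integrable lborel (\<lambda>z :: real ^ 'n. indicator (cball 0 h) z * \<phi> x)" using fin by simp
    have eq: "ball_avg h \<phi> x - \<mu> * \<phi> x = (LINT z|lborel. indicator (cball 0 h) z * \<phi> (x + z) - indicator (cball 0 h) z * \<phi> x)"
      unfolding ball_avg_def by (subst Bochner_Integration.integral_diff[OF ball_avg_integrable[OF c] i]) (simp add: \<mu>_def)
    have "ennreal \<bar>ball_avg h \<phi> x - \<mu> * \<phi> x\<bar> \<le> (\<integral>\<^sup>+z. ennreal (norm (indicator (cball 0 h) z * \<phi> (x + z) - indicator (cball 0 h) z * \<phi> x)) \<partial>lborel)"
      unfolding eq real_norm_def[symmetric]
      by (intro integral_norm_bound_ennreal Bochner_Integration.integrable_diff ball_avg_integrable c i)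
    also have "\<dots> = (\<integral>\<^sup>+z. indicator (cball 0 h) z * ennreal \<bar>\<phi> (x + z) - \<phi> x\<bar> \<partial>lborel)"
      by (intro nn_integral_cong) (auto simp: indicator_def)
    finally show ?thesis .
  qed
  have "(\<integral>\<^sup>+x. ennreal \<bar>ball_avg h \<phi> x - \<mu> * \<phi> x\<bar> \<partial>lborel) \<le> (\<integral>\<^sup>+x. \<integral>\<^sup>+z. indicator (cball 0 h) z * ennreal \<bar>\<phi> (x + z) - \<phi> x\<bar> \<partial>lborel \<partial>lborel)"
    by (intro nn_integral_mono pw)
  also have "\<dots> = (\<integral>\<^sup>+z. \<integral>\<^sup>+x. indicator (cball 0 h) z * ennreal \<bar>\<phi> (x + z) - \<phi> x\<bar> \<partial>lborel \<partial>lborel)"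
  proof (rule lborel_pair.Fubini'[symmetric])
    have "(\<lambda>p. indicator (cball 0 h) (snd p) * ennreal \<bar>\<phi> (fst p + snd p) - \<phi> (fst p)\<bar>)
        \<in> borel_measurable (borel \<Otimes>\<^sub>M (borel :: (real ^ 'n) measure))"
      by measurable
    then show "(\<lambda>(x, z). indicator (cball 0 h) z * ennreal \<bar>\<phi> (x + z) - \<phi> x\<bar>) \<in> borel_measurable (lborel \<Otimes>\<^sub>M lborel)"
      by (simp add: case_prod_beta)
  qed
  also have "\<dots> \<le> (\<integral>\<^sup>+z. (ennreal h * ?K) * indicator (cball (0 :: real ^ 'n) h) z \<partial>lborel)"
  proof (rule nn_integral_mono)
    fix z :: "real ^ 'n"
    have "(\<integral>\<^sup>+x. indicator (cball 0 h) z * ennreal \<bar>\<phi> (x + z) - \<phi> x\<bar> \<partial>lborel) = indicator (cball 0 h) z * (\<integral>\<^sup>+x. ennreal \<bar>\<phi> (x + z) - \<phi> x\<bar> \<partial>lborel)"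
      by (subst nn_integral_cmult) auto
    also have "\<dots> \<le> indicator (cball 0 h) z * (ennreal (norm z) * ?K)"
      by (intro mult_left_mono C1c_translation_L1 \<phi>) auto
    also have "\<dots> \<le> indicator (cball 0 h) z * (ennreal h * ?K)"
      by (auto simp: indicator_def intro!: mult_right_mono ennreal_leI)
    finally show "(\<integral>\<^sup>+x. indicator (cball 0 h) z * ennreal \<bar>\<phi> (x + z) - \<phi> x\<bar> \<partial>lborel) \<le> (ennreal h * ?K) * indicator (cball 0 h) z"
      by (simp add: mult.commute)
  qed
  also have "\<dots> = ennreal h * ?K * ennreal \<mu>"
    by (subst nn_integral_cmult_indicator) (auto simp: \<mu>)
  also have "\<dots> = ennreal (\<mu> * h) * ?K"
    using h \<mu>0 by (simp add: ennreal_mult mult_ac)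
  finally show ?thesis .
qed

text \<open>For one accuracy a single radius \<open>h\<close> suffices: the averages at that radius
  are equi-Lipschitz and equibounded on the compact closure, so Arzela-Ascoli yields a uniformly
  convergent subsequence of averages.\<close>

lemma C1c_L1_almost_Cauchy_subseq:
  fixes \<phi> :: "nat \<Rightarrow> real ^ 'n \<Rightarrow> real"
  assumes \<Omega>: "bounded \<Omega>" "open \<Omega>"
    and \<phi>: "\<And>n. C1c (\<phi> n)" "\<And>n x. x \<notin> \<Omega> \<Longrightarrow> \<phi> n x = 0"
    and K: "\<And>n. (\<integral>\<^sup>+x. ennreal \<bar>\<phi> n x\<bar> \<partial>lborel) \<le> ennreal K" "\<And>n. (\<integral>\<^sup>+x. ennreal (norm (grad (\<phi> n) x)) \<partial>lborel) \<le> ennreal K" "K > 0"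
    and \<delta>: "\<delta> > 0"
  obtains r :: "nat \<Rightarrow> nat" and N :: nat where "strict_mono r"
    "\<And>i j. i \<ge> N \<Longrightarrow> j \<ge> N \<Longrightarrow> (\<integral>\<^sup>+x. ennreal \<bar>\<phi> (r i) x - \<phi> (r j) x\<bar> \<partial>lborel) \<le> ennreal \<delta>"
proof -
  \<comment> \<open>Each replacement of a function by its average costs at most
    \<open>\<mu> * h * K = \<mu> * \<delta> / 4\<close>; the two of them use half of the budget
    \<open>\<mu> * \<delta>\<close>.\<close>
  define h where "h = \<delta> / (4 * K)"
  have h: "h > 0" using \<delta> K(3) by (simp add: h_def)
  define \<mu> where "\<mu> = measure lborel (cball (0 :: real ^ 'n) h)"
  have fin: "emeasure lborel (cball (0 :: real ^ 'n) h) < \<infinity>" by (rule emeasure_bounded_finite) simp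
  have \<mu>: "\<mu> > 0"
    using content_cball_pos[OF h, of "0 :: real ^ 'n"] by (simp add: \<mu>_def)
  have Afin: "emeasure lborel \<Omega> < \<infinity>" by (rule emeasure_bounded_finite[OF \<Omega>(1)])
  define w where "w = measure lborel \<Omega>"
  have w: "emeasure lborel \<Omega> = ennreal w" "w \<ge> 0"
    using Afin unfolding w_def by (auto simp: emeasure_eq_ennreal_measure)
  \<comment> \<open>A positive substitute for the volume, usable as a divisor. With \<open>e\<close>
    below, the uniform distance of the averages costs at most
    \<open>e * v = \<mu> * \<delta> / 2\<close>, the other half of the budget.\<close>
  define v where "v = w + 1"
  have v: "v > 0" "w \<le> v" using w by (simp_all add: v_def)
  define e where "e = \<mu> * \<delta> / (2 * v)"
  have e: "e > 0" using \<mu> \<delta> v by (simp add: e_def)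
  have [measurable]: "\<phi> n \<in> borel_measurable borel" for n
    using C1cD(2)[OF \<phi>(1)] by (rule borel_measurable_continuous_onI)
  have lip: "\<bar>ball_avg h (\<phi> n) x - ball_avg h (\<phi> n) y\<bar> \<le> norm (x - y) * K" for n x y
  proof -
    have "ennreal \<bar>ball_avg h (\<phi> n) x - ball_avg h (\<phi> n) y\<bar> \<le> ennreal (norm (x - y)) * ennreal K"
      by (rule order_trans[OF ball_avg_lipschitz[OF \<phi>(1)]]) (intro mult_left_mono K, simp)
    then show ?thesis using K(3) by (simp add: ennreal_mult[symmetric])
  qed
  have cont: "continuous_on UNIV (ball_avg h (\<phi> n))" for n
    unfolding continuous_on_iff
  proof (intro ballI allI impI)
    fix x and \<epsilon> :: real assume "\<epsilon> > 0"
    then show "\<exists>d>0. \<forall>x'\<in>UNIV. dist x' x < d \<longrightarrow> dist (ball_avg h (\<phi> n) x') (ball_avg h (\<phi> n) x) < \<epsilon>"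
      using lip[of n _ x] K(3)
      by (intro exI[of _ "\<epsilon> / K"]) (auto simp: dist_norm field_simps intro: le_less_trans)
  qed
  have [measurable]: "ball_avg h (\<phi> n) \<in> borel_measurable borel" for n
    using cont by (rule borel_measurable_continuous_onI)
  obtain g r where r: "strict_mono (r :: nat \<Rightarrow> nat)"
    and g: "\<And>e. 0 < e \<Longrightarrow> \<exists>N. \<forall>n x. n \<ge> N \<and> x \<in> closure \<Omega> \<longrightarrow> norm (ball_avg h (\<phi> (r n)) x - g x) < e"
  proof (rule Arzela_Ascoli[of "closure \<Omega>" "\<lambda>n. ball_avg h (\<phi> n)" K])
    show "compact (closure \<Omega>)" using \<Omega> by (simp add: compact_closure)
    show "norm (ball_avg h (\<phi> n) x) \<le> K" for n x
    proof -
      have "ennreal \<bar>ball_avg h (\<phi> n) x\<bar> \<le> ennreal K"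
        by (rule order_trans[OF ball_avg_bound[OF C1cD(2)[OF \<phi>(1)]] K(1)])
      then show ?thesis using K(3) by simp
    qed
    show "\<exists>d>0. \<forall>n y. y \<in> closure \<Omega> \<and> norm (x - y) < d \<longrightarrow> norm (ball_avg h (\<phi> n) x - ball_avg h (\<phi> n) y) < \<epsilon>"
      if "\<epsilon> > 0" for x \<epsilon>
      using that lip[of _ x] K(3)
      by (intro exI[of _ "\<epsilon> / K"]) (auto simp: field_simps intro: le_less_trans)
  qed blast
  obtain N where N: "\<And>n x. n \<ge> N \<Longrightarrow> x \<in> closure \<Omega> \<Longrightarrow> \<bar>ball_avg h (\<phi> (r n)) x - g x\<bar> < e / 2"
    using g[of "e / 2"] e by auto
  have "(\<integral>\<^sup>+x. ennreal \<bar>\<phi> (r i) x - \<phi> (r j) x\<bar> \<partial>lborel) \<le> ennreal \<delta>" if ij: "i \<ge> N" "j \<ge> N" for i j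
  proof -
    let ?d = "\<lambda>n x. \<bar>ball_avg h (\<phi> (r n)) x - \<mu> * \<phi> (r n) x\<bar>"
    have pw: "ennreal (\<mu> * \<bar>\<phi> (r i) x - \<phi> (r j) x\<bar>) \<le> (ennreal (?d i x) + ennreal (?d j x)) + ennreal e * indicator \<Omega> x" for x
    proof (cases "x \<in> \<Omega>")
      case True
      then have x: "x \<in> closure \<Omega>" using closure_subset by blast
      have "\<mu> * \<bar>\<phi> (r i) x - \<phi> (r j) x\<bar> = \<bar>\<mu> * \<phi> (r i) x - \<mu> * \<phi> (r j) x\<bar>"
        using \<mu> by (simp add: abs_mult flip: right_diff_distrib)
      also have "\<dots> \<le> ?d i x + ?d j x + e"
        using N[OF ij(1) x] N[OF ij(2) x] by linarith
      finally have "ennreal (\<mu> * \<bar>\<phi> (r i) x - \<phi> (r j) x\<bar>) \<le> ennreal (?d i x + ?d j x + e)" by (rule ennreal_leI)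
      then show ?thesis using True e by (simp add: ennreal_plus)
    qed (simp add: \<phi>(2))
    have d: "(\<integral>\<^sup>+x. ennreal (?d n x) \<partial>lborel) \<le> ennreal (\<mu> * h * K)" for n
    proof -
      have "(\<integral>\<^sup>+x. ennreal (?d n x) \<partial>lborel) \<le> ennreal (\<mu> * h) * (\<integral>\<^sup>+x. ennreal (norm (grad (\<phi> (r n)) x)) \<partial>lborel)"
        unfolding \<mu>_def by (rule ball_avg_L1[OF \<phi>(1)]) (use h in simp)
      also have "\<dots> \<le> ennreal (\<mu> * h) * ennreal K" by (intro mult_left_mono K) simp
      finally show ?thesis using K(3) h \<mu> by (simp add: ennreal_mult)
    qed
    have "ennreal \<mu> * (\<integral>\<^sup>+x. ennreal \<bar>\<phi> (r i) x - \<phi> (r j) x\<bar> \<partial>lborel) = (\<integral>\<^sup>+x. ennreal (\<mu> * \<bar>\<phi> (r i) x - \<phi> (r j) x\<bar>) \<partial>lborel)"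
      using \<mu> by (subst nn_integral_cmult[symmetric]) (auto simp: ennreal_mult)
    also have "\<dots> \<le> (\<integral>\<^sup>+x. (ennreal (?d i x) + ennreal (?d j x)) + ennreal e * indicator \<Omega> x \<partial>lborel)"
      by (intro nn_integral_mono pw)
    also have "\<dots> = (\<integral>\<^sup>+x. ennreal (?d i x) \<partial>lborel) + (\<integral>\<^sup>+x. ennreal (?d j x) \<partial>lborel) + ennreal e * ennreal w"
      using \<Omega>(2) by (simp add: nn_integral_add nn_integral_cmult_indicator w)
    also have "\<dots> \<le> ennreal (\<mu> * h * K) + ennreal (\<mu> * h * K) + ennreal e * ennreal w"
      by (intro add_mono d order_refl)
    also have "\<dots> = ennreal (2 * (\<mu> * h * K) + e * w)"
      using h \<mu> e w K(3) by (simp add: ennreal_plus[symmetric] ennreal_mult[symmetric] del: ennreal_plus)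
    also have "\<dots> \<le> ennreal (\<mu> * \<delta>)"
    proof (rule ennreal_leI)
      have "2 * (\<mu> * h * K) = \<mu> * \<delta> / 2" using K(3) by (simp add: h_def)
      moreover have "e * w \<le> e * v" using e v by simp
      moreover have "e * v = \<mu> * \<delta> / 2" using v by (simp add: e_def)
      ultimately show "2 * (\<mu> * h * K) + e * w \<le> \<mu> * \<delta>" by linarith
    qed
    finally have "ennreal \<mu> * (\<integral>\<^sup>+x. ennreal \<bar>\<phi> (r i) x - \<phi> (r j) x\<bar> \<partial>lborel) \<le> ennreal \<mu> * ennreal \<delta>"
      using \<mu> \<delta> by (simp add: ennreal_mult)
    then show ?thesis using \<mu> by (subst (asm) ennreal_mult_le_mult_iff) auto
  qed
  with r that show thesis by blast
qed

text \<open>A diagonal sequence over the accuracies \<open>1 / Suc n\<close>. The property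
  \<open>P n\<close> speaks of tails only and so is inherited by further subsequences.\<close>

lemma C1c_L1_Cauchy_subseq:
  fixes \<phi> :: "nat \<Rightarrow> real ^ 'n \<Rightarrow> real"
  assumes \<Omega>: "bounded \<Omega>" "open \<Omega>"
    and \<phi>: "\<And>n. C1c (\<phi> n)" "\<And>n x. x \<notin> \<Omega> \<Longrightarrow> \<phi> n x = 0"
    and K: "\<And>n. (\<integral>\<^sup>+x. ennreal \<bar>\<phi> n x\<bar> \<partial>lborel) \<le> ennreal K" "\<And>n. (\<integral>\<^sup>+x. ennreal (norm (grad (\<phi> n) x)) \<partial>lborel) \<le> ennreal K" "K > 0"
  obtains r :: "nat \<Rightarrow> nat" where "strict_mono r"
    "\<And>\<delta>. \<delta> > 0 \<Longrightarrow> \<exists>N. \<forall>i\<ge>N. \<forall>j\<ge>N. (\<integral>\<^sup>+x. ennreal \<bar>\<phi> (r i) x - \<phi> (r j) x\<bar> \<partial>lborel) \<le> ennreal \<delta>"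
proof -
  define P where "P n s \<longleftrightarrow> (\<exists>N. \<forall>i\<ge>N. \<forall>j\<ge>N. (\<integral>\<^sup>+x. ennreal \<bar>\<phi> (s i) x - \<phi> (s j) x\<bar> \<partial>lborel) \<le> ennreal (1 / real (Suc n)))"
    for n and s :: "nat \<Rightarrow> nat"
  interpret subseqs P
  proof
    fix n and s :: "nat \<Rightarrow> nat" assume "strict_mono s"
    show "\<exists>r'. strict_mono r' \<and> P n (s \<circ> r')"
    proof (rule C1c_L1_almost_Cauchy_subseq[where \<phi> = "\<lambda>n. \<phi> (s n)" and \<delta> = "1 / real (Suc n)",
          OF \<Omega> \<phi>(1) \<phi>(2) K(1) K(2) K(3)])
      fix r :: "nat \<Rightarrow> nat" and N :: nat assume "strict_mono r"
        "\<And>i j. i \<ge> N \<Longrightarrow> j \<ge> N \<Longrightarrow> (\<integral>\<^sup>+x. ennreal \<bar>\<phi> (s (r i)) x - \<phi> (s (r j)) x\<bar> \<partial>lborel) \<le> ennreal (1 / real (Suc n))"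
      then show ?thesis
        unfolding P_def o_def by blast
    qed auto
  qed
  \<comment> \<open>Only from the index \<open>Suc n\<close> on is the diagonal sequence a
    subsequence of the \<open>n\<close>-th stage; the shift reappears in the index bound
    \<open>Suc n + N\<close> below.\<close>
  have P: "P n (diagseq \<circ> ((+) (Suc n)))" for n
  proof (rule diagseq_holds)
    fix r s :: "nat \<Rightarrow> nat" and n assume r: "strict_mono r" and "P n s"
    then obtain N where N: "\<forall>i\<ge>N. \<forall>j\<ge>N. (\<integral>\<^sup>+x. ennreal \<bar>\<phi> (s i) x - \<phi> (s j) x\<bar> \<partial>lborel) \<le> ennreal (1 / real (Suc n))"
      by (auto simp: P_def)
    have "r i \<ge> N" if "i \<ge> N" for i using seq_suble[OF r, of i] that by simp
    with N show "P n (s \<circ> r)" unfolding P_def by (intro exI[of _ N]) auto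
  qed
  have "\<exists>N. \<forall>i\<ge>N. \<forall>j\<ge>N. (\<integral>\<^sup>+x. ennreal \<bar>\<phi> (diagseq i) x - \<phi> (diagseq j) x\<bar> \<partial>lborel) \<le> ennreal \<delta>" if \<delta>: "\<delta> > 0" for \<delta>
  proof -
    obtain n where n: "1 / real (Suc n) < \<delta>" using nat_approx_posE[OF \<delta>] by (auto simp: inverse_eq_divide)
    obtain N where N: "\<forall>i\<ge>N. \<forall>j\<ge>N. (\<integral>\<^sup>+x. ennreal \<bar>\<phi> (diagseq (Suc n + i)) x - \<phi> (diagseq (Suc n + j)) x\<bar> \<partial>lborel) \<le> ennreal (1 / real (Suc n))"
      using P[of n] by (auto simp: P_def)
    show ?thesis
    proof (intro exI allI impI)
      fix i j assume ij: "i \<ge> Suc n + N" "j \<ge> Suc n + N"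
      have "(\<integral>\<^sup>+x. ennreal \<bar>\<phi> (diagseq i) x - \<phi> (diagseq j) x\<bar> \<partial>lborel) \<le> ennreal (1 / real (Suc n))"
        using N[rule_format, of "i - Suc n" "j - Suc n"] ij by simp
      also have "\<dots> \<le> ennreal \<delta>" using n by (intro ennreal_leI) simp
      finally show "(\<integral>\<^sup>+x. ennreal \<bar>\<phi> (diagseq i) x - \<phi> (diagseq j) x\<bar> \<partial>lborel) \<le> ennreal \<delta>" .
    qed
  qed
  with subseq_diagseq that show thesis by blast
qed

text \<open>The Riesz-Fischer argument: along a fast subsequence the increments have integrals
  bounded by a geometric series, so their sum is absolutely convergent a.e. and telescopes.\<close>

lemma L1_Cauchy_AE_convergent_subseq:
  fixes f :: "nat \<Rightarrow> 'a \<Rightarrow> 'b::{banach, second_countable_topology}"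
  assumes [measurable]: "\<And>n. f n \<in> borel_measurable M"
    and C: "\<And>\<delta>. \<delta> > 0 \<Longrightarrow> \<exists>N. \<forall>i\<ge>N. \<forall>j\<ge>N. (\<integral>\<^sup>+x. ennreal (norm (f i x - f j x)) \<partial>M) \<le> ennreal \<delta>"
  obtains r :: "nat \<Rightarrow> nat" and g where "strict_mono r" "g \<in> borel_measurable M"
    "AE x in M. (\<lambda>n. f (r n) x) \<longlonglongrightarrow> g x"
proof -
  have "\<exists>N. \<forall>i\<ge>N. \<forall>j\<ge>N. (\<integral>\<^sup>+x. ennreal (norm (f i x - f j x)) \<partial>M) \<le> ennreal ((1 / 2) ^ n)" for n
    by (rule C) simp
  then obtain N where N: "\<And>n i j. i \<ge> N n \<Longrightarrow> j \<ge> N n \<Longrightarrow> (\<integral>\<^sup>+x. ennreal (norm (f i x - f j x)) \<partial>M) \<le> ennreal ((1 / 2) ^ n)"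
    by metis
  \<comment> \<open>The partial sum dominates \<open>N n\<close>, and the added \<open>n\<close>
    makes \<open>r\<close> strictly increasing.\<close>
  define r where "r n = (\<Sum>i\<le>n. N i) + n" for n
  have r: "strict_mono r" by (auto simp: strict_mono_Suc_iff r_def)
  have rN: "r n \<ge> N n" "r (Suc n) \<ge> N n" for n
  proof -
    have "N n \<le> (\<Sum>i\<le>n. N i)" by (rule member_le_sum) auto
    then show "r n \<ge> N n" by (simp add: r_def)
    then show "r (Suc n) \<ge> N n" using strict_monoD[OF r, of n "Suc n"] by simp
  qed
  have "(\<integral>\<^sup>+x. (\<Sum>n. ennreal (norm (f (r (Suc n)) x - f (r n) x))) \<partial>M) = (\<Sum>n. \<integral>\<^sup>+x. ennreal (norm (f (r (Suc n)) x - f (r n) x)) \<partial>M)"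
    by (rule nn_integral_suminf) measurable
  also have "\<dots> \<le> (\<Sum>n. ennreal ((1 / 2) ^ n))"
    by (intro suminf_le N rN) auto
  also have "\<dots> = ennreal (\<Sum>n. (1 / 2) ^ n)"
    by (rule suminf_ennreal2) (auto simp: summable_geometric)
  also have "\<dots> < \<infinity>" by simp
  finally have "AE x in M. (\<Sum>n. ennreal (norm (f (r (Suc n)) x - f (r n) x))) \<noteq> \<infinity>"
    by (intro nn_integral_PInf_AE) auto
  then have conv: "AE x in M. (\<lambda>n. f (r n) x) \<longlonglongrightarrow> lim (\<lambda>n. f (r n) x)"
  proof eventually_elim
    case (elim x)
    then have "summable (\<lambda>n. norm (f (r (Suc n)) x - f (r n) x))"
      by (intro summable_suminf_not_top) auto
    then have "summable (\<lambda>n. f (r (Suc n)) x - f (r n) x)" by (rule summable_norm_cancel)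
    then have "(\<lambda>n. \<Sum>i<n. f (r (Suc i)) x - f (r i) x) \<longlonglongrightarrow> (\<Sum>n. f (r (Suc n)) x - f (r n) x)"
      by (rule summable_LIMSEQ)
    then have "(\<lambda>n. f (r 0) x + (f (r n) x - f (r 0) x)) \<longlonglongrightarrow> f (r 0) x + (\<Sum>n. f (r (Suc n)) x - f (r n) x)"
      by (intro tendsto_add tendsto_const) (simp add: sum_lessThan_telescope[of "\<lambda>i. f (r i) x"])
    then have "convergent (\<lambda>n. f (r n) x)" by (auto simp: convergent_def)
    then show ?case by (simp add: convergent_LIMSEQ_iff)
  qed
  show thesis by (rule that[OF r _ conv]) measurable
qed

section \<open>The space \<open>H10\<close>\<close>

text \<open>Stated with convergent upper bounds \<open>c n\<close>, since in the applications the
  integrals themselves are not known to converge. Integrability of the limit is part of the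
  conclusion.\<close>

lemma Fatou_real:
  fixes f :: "nat \<Rightarrow> 'a \<Rightarrow> real"
  assumes f: "\<And>n. integrable M (f n)" "\<And>n. AE x in M. 0 \<le> f n x"
    and g: "g \<in> borel_measurable M" "AE x in M. (\<lambda>n. f n x) \<longlonglongrightarrow> g x"
    and c: "\<And>n. (LINT x|M. f n x) \<le> c n" "c \<longlonglongrightarrow> c'"
  shows "integrable M g" "(LINT x|M. g x) \<le> c'"
proof -
  have g0: "AE x in M. 0 \<le> g x"
  proof -
    have "AE x in M. \<forall>n. 0 \<le> f n x" using f(2) by (simp add: AE_all_countable)
    then show ?thesis using g(2)
      by eventually_elim (rule LIMSEQ_le_const, auto)
  qed
  have "c n \<ge> 0" for n
    using order_trans[OF integral_nonneg_AE[OF f(2)] c(1)] .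
  then have c0: "c' \<ge> 0" using c(2) by (intro LIMSEQ_le_const[OF c(2)]) auto
  have "(\<integral>\<^sup>+x. ennreal (g x) \<partial>M) = (\<integral>\<^sup>+x. liminf (\<lambda>n. ennreal (f n x)) \<partial>M)"
  proof (rule nn_integral_cong_AE)
    show "AE x in M. ennreal (g x) = liminf (\<lambda>n. ennreal (f n x))"
      using g(2)
    proof eventually_elim
      case (elim x)
      then have "(\<lambda>n. ennreal (f n x)) \<longlonglongrightarrow> ennreal (g x)" by (rule tendsto_ennrealI)
      then show ?case by (simp add: lim_imp_Liminf)
    qed
  qed
  also have "\<dots> \<le> liminf (\<lambda>n. \<integral>\<^sup>+x. ennreal (f n x) \<partial>M)"
    by (rule nn_integral_liminf) (use f in auto)
  also have "\<dots> \<le> liminf (\<lambda>n. ennreal (c n))"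
    by (intro Liminf_mono always_eventually allI) (simp add: nn_integral_eq_integral f c ennreal_leI)
  also have "\<dots> = ennreal c'"
    using tendsto_ennrealI[OF c(2)] by (simp add: lim_imp_Liminf)
  finally have le: "(\<integral>\<^sup>+x. ennreal (g x) \<partial>M) \<le> ennreal c'" .
  show i: "integrable M g"
    by (rule integrableI_nonneg[OF g(1) g0]) (rule le_less_trans[OF le], simp)
  show "(LINT x|M. g x) \<le> c'"
    using le c0 by (simp add: nn_integral_eq_integral[OF i g0])
qed

text \<open>The Euclidean inner product in the integrand lets one theory cover functions and
  gradient fields. On representatives this is only a semi-inner product, so convergence is expressed
  by \<open>l2sq\<close> of the difference.\<close>

definition l2in :: "(real ^ 'n) set \<Rightarrow> (real ^ 'n \<Rightarrow> 'b::euclidean_space) \<Rightarrow> (real ^ 'n \<Rightarrow> 'b) \<Rightarrow> real" where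
  "l2in \<Omega> f g = (LINT x|lebesgue_on \<Omega>. f x \<bullet> g x)"

abbreviation l2sq :: "(real ^ 'n) set \<Rightarrow> (real ^ 'n \<Rightarrow> 'b::euclidean_space) \<Rightarrow> real" where
  "l2sq \<Omega> f \<equiv> l2in \<Omega> f f"

lemma L2_D:
  assumes "f \<in> L2 \<Omega>"
  shows "f \<in> borel_measurable (lebesgue_on \<Omega>)" "integrable (lebesgue_on \<Omega>) (\<lambda>x. f x \<bullet> f x)"
  using assms by (auto simp: L2_def power2_norm_eq_inner)

lemma L2_I:
  assumes "f \<in> borel_measurable (lebesgue_on \<Omega>)" "integrable (lebesgue_on \<Omega>) (\<lambda>x. f x \<bullet> f x)"
  shows "f \<in> L2 \<Omega>"
  using assms by (auto simp: L2_def power2_norm_eq_inner)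

lemma L2_integrable_inner:
  assumes "f \<in> L2 \<Omega>" "g \<in> L2 \<Omega>"
  shows "integrable (lebesgue_on \<Omega>) (\<lambda>x. f x \<bullet> g x)"
proof (rule Bochner_Integration.integrable_bound[where f = "\<lambda>x. f x \<bullet> f x + g x \<bullet> g x"])
  show "integrable (lebesgue_on \<Omega>) (\<lambda>x. f x \<bullet> f x + g x \<bullet> g x)"
    using L2_D[OF assms(1)] L2_D[OF assms(2)] by simp
  show "(\<lambda>x. f x \<bullet> g x) \<in> borel_measurable (lebesgue_on \<Omega>)"
    using L2_D[OF assms(1)] L2_D[OF assms(2)] by simp
  have "\<bar>a \<bullet> b\<bar> \<le> a \<bullet> a + b \<bullet> b" for a b :: 'b
  proof -
    have "0 \<le> (a + b) \<bullet> (a + b)" "0 \<le> (a - b) \<bullet> (a - b)" "0 \<le> a \<bullet> a" "0 \<le> b \<bullet> b" by auto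
    then show ?thesis by (simp add: inner_add_left inner_add_right inner_diff_left inner_diff_right inner_commute)
  qed
  then show "AE x in lebesgue_on \<Omega>. norm (f x \<bullet> g x) \<le> norm (f x \<bullet> f x + g x \<bullet> g x)"
    by (intro AE_I2) (smt (verit) real_norm_def inner_ge_zero)
qed

lemma L2_linear:
  assumes "f \<in> L2 \<Omega>" "g \<in> L2 \<Omega>"
  shows "(\<lambda>x. \<alpha> *\<^sub>R f x + \<beta> *\<^sub>R g x) \<in> L2 \<Omega>"
proof (rule L2_I)
  show "(\<lambda>x. \<alpha> *\<^sub>R f x + \<beta> *\<^sub>R g x) \<in> borel_measurable (lebesgue_on \<Omega>)"
    using L2_D(1)[OF assms(1)] L2_D(1)[OF assms(2)] by simp
  have "(\<lambda>x. (\<alpha> *\<^sub>R f x + \<beta> *\<^sub>R g x) \<bullet> (\<alpha> *\<^sub>R f x + \<beta> *\<^sub>R g x)) =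
     (\<lambda>x. \<alpha>\<^sup>2 * (f x \<bullet> f x) + 2 * \<alpha> * \<beta> * (f x \<bullet> g x) + \<beta>\<^sup>2 * (g x \<bullet> g x))"
    by (auto simp: inner_add_left inner_add_right inner_commute power2_eq_square algebra_simps)
  then show "integrable (lebesgue_on \<Omega>) (\<lambda>x. (\<alpha> *\<^sub>R f x + \<beta> *\<^sub>R g x) \<bullet> (\<alpha> *\<^sub>R f x + \<beta> *\<^sub>R g x))"
    using L2_integrable_inner[OF assms(1,1)] L2_integrable_inner[OF assms] L2_integrable_inner[OF assms(2,2)] by simp
qed

lemma L2_diff: "f \<in> L2 \<Omega> \<Longrightarrow> g \<in> L2 \<Omega> \<Longrightarrow> (\<lambda>x. f x - g x) \<in> L2 \<Omega>"
  using L2_linear[of f \<Omega> g 1 "-1"] by simp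

lemma l2in_linear:
  assumes "f \<in> L2 \<Omega>" "g \<in> L2 \<Omega>" "h \<in> L2 \<Omega>"
  shows "l2in \<Omega> (\<lambda>x. \<alpha> *\<^sub>R f x + \<beta> *\<^sub>R g x) h = \<alpha> * l2in \<Omega> f h + \<beta> * l2in \<Omega> g h"
  using L2_integrable_inner[OF assms(1,3)] L2_integrable_inner[OF assms(2,3)]
  by (simp add: l2in_def inner_add_left)

lemma l2in_commute: "l2in \<Omega> f g = l2in \<Omega> g f"
  by (simp add: l2in_def inner_commute)

lemma l2in_nonneg[simp]: "l2sq \<Omega> f \<ge> 0"
  by (simp add: l2in_def)

lemma l2in_square:
  assumes "f \<in> L2 \<Omega>" "g \<in> L2 \<Omega>"
  shows "l2sq \<Omega> (\<lambda>x. \<alpha> *\<^sub>R f x + \<beta> *\<^sub>R g x) =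
    \<alpha>\<^sup>2 * l2sq \<Omega> f + 2 * \<alpha> * \<beta> * l2in \<Omega> f g + \<beta>\<^sup>2 * l2sq \<Omega> g"
proof -
  note * = l2in_linear[OF assms L2_linear[OF assms]] l2in_linear[OF assms assms(1)] l2in_linear[OF assms assms(2)]
  have "l2in \<Omega> f (\<lambda>x. \<alpha> *\<^sub>R f x + \<beta> *\<^sub>R g x) = \<alpha> * l2sq \<Omega> f + \<beta> * l2in \<Omega> f g"
    "l2in \<Omega> g (\<lambda>x. \<alpha> *\<^sub>R f x + \<beta> *\<^sub>R g x) = \<alpha> * l2in \<Omega> f g + \<beta> * l2sq \<Omega> g"
    using * by (simp_all add: l2in_commute)
  then show ?thesis using *(1) by (simp add: power2_eq_square algebra_simps)
qed

lemma l2in_square_diff: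
  assumes "f \<in> L2 \<Omega>" "g \<in> L2 \<Omega>"
  shows "l2sq \<Omega> (\<lambda>x. f x - g x) = l2sq \<Omega> f - 2 * l2in \<Omega> f g + l2sq \<Omega> g"
  using l2in_square[OF assms, of 1 "-1"] by simp

lemma l2in_Cauchy_Schwarz:
  assumes "f \<in> L2 \<Omega>" "g \<in> L2 \<Omega>"
  shows "(l2in \<Omega> f g)\<^sup>2 \<le> l2sq \<Omega> f * l2sq \<Omega> g"
proof -
  let ?A = "l2sq \<Omega> f" and ?B = "l2in \<Omega> f g" and ?C = "l2sq \<Omega> g"
  have *: "0 \<le> ?A + 2 * t * ?B + t\<^sup>2 * ?C" for t
    using l2in_square[OF assms, of 1 t] l2in_nonneg[of \<Omega> "\<lambda>x. 1 *\<^sub>R f x + t *\<^sub>R g x"] by simp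
  show ?thesis
  proof (cases "?C = 0")
    case True
    have "?B = 0"
    proof (rule ccontr)
      assume "?B \<noteq> 0"
      \<comment> \<open>With \<open>?C = 0\<close> the quadratic is affine in \<open>t\<close>, and
        this \<open>t\<close> gives it the value -1.\<close>
      then show False using *[of "- (?A + 1) / (2 * ?B)"] True by (simp add: field_simps)
    qed
    then show ?thesis using True by simp
  next
    case False
    then have C: "?C > 0" using l2in_nonneg[of \<Omega> g] by linarith
    have "0 \<le> ?A - ?B\<^sup>2 / ?C"
      using *[of "- ?B / ?C"] C by (simp add: power2_eq_square)
    then show ?thesis using C by (simp add: pos_divide_le_eq)
  qed
qed

lemma l2in_tendsto:
  assumes f: "\<And>n. f n \<in> L2 \<Omega>" "f' \<in> L2 \<Omega>" "g \<in> L2 \<Omega>"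
    and lim: "(\<lambda>n. l2sq \<Omega> (\<lambda>x. f n x - f' x)) \<longlonglongrightarrow> 0"
  shows "(\<lambda>n. l2in \<Omega> (f n) g) \<longlonglongrightarrow> l2in \<Omega> f' g"
proof -
  let ?d = "\<lambda>n x. f n x - f' x"
  have "(\<lambda>n. l2in \<Omega> (?d n) g) \<longlonglongrightarrow> 0"
  proof (rule Lim_null_comparison)
    show "\<forall>\<^sub>F n in sequentially. norm (l2in \<Omega> (?d n) g) \<le> sqrt (l2sq \<Omega> (?d n)) * sqrt (l2sq \<Omega> g)"
    proof (intro always_eventually allI)
      fix n
      have "(l2in \<Omega> (?d n) g)\<^sup>2 \<le> l2sq \<Omega> (?d n) * l2sq \<Omega> g"
        by (intro l2in_Cauchy_Schwarz L2_diff f)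
      then have "sqrt ((l2in \<Omega> (?d n) g)\<^sup>2) \<le> sqrt (l2sq \<Omega> (?d n) * l2sq \<Omega> g)" by (rule real_sqrt_le_mono)
      then show "norm (l2in \<Omega> (?d n) g) \<le> sqrt (l2sq \<Omega> (?d n)) * sqrt (l2sq \<Omega> g)"
        by (simp add: real_sqrt_mult)
    qed
    show "(\<lambda>n. sqrt (l2sq \<Omega> (?d n)) * sqrt (l2sq \<Omega> g)) \<longlonglongrightarrow> 0"
      using tendsto_mult_right[OF tendsto_real_sqrt[OF lim], of "sqrt (l2sq \<Omega> g)"] by simp
  qed
  moreover have "l2in \<Omega> (?d n) g = l2in \<Omega> (f n) g - l2in \<Omega> f' g" for n
    using l2in_linear[OF f(1) f(2) f(3), of 1 n "-1"] by simp
  ultimately show ?thesis by (simp add: LIM_zero_iff)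
qed

lemma l2in_self_tendsto:
  assumes f: "\<And>n. f n \<in> L2 \<Omega>" "f' \<in> L2 \<Omega>"
    and lim: "(\<lambda>n. l2sq \<Omega> (\<lambda>x. f n x - f' x)) \<longlonglongrightarrow> 0"
  shows "(\<lambda>n. l2sq \<Omega> (f n)) \<longlonglongrightarrow> l2sq \<Omega> f'"
proof -
  \<comment> \<open>Polarization: the expression equals \<open>l2sq \<Omega> (f n)\<close>, and its
    mixed term converges by \<open>l2in_tendsto\<close>.\<close>
  have "(\<lambda>n. l2sq \<Omega> (\<lambda>x. f n x - f' x) + 2 * l2in \<Omega> (f n) f' - l2sq \<Omega> f')
     \<longlonglongrightarrow> 0 + 2 * l2sq \<Omega> f' - l2sq \<Omega> f'"
    by (intro tendsto_intros lim l2in_tendsto f)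
  then show ?thesis by (simp add: l2in_square_diff f)
qed

lemma l2in_linear_tendsto_0:
  assumes f: "\<And>n. f n \<in> L2 \<Omega>" "\<And>n. g n \<in> L2 \<Omega>"
    and "(\<lambda>n. l2sq \<Omega> (f n)) \<longlonglongrightarrow> 0" "(\<lambda>n. l2sq \<Omega> (g n)) \<longlonglongrightarrow> 0"
  shows "(\<lambda>n. l2sq \<Omega> (\<lambda>x. \<alpha> *\<^sub>R f n x + \<beta> *\<^sub>R g n x)) \<longlonglongrightarrow> 0"
proof (rule tendsto_sandwich[of "\<lambda>_. 0"])
  show "\<forall>\<^sub>F n in sequentially. l2sq \<Omega> (\<lambda>x. \<alpha> *\<^sub>R f n x + \<beta> *\<^sub>R g n x)
     \<le> 2 * \<alpha>\<^sup>2 * l2sq \<Omega> (f n) + 2 * \<beta>\<^sup>2 * l2sq \<Omega> (g n)"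
  proof (intro always_eventually allI)
    fix n
    \<comment> \<open>Nonnegativity with the opposite sign of \<open>\<beta>\<close> bounds the
      mixed term by the two squares.\<close>
    have "0 \<le> l2sq \<Omega> (\<lambda>x. \<alpha> *\<^sub>R f n x + (- \<beta>) *\<^sub>R g n x)" by simp
    then show "l2sq \<Omega> (\<lambda>x. \<alpha> *\<^sub>R f n x + \<beta> *\<^sub>R g n x)
     \<le> 2 * \<alpha>\<^sup>2 * l2sq \<Omega> (f n) + 2 * \<beta>\<^sup>2 * l2sq \<Omega> (g n)"
      unfolding l2in_square[OF f] by (simp only: power2_minus)
  qed
  have "(\<lambda>n. 2 * \<alpha>\<^sup>2 * l2sq \<Omega> (f n) + 2 * \<beta>\<^sup>2 * l2sq \<Omega> (g n)) \<longlonglongrightarrow> 2 * \<alpha>\<^sup>2 * 0 + 2 * \<beta>\<^sup>2 * 0"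
    by (intro tendsto_intros assms)
  then show "(\<lambda>n. 2 * \<alpha>\<^sup>2 * l2sq \<Omega> (f n) + 2 * \<beta>\<^sup>2 * l2sq \<Omega> (g n)) \<longlonglongrightarrow> 0" by simp
qed auto

lemma l2in_cong_AE:
  assumes "AE x in lebesgue_on \<Omega>. f x = f' x" "AE x in lebesgue_on \<Omega>. g x = g' x"
    and "f \<in> L2 \<Omega>" "f' \<in> L2 \<Omega>" "g \<in> L2 \<Omega>" "g' \<in> L2 \<Omega>"
  shows "l2in \<Omega> f g = l2in \<Omega> f' g'"
  unfolding l2in_def
proof (rule integral_cong_AE)
  show "AE x in lebesgue_on \<Omega>. f x \<bullet> g x = f' x \<bullet> g' x"
    using assms(1,2) by eventually_elim simp
qed (use assms L2_integrable_inner in auto)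

section \<open>Weak gradients and \<open>H10\<close> as a space of limits of test functions\<close>

locale sobolev_domain =
  fixes \<Omega> :: "(real ^ 'n) set" and q :: real
  assumes open_dom: "open \<Omega>" and bounded_dom: "bounded \<Omega>" and nonempty_dom: "\<Omega> \<noteq> {}"
    and dim: "CARD('n) \<ge> 3" and q_eq: "q = crit_exp CARD('n)"
begin

abbreviation M :: "(real ^ 'n) measure" where "M \<equiv> lebesgue_on \<Omega>"
lemma q_gt_2: "q > 2"
proof -
  have "real CARD('n) - 2 > 0" using dim by linarith
  then show ?thesis by (simp add: q_eq crit_exp_def field_simps)
qed

lemma dom_sets: "\<Omega> \<in> sets lebesgue"
  using open_dom by auto

sublocale finite_measure M
  by (intro finite_measure_lebesgue_on lmeasurable_open bounded_dom open_dom)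

lemma L2_integrable:
  fixes f :: "real ^ 'n \<Rightarrow> 'b::euclidean_space"
  assumes "f \<in> L2 \<Omega>"
  shows "integrable M f"
proof (rule Bochner_Integration.integrable_bound[where f = "\<lambda>x. 1 + f x \<bullet> f x"])
  show "integrable M (\<lambda>x. 1 + f x \<bullet> f x)" using L2_D[OF assms] by simp
  have "norm a \<le> 1 + a \<bullet> a" for a :: 'b
    using sum_squares_bound[of "norm a" 1] by (simp add: power2_norm_eq_inner[symmetric])
      (smt (verit) zero_le_power2)
  then show "AE x in M. norm (f x) \<le> norm (1 + f x \<bullet> f x)"
    by (intro AE_I2) (simp add: abs_of_nonneg add_nonneg_nonneg)
qed (rule L2_D[OF assms])

lemma test_C1c: "\<phi> \<in> test_functions \<Omega> \<Longrightarrow> C1c \<phi>"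
  by (rule test_functionsD)

lemma integral_test:
  fixes f :: "real ^ 'n \<Rightarrow> 'b::{banach, second_countable_topology}"
  assumes "continuous_on UNIV f" "bounded {x. f x \<noteq> 0}" "\<And>x. x \<notin> \<Omega> \<Longrightarrow> f x = 0"
  shows "integrable M f" "(LINT x|M. f x) = (LINT x|lborel. f x)"
  using integral_lebesgue_on[OF _ dom_sets assms(3)] integrable_continuous_bounded_support[OF assms(1,2)]
    borel_measurable_continuous_onI[OF assms(1)] by auto

lemma test_L2:
  assumes "\<phi> \<in> test_functions \<Omega>"
  shows "\<phi> \<in> L2 \<Omega>" "grad \<phi> \<in> L2 \<Omega>"
proof -
  note C = C1cD[OF test_C1c[OF assms]] and z = test_functionsD(2,3)[OF assms] and g = C1c_grad_support[OF test_C1c[OF assms]]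
  show "\<phi> \<in> L2 \<Omega>"
    by (intro L2_I borel_measurable_integrable[OF integral_test(1)] integral_test(1) continuous_intros C)
       (use C z in auto)
  show "grad \<phi> \<in> L2 \<Omega>"
    by (intro L2_I borel_measurable_integrable[OF integral_test(1)] integral_test(1) continuous_intros C)
       (use g z in auto)
qed

lemma test_weak_gradient:
  assumes "\<phi> \<in> test_functions \<Omega>"
  shows "has_weak_gradient \<Omega> \<phi> (grad \<phi>)"
  unfolding has_weak_gradient_def
proof (intro conjI ballI allI test_L2 assms)
  fix \<psi> i assume \<psi>: "\<psi> \<in> test_functions \<Omega>"
  note C = C1cD[OF test_C1c[OF assms]] and D = C1cD[OF test_C1c[OF \<psi>]]
  have 1: "(LINT x|M. \<phi> x * grad \<psi> x $ i) = (LINT x|lborel. \<phi> x * grad \<psi> x $ i)"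
    by (intro integral_test continuous_intros C D)
       (use test_functionsD(2)[OF assms] bounded_subset[OF C(4)] in \<open>auto simp: subset_iff\<close>)
  have 2: "(LINT x|M. grad \<phi> x $ i * \<psi> x) = (LINT x|lborel. grad \<phi> x $ i * \<psi> x)"
    by (intro integral_test continuous_intros C D)
       (use test_functionsD(2)[OF \<psi>] bounded_subset[OF D(4)] in \<open>auto simp: subset_iff\<close>)
  show "(LINT x|M. \<phi> x * partial_deriv i \<psi> x) = - (LINT x|M. grad \<phi> x $ i * \<psi> x)"
    unfolding partial_deriv_grad 1 2 by (intro integral_by_parts test_C1c assms \<psi>)
qed

lemma component_L2:
  fixes G :: "real ^ 'n \<Rightarrow> real ^ 'n"
  assumes "G \<in> L2 \<Omega>"
  shows "(\<lambda>x. G x $ i) \<in> L2 \<Omega>"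
proof (rule L2_I)
  have m: "(\<lambda>x. G x $ i) \<in> borel_measurable M"
    using L2_D(1)[OF assms] borel_measurable_inner[OF _ borel_measurable_const, of G M "axis i 1"] by (simp add: inner_axis)
  then show "(\<lambda>x. G x $ i) \<in> borel_measurable M" .
  show "integrable M (\<lambda>x. G x $ i \<bullet> G x $ i)"
  proof (rule Bochner_Integration.integrable_bound[OF L2_D(2)[OF assms]])
    show "(\<lambda>x. G x $ i \<bullet> G x $ i) \<in> borel_measurable M" using m by simp
    show "AE x in M. norm (G x $ i \<bullet> G x $ i) \<le> norm (G x \<bullet> G x)"
    proof (intro AE_I2)
      fix x
      have "\<bar>G x $ i\<bar>\<^sup>2 \<le> (norm (G x))\<^sup>2" by (intro power_mono component_le_norm_cart) simp
      then show "norm (G x $ i \<bullet> G x $ i) \<le> norm (G x \<bullet> G x)"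
        by (simp add: power2_norm_eq_inner) (simp add: power2_eq_square)
    qed
  qed
qed

text \<open>Each component of the difference is orthogonal to all test functions, so
  \<open>test_functions_separate\<close> applies to it.\<close>

lemma weak_gradient_unique:
  assumes "has_weak_gradient \<Omega> u G" "has_weak_gradient \<Omega> u G'"
  shows "AE x in M. G x = G' x"
proof -
  have G: "G \<in> L2 \<Omega>" "G' \<in> L2 \<Omega>" using assms by (auto simp: has_weak_gradient_def)
  have "AE x in M. G x $ i - G' x $ i = 0" for i
  proof (rule test_functions_separate[OF open_dom])
    show "integrable M (\<lambda>x. G x $ i - G' x $ i)"
      by (intro Bochner_Integration.integrable_diff L2_integrable component_L2 G)
    fix \<phi> assume \<phi>: "\<phi> \<in> test_functions \<Omega>"
    have i: "integrable M (\<lambda>x. G x $ i * \<phi> x)" "integrable M (\<lambda>x. G' x $ i * \<phi> x)"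
      using L2_integrable_inner[OF component_L2[OF G(1)] test_L2(1)[OF \<phi>]]
        L2_integrable_inner[OF component_L2[OF G(2)] test_L2(1)[OF \<phi>]] by simp_all
    have "(LINT x|M. G x $ i * \<phi> x) = (LINT x|M. G' x $ i * \<phi> x)"
      using assms \<phi> by (auto simp: has_weak_gradient_def)
    then show "(LINT x|M. (G x $ i - G' x $ i) * \<phi> x) = 0"
      using i by (simp add: left_diff_distrib)
  qed
  then have "AE x in M. \<forall>i\<in>UNIV. G x $ i - G' x $ i = 0"
    by (intro AE_finite_allI) auto
  then show ?thesis by eventually_elim (simp add: vec_eq_iff)
qed

text \<open>\<open>weak_grad\<close> is an arbitrary choice; by uniqueness up to null sets, any
  concrete weak gradient may replace it in integrals.\<close>

lemma weak_gradient_weak_grad: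
  assumes "has_weak_gradient \<Omega> u G"
  shows "has_weak_gradient \<Omega> u (weak_grad \<Omega> u)" "AE x in M. weak_grad \<Omega> u x = G x"
    "weak_grad \<Omega> u \<in> L2 \<Omega>"
proof -
  show *: "has_weak_gradient \<Omega> u (weak_grad \<Omega> u)"
    unfolding weak_grad_def using someI[of "has_weak_gradient \<Omega> u", OF assms] .
  show "AE x in M. weak_grad \<Omega> u x = G x" by (rule weak_gradient_unique[OF * assms])
  show "weak_grad \<Omega> u \<in> L2 \<Omega>" using * by (simp add: has_weak_gradient_def)
qed

lemma dirichlet_integral_eq:
  assumes "has_weak_gradient \<Omega> u G"
  shows "dirichlet_integral \<Omega> u = l2sq \<Omega> G"
proof -
  note w = weak_gradient_weak_grad[OF assms]
  have "G \<in> L2 \<Omega>" using assms by (simp add: has_weak_gradient_def)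
  then have "l2sq \<Omega> (weak_grad \<Omega> u) = l2sq \<Omega> G"
    by (intro l2in_cong_AE w)
  then show ?thesis by (simp add: dirichlet_integral_def l2in_def power2_norm_eq_inner)
qed

text \<open>Membership in \<open>H10\<close> with an explicit sequence and an explicit limit
  gradient. It avoids the norm \<open>H1_norm\<close>, which involves the chosen weak gradient of
  each difference, and is linear in an obvious way.\<close>

definition H1_limit :: "(nat \<Rightarrow> real ^ 'n \<Rightarrow> real) \<Rightarrow> (real ^ 'n \<Rightarrow> real) \<Rightarrow> (real ^ 'n \<Rightarrow> real ^ 'n) \<Rightarrow> bool" where
  "H1_limit \<phi> u G \<longleftrightarrow> u \<in> L2 \<Omega> \<and> G \<in> L2 \<Omega> \<and> (\<forall>n. \<phi> n \<in> test_functions \<Omega>) \<and>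
     (\<lambda>n. l2sq \<Omega> (\<lambda>x. \<phi> n x - u x)) \<longlonglongrightarrow> 0 \<and>
     (\<lambda>n. l2sq \<Omega> (\<lambda>x. grad (\<phi> n) x - G x)) \<longlonglongrightarrow> 0"

lemma H1_limit_weak_gradient:
  assumes "H1_limit \<phi> u G"
  shows "has_weak_gradient \<Omega> u G"
proof -
  have u: "u \<in> L2 \<Omega>" and G: "G \<in> L2 \<Omega>" and \<phi>: "\<phi> n \<in> test_functions \<Omega>"
    and l1: "(\<lambda>n. l2sq \<Omega> (\<lambda>x. \<phi> n x - u x)) \<longlonglongrightarrow> 0"
    and l2: "(\<lambda>n. l2sq \<Omega> (\<lambda>x. grad (\<phi> n) x - G x)) \<longlonglongrightarrow> 0" for n
    using assms by (auto simp: H1_limit_def)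
  show ?thesis
    unfolding has_weak_gradient_def
  proof (intro conjI ballI allI G)
    fix \<psi> i assume \<psi>: "\<psi> \<in> test_functions \<Omega>"
    have p: "(\<lambda>x. grad \<psi> x $ i) \<in> L2 \<Omega>" by (intro component_L2 test_L2 \<psi>)
    \<comment> \<open>Pairing with this field extracts the \<open>i\<close>-th component as a scalar
      product of vector fields, so that convergence of the gradients as a whole can be used.\<close>
    have v: "(\<lambda>x. \<psi> x *\<^sub>R axis i 1 :: real ^ 'n) \<in> L2 \<Omega>"
      using L2_D[OF test_L2(1)[OF \<psi>]] by (intro L2_I) (simp_all add: inner_axis)
    have 1: "(\<lambda>n. l2in \<Omega> (\<phi> n) (\<lambda>x. grad \<psi> x $ i)) \<longlonglongrightarrow> l2in \<Omega> u (\<lambda>x. grad \<psi> x $ i)"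
      by (intro l2in_tendsto test_L2 \<phi> u p l1)
    have 2: "(\<lambda>n. l2in \<Omega> (grad (\<phi> n)) (\<lambda>x. \<psi> x *\<^sub>R axis i 1)) \<longlonglongrightarrow> l2in \<Omega> G (\<lambda>x. \<psi> x *\<^sub>R axis i 1)"
      by (intro l2in_tendsto test_L2 \<phi> G v l2)
    have 3: "l2in \<Omega> (\<phi> n) (\<lambda>x. grad \<psi> x $ i) = - l2in \<Omega> (grad (\<phi> n)) (\<lambda>x. \<psi> x *\<^sub>R axis i 1)" for n
      using test_weak_gradient[OF \<phi>[of n]] \<psi>
      by (simp add: has_weak_gradient_def l2in_def inner_axis partial_deriv_grad mult.commute)
    have "l2in \<Omega> u (\<lambda>x. grad \<psi> x $ i) = - l2in \<Omega> G (\<lambda>x. \<psi> x *\<^sub>R axis i 1)"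
      by (rule LIMSEQ_unique[OF 1]) (use tendsto_minus[OF 2] in \<open>simp add: 3\<close>)
    then show "(LINT x|M. u x * partial_deriv i \<psi> x) = - (LINT x|M. G x $ i * \<psi> x)"
      by (simp add: l2in_def inner_axis partial_deriv_grad mult.commute)
  qed
qed

lemma H1_limit_linear:
  assumes "H1_limit \<phi> u G" "H1_limit \<psi> v K"
  shows "H1_limit (\<lambda>n x. \<alpha> * \<phi> n x + \<beta> * \<psi> n x) (\<lambda>x. \<alpha> * u x + \<beta> * v x) (\<lambda>x. \<alpha> *\<^sub>R G x + \<beta> *\<^sub>R K x)"
proof -
  have t: "\<phi> n \<in> test_functions \<Omega>" "\<psi> n \<in> test_functions \<Omega>" for n
    using assms by (auto simp: H1_limit_def)
  have u: "u \<in> L2 \<Omega>" "v \<in> L2 \<Omega>" "G \<in> L2 \<Omega>" "K \<in> L2 \<Omega>"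
    using assms by (auto simp: H1_limit_def)
  have eq1: "(\<lambda>x. (\<alpha> * \<phi> n x + \<beta> * \<psi> n x) - (\<alpha> * u x + \<beta> * v x)) = (\<lambda>x. \<alpha> *\<^sub>R (\<phi> n x - u x) + \<beta> *\<^sub>R (\<psi> n x - v x))" for n
    by (auto simp: algebra_simps)
  have eq2: "(\<lambda>x. grad (\<lambda>x. \<alpha> * \<phi> n x + \<beta> * \<psi> n x) x - (\<alpha> *\<^sub>R G x + \<beta> *\<^sub>R K x)) =
      (\<lambda>x. \<alpha> *\<^sub>R (grad (\<phi> n) x - G x) + \<beta> *\<^sub>R (grad (\<psi> n) x - K x))" for n
    using grad_linear[OF test_C1c[OF t(1)[of n]] test_C1c[OF t(2)[of n]]] by (auto simp: algebra_simps)
  show ?thesis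
    unfolding H1_limit_def eq1 eq2
  proof (intro conjI allI test_functions_linear t)
    show "(\<lambda>x. \<alpha> * u x + \<beta> * v x) \<in> L2 \<Omega>" using L2_linear[OF u(1,2), of \<alpha> \<beta>] by simp
    show "(\<lambda>x. \<alpha> *\<^sub>R G x + \<beta> *\<^sub>R K x) \<in> L2 \<Omega>" by (rule L2_linear[OF u(3,4)])
    show "(\<lambda>n. l2sq \<Omega> (\<lambda>x. \<alpha> *\<^sub>R (\<phi> n x - u x) + \<beta> *\<^sub>R (\<psi> n x - v x))) \<longlonglongrightarrow> 0"
      by (intro l2in_linear_tendsto_0 L2_diff test_L2(1) t u) (use assms in \<open>auto simp: H1_limit_def\<close>)
    show "(\<lambda>n. l2sq \<Omega> (\<lambda>x. \<alpha> *\<^sub>R (grad (\<phi> n) x - G x) + \<beta> *\<^sub>R (grad (\<psi> n) x - K x))) \<longlonglongrightarrow> 0"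
      by (intro l2in_linear_tendsto_0 L2_diff test_L2(2) t u) (use assms in \<open>auto simp: H1_limit_def\<close>)
  qed
qed

lemma H1_limit_const:
  assumes "\<phi> \<in> test_functions \<Omega>"
  shows "H1_limit (\<lambda>_. \<phi>) \<phi> (grad \<phi>)"
  using assms test_L2[OF assms] by (auto simp: H1_limit_def l2in_def)

lemma H1_norm_eq:
  assumes "has_weak_gradient \<Omega> u G"
  shows "(H1_norm \<Omega> u)\<^sup>2 = l2sq \<Omega> u + l2sq \<Omega> G" "H1_norm \<Omega> u \<ge> 0"
proof -
  have eq: "H1_norm \<Omega> u = sqrt (l2sq \<Omega> u + l2sq \<Omega> G)"
    using dirichlet_integral_eq[OF assms]
    by (simp add: H1_norm_def dirichlet_integral_def) (simp add: l2in_def power2_eq_square)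
  then show "(H1_norm \<Omega> u)\<^sup>2 = l2sq \<Omega> u + l2sq \<Omega> G" "H1_norm \<Omega> u \<ge> 0" by simp_all
qed

lemma weak_gradient_diff:
  assumes "has_weak_gradient \<Omega> u G" "u \<in> L2 \<Omega>" "\<phi> \<in> test_functions \<Omega>"
  shows "has_weak_gradient \<Omega> (\<lambda>x. u x - \<phi> x) (\<lambda>x. G x - grad \<phi> x)"
  unfolding has_weak_gradient_def
proof (intro conjI ballI allI)
  have G: "G \<in> L2 \<Omega>" using assms by (simp add: has_weak_gradient_def)
  show "(\<lambda>x. G x - grad \<phi> x) \<in> L2 \<Omega>" by (intro L2_diff G test_L2 assms)
  fix \<psi> i assume \<psi>: "\<psi> \<in> test_functions \<Omega>"
  have i: "integrable M (\<lambda>x. f x * g x)" if "f \<in> L2 \<Omega>" "g \<in> L2 \<Omega>" for f g :: "real ^ 'n \<Rightarrow> real"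
    using L2_integrable_inner[OF that] by simp
  have p: "partial_deriv i \<psi> \<in> L2 \<Omega>"
    using component_L2[OF test_L2(2)[OF \<psi>], of i] by (simp add: partial_deriv_grad[abs_def])
  have "(LINT x|M. u x * partial_deriv i \<psi> x) = - (LINT x|M. G x $ i * \<psi> x)"
    "(LINT x|M. \<phi> x * partial_deriv i \<psi> x) = - (LINT x|M. grad \<phi> x $ i * \<psi> x)"
    using assms(1) test_weak_gradient[OF assms(3)] \<psi> by (auto simp: has_weak_gradient_def)
  then show "(LINT x|M. (u x - \<phi> x) * partial_deriv i \<psi> x) = - (LINT x|M. (G x - grad \<phi> x) $ i * \<psi> x)"
    using i[OF assms(2) p] i[OF test_L2(1)[OF assms(3)] p] i[OF component_L2[OF G] test_L2(1)[OF \<psi>]]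
      i[OF component_L2[OF test_L2(2)[OF assms(3)]] test_L2(1)[OF \<psi>]]
    by (simp add: left_diff_distrib)
qed

lemma l2in_diff_commute:
  "l2sq \<Omega> (\<lambda>x. f x - g x) = l2sq \<Omega> (\<lambda>x. g x - f x)"
  unfolding l2in_def by (rule Bochner_Integration.integral_cong) (auto simp: inner_diff_left inner_diff_right)

lemma H1_limit_H10:
  assumes "H1_limit \<phi> u G"
  shows "u \<in> H10 \<Omega>"
proof -
  note wg = H1_limit_weak_gradient[OF assms]
  have u: "u \<in> L2 \<Omega>" and \<phi>: "\<phi> n \<in> test_functions \<Omega>" for n
    using assms by (auto simp: H1_limit_def)
  have n: "(H1_norm \<Omega> (\<lambda>x. u x - \<phi> n x))\<^sup>2 = l2sq \<Omega> (\<lambda>x. \<phi> n x - u x)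
      + l2sq \<Omega> (\<lambda>x. grad (\<phi> n) x - G x)" "H1_norm \<Omega> (\<lambda>x. u x - \<phi> n x) \<ge> 0" for n
    using H1_norm_eq[OF weak_gradient_diff[OF wg u \<phi>]] l2in_diff_commute[of "\<phi> n" u]
      l2in_diff_commute[of "grad (\<phi> n)" G] by simp_all
  have "(\<lambda>n. (H1_norm \<Omega> (\<lambda>x. u x - \<phi> n x))\<^sup>2) \<longlonglongrightarrow> 0 + 0"
    unfolding n by (intro tendsto_add) (use assms in \<open>auto simp: H1_limit_def\<close>)
  then have lim: "(\<lambda>n. (H1_norm \<Omega> (\<lambda>x. u x - \<phi> n x))\<^sup>2) \<longlonglongrightarrow> 0" by simp
  have "\<exists>\<phi>\<in>test_functions \<Omega>. H1_norm \<Omega> (\<lambda>x. u x - \<phi> x) < \<epsilon>" if "\<epsilon> > 0" for \<epsilon>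
  proof -
    have "\<forall>\<^sub>F n in sequentially. (H1_norm \<Omega> (\<lambda>x. u x - \<phi> n x))\<^sup>2 < \<epsilon>\<^sup>2"
      using order_tendstoD(2)[OF lim] that by simp
    then obtain n where "(H1_norm \<Omega> (\<lambda>x. u x - \<phi> n x))\<^sup>2 < \<epsilon>\<^sup>2"
      by (auto simp: eventually_sequentially)
    then have "H1_norm \<Omega> (\<lambda>x. u x - \<phi> n x) < \<epsilon>"
      by (rule power2_less_imp_less) (use that in simp)
    then show ?thesis using \<phi> by blast
  qed
  then show ?thesis using wg u by (auto simp: H10_def H1_def)
qed

lemma H10_L2: "u \<in> H10 \<Omega> \<Longrightarrow> u \<in> L2 \<Omega>"
  by (simp add: H10_def H1_def)

lemma H10_H1_limit:
  assumes "u \<in> H10 \<Omega>"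
  obtains \<phi> where "H1_limit \<phi> u (weak_grad \<Omega> u)"
proof -
  have u: "u \<in> L2 \<Omega>" using assms by (rule H10_L2)
  obtain G where "has_weak_gradient \<Omega> u G" using assms by (auto simp: H10_def H1_def)
  then have wg: "has_weak_gradient \<Omega> u (weak_grad \<Omega> u)" by (rule weak_gradient_weak_grad)
  have "\<exists>\<phi>\<in>test_functions \<Omega>. H1_norm \<Omega> (\<lambda>x. u x - \<phi> x) < 1 / real (Suc n)" for n
    using assms by (simp add: H10_def)
  then obtain \<phi> where \<phi>: "\<And>n. \<phi> n \<in> test_functions \<Omega>" "\<And>n. H1_norm \<Omega> (\<lambda>x. u x - \<phi> n x) < 1 / real (Suc n)"
    by metis
  have n: "(H1_norm \<Omega> (\<lambda>x. u x - \<phi> n x))\<^sup>2 = l2sq \<Omega> (\<lambda>x. \<phi> n x - u x)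
      + l2sq \<Omega> (\<lambda>x. grad (\<phi> n) x - weak_grad \<Omega> u x)"
    "H1_norm \<Omega> (\<lambda>x. u x - \<phi> n x) \<ge> 0" for n
    using H1_norm_eq[OF weak_gradient_diff[OF wg u \<phi>(1)]] l2in_diff_commute[of "\<phi> n" u]
      l2in_diff_commute[of "grad (\<phi> n)" "weak_grad \<Omega> u"] by simp_all
  have le: "(H1_norm \<Omega> (\<lambda>x. u x - \<phi> n x))\<^sup>2 \<le> (1 / real (Suc n))\<^sup>2" for n
    using \<phi>(2)[of n] n(2)[of n] by (intro power_mono) auto
  have lim: "(\<lambda>n. (1 / real (Suc n))\<^sup>2) \<longlonglongrightarrow> 0"
    using tendsto_power[OF LIMSEQ_Suc[OF lim_1_over_n], of 2] by (simp only: zero_power2)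
  have "H1_limit \<phi> u (weak_grad \<Omega> u)"
    unfolding H1_limit_def
  proof (intro conjI allI u \<phi>)
    show "weak_grad \<Omega> u \<in> L2 \<Omega>" using wg by (simp add: has_weak_gradient_def)
    show "(\<lambda>n. l2sq \<Omega> (\<lambda>x. \<phi> n x - u x)) \<longlonglongrightarrow> 0"
      by (rule tendsto_sandwich[OF _ _ tendsto_const lim]) (intro always_eventually allI, use le n in \<open>smt (verit) l2in_nonneg\<close>)+
    show "(\<lambda>n. l2sq \<Omega> (\<lambda>x. grad (\<phi> n) x - weak_grad \<Omega> u x)) \<longlonglongrightarrow> 0"
      by (rule tendsto_sandwich[OF _ _ tendsto_const lim]) (intro always_eventually allI, use le n in \<open>smt (verit) l2in_nonneg\<close>)+
  qed
  with that show thesis by blast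
qed

lemma H10_weak_gradient:
  assumes "u \<in> H10 \<Omega>"
  shows "has_weak_gradient \<Omega> u (weak_grad \<Omega> u)" "weak_grad \<Omega> u \<in> L2 \<Omega>"
proof -
  obtain G where "has_weak_gradient \<Omega> u G" using assms by (auto simp: H10_def H1_def)
  then show "has_weak_gradient \<Omega> u (weak_grad \<Omega> u)" "weak_grad \<Omega> u \<in> L2 \<Omega>"
    by (rule weak_gradient_weak_grad)+
qed

text \<open>On a line in \<open>H10\<close> the Dirichlet integral is a quadratic polynomial; this
  is what makes the Kirchhoff term differentiable in every direction.\<close>

lemma H10_linear:
  assumes "u \<in> H10 \<Omega>" "v \<in> H10 \<Omega>"
  shows "(\<lambda>x. \<alpha> * u x + \<beta> * v x) \<in> H10 \<Omega>"
    "dirichlet_integral \<Omega> (\<lambda>x. \<alpha> * u x + \<beta> * v x) =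
      \<alpha>\<^sup>2 * dirichlet_integral \<Omega> u + 2 * \<alpha> * \<beta> * l2in \<Omega> (weak_grad \<Omega> u) (weak_grad \<Omega> v) + \<beta>\<^sup>2 * dirichlet_integral \<Omega> v"
proof -
  obtain \<phi> where \<phi>: "H1_limit \<phi> u (weak_grad \<Omega> u)" using H10_H1_limit[OF assms(1)] .
  obtain \<psi> where \<psi>: "H1_limit \<psi> v (weak_grad \<Omega> v)" using H10_H1_limit[OF assms(2)] .
  note lin = H1_limit_linear[OF \<phi> \<psi>, of \<alpha> \<beta>]
  show "(\<lambda>x. \<alpha> * u x + \<beta> * v x) \<in> H10 \<Omega>" by (rule H1_limit_H10[OF lin])
  show "dirichlet_integral \<Omega> (\<lambda>x. \<alpha> * u x + \<beta> * v x) =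
      \<alpha>\<^sup>2 * dirichlet_integral \<Omega> u + 2 * \<alpha> * \<beta> * l2in \<Omega> (weak_grad \<Omega> u) (weak_grad \<Omega> v) + \<beta>\<^sup>2 * dirichlet_integral \<Omega> v"
    using dirichlet_integral_eq[OF H1_limit_weak_gradient[OF lin]]
      dirichlet_integral_eq[OF H1_limit_weak_gradient[OF \<phi>]] dirichlet_integral_eq[OF H1_limit_weak_gradient[OF \<psi>]]
    by (simp add: l2in_square H10_weak_gradient assms)
qed

end

section \<open>The best Sobolev constant and weak compactness\<close>

context sobolev_domain
begin

lemma H1_limitD:
  assumes "H1_limit \<phi> u G"
  shows "u \<in> L2 \<Omega>" "G \<in> L2 \<Omega>" "\<And>n. \<phi> n \<in> test_functions \<Omega>"
    "(\<lambda>n. l2sq \<Omega> (\<lambda>x. \<phi> n x - u x)) \<longlonglongrightarrow> 0"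
    "(\<lambda>n. l2sq \<Omega> (\<lambda>x. grad (\<phi> n) x - G x)) \<longlonglongrightarrow> 0"
  using assms by (auto simp: H1_limit_def)

lemma H1_limit_AE_subseq:
  assumes "H1_limit \<phi> u G"
  obtains r :: "nat \<Rightarrow> nat" where "strict_mono r" "AE x in M. (\<lambda>n. \<phi> (r n) x) \<longlonglongrightarrow> u x"
proof -
  note H = H1_limitD[OF assms]
  have "\<exists>r::nat\<Rightarrow>nat. strict_mono r \<and> (AE x in M. (\<lambda>n. (\<phi> (r n) x - u x) \<bullet> (\<phi> (r n) x - u x)) \<longlonglongrightarrow> 0)"
  proof (rule tendsto_L1_AE_subseq)
    show "integrable M (\<lambda>x. (\<phi> n x - u x) \<bullet> (\<phi> n x - u x))" for n
      by (intro L2_integrable_inner L2_diff test_L2 H)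
    show "(\<lambda>n. LINT x|M. norm ((\<phi> n x - u x) \<bullet> (\<phi> n x - u x))) \<longlonglongrightarrow> 0"
      using H(4) by (simp add: l2in_def)
  qed
  then obtain r :: "nat \<Rightarrow> nat" where r: "strict_mono r" "AE x in M. (\<lambda>n. (\<phi> (r n) x - u x) \<bullet> (\<phi> (r n) x - u x)) \<longlonglongrightarrow> 0" by blast
  have "AE x in M. (\<lambda>n. \<phi> (r n) x) \<longlonglongrightarrow> u x"
    using r(2)
  proof eventually_elim
    case (elim x)
    from tendsto_real_sqrt[OF this] have "(\<lambda>n. \<phi> (r n) x - u x) \<longlonglongrightarrow> 0"
      by (simp add: real_sqrt_mult_self tendsto_rabs_zero_iff)
    then show ?case by (simp add: LIM_zero_iff)
  qed
  with r(1) that show thesis by blast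
qed

lemma sobolev_test:
  obtains C where "C > 0"
    "\<And>\<phi>. \<phi> \<in> test_functions \<Omega> \<Longrightarrow> integrable M (\<lambda>x. \<bar>\<phi> x\<bar> powr q)"
    "\<And>\<phi>. \<phi> \<in> test_functions \<Omega> \<Longrightarrow> (LINT x|M. \<bar>\<phi> x\<bar> powr q) \<le> (C * l2sq \<Omega> (grad \<phi>)) powr (q / 2)"
proof -
  define C where "C = (2 * (real CARD('n) - 1) / (real CARD('n) - 2))\<^sup>2"
  have C: "C > 0" using dim by (simp add: C_def)
  have *: "integrable M (\<lambda>x. \<bar>\<phi> x\<bar> powr q) \<and> (LINT x|M. \<bar>\<phi> x\<bar> powr q) \<le> (C * l2sq \<Omega> (grad \<phi>)) powr (q / 2)"
    if \<phi>: "\<phi> \<in> test_functions \<Omega>" for \<phi>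
  proof -
    note c = C1cD[OF test_C1c[OF \<phi>]]
    have 1: "integrable M (\<lambda>x. \<bar>\<phi> x\<bar> powr q)" "(LINT x|M. \<bar>\<phi> x\<bar> powr q) = (LINT x|lborel. \<bar>\<phi> x\<bar> powr q)"
      by (intro integral_test continuous_on_powr' continuous_intros c;
          use c test_functionsD(2)[OF \<phi>] q_gt_2 in auto)+
    have 2: "l2sq \<Omega> (grad \<phi>) = (LINT x|lborel. (norm (grad \<phi> x))\<^sup>2)"
      unfolding l2in_def power2_norm_eq_inner
      by (intro integral_test continuous_intros c)
         (use C1c_grad_support[OF test_C1c[OF \<phi>]] test_functionsD(3)[OF \<phi>] in auto)
    show ?thesis
      using sobolev_C1c[OF dim test_C1c[OF \<phi>]] 1 unfolding 2 C_def q_eq by simp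
  qed
  show thesis by (rule that[OF C]) (use * in auto)
qed

text \<open>Fatou's lemma along an a.e. convergent subsequence of approximating test functions;
  their Dirichlet integrals converge, which controls the right-hand side.\<close>

lemma sobolev_H10:
  obtains C where "C > 0"
    "\<And>u. u \<in> H10 \<Omega> \<Longrightarrow> integrable M (\<lambda>x. \<bar>u x\<bar> powr q)"
    "\<And>u. u \<in> H10 \<Omega> \<Longrightarrow> (LINT x|M. \<bar>u x\<bar> powr q) \<le> (C * dirichlet_integral \<Omega> u) powr (q / 2)"
proof -
  obtain C where C: "C > 0"
    and int: "\<And>\<phi>. \<phi> \<in> test_functions \<Omega> \<Longrightarrow> integrable M (\<lambda>x. \<bar>\<phi> x\<bar> powr q)"
    and le: "\<And>\<phi>. \<phi> \<in> test_functions \<Omega> \<Longrightarrow> (LINT x|M. \<bar>\<phi> x\<bar> powr q) \<le> (C * l2sq \<Omega> (grad \<phi>)) powr (q / 2)"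
    using sobolev_test by blast
  have *: "integrable M (\<lambda>x. \<bar>u x\<bar> powr q) \<and> (LINT x|M. \<bar>u x\<bar> powr q) \<le> (C * dirichlet_integral \<Omega> u) powr (q / 2)"
    if u: "u \<in> H10 \<Omega>" for u
  proof -
    obtain \<phi> where \<phi>: "H1_limit \<phi> u (weak_grad \<Omega> u)" using H10_H1_limit[OF u] .
    note H = H1_limitD[OF \<phi>]
    obtain r :: "nat \<Rightarrow> nat" where r: "strict_mono r" "AE x in M. (\<lambda>n. \<phi> (r n) x) \<longlonglongrightarrow> u x"
      using H1_limit_AE_subseq[OF \<phi>] .
    let ?c = "\<lambda>n. (C * l2sq \<Omega> (grad (\<phi> (r n)))) powr (q / 2)"
    have "(\<lambda>n. l2sq \<Omega> (grad (\<phi> n))) \<longlonglongrightarrow> l2sq \<Omega> (weak_grad \<Omega> u)"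
      by (intro l2in_self_tendsto test_L2 H)
    then have lim: "(\<lambda>n. l2sq \<Omega> (grad (\<phi> (r n)))) \<longlonglongrightarrow> dirichlet_integral \<Omega> u"
      unfolding dirichlet_integral_eq[OF H10_weak_gradient(1)[OF u]]
      by (rule LIMSEQ_subseq_LIMSEQ[OF _ r(1), unfolded o_def])
    have clim: "?c \<longlonglongrightarrow> (C * dirichlet_integral \<Omega> u) powr (q / 2)"
      by (intro tendsto_powr' tendsto_intros lim disjI2 conjI always_eventually allI mult_nonneg_nonneg)
         (use q_gt_2 C in auto)
    have m: "(\<lambda>x. \<bar>u x\<bar> powr q) \<in> borel_measurable M"
      using L2_D(1)[OF H(1)] by measurable
    have "AE x in M. (\<lambda>n. \<bar>\<phi> (r n) x\<bar> powr q) \<longlonglongrightarrow> \<bar>u x\<bar> powr q"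
      using r(2) by eventually_elim (intro tendsto_powr' tendsto_intros disjI2 conjI always_eventually allI, use q_gt_2 in auto)
    with Fatou_real[of M "\<lambda>n x. \<bar>\<phi> (r n) x\<bar> powr q", OF int[OF H(3)] _ m _ le[OF H(3)] clim]
    show ?thesis by auto
  qed
  show thesis by (rule that[OF C]) (use * in auto)
qed

lemma dirichlet_nonneg: "dirichlet_integral \<Omega> u \<ge> 0"
  by (simp add: dirichlet_integral_def)

lemma AE_zero_iff:
  assumes "integrable M (\<lambda>x. \<bar>u x\<bar> powr q)"
  shows "(LINT x|M. \<bar>u x\<bar> powr q) = 0 \<longleftrightarrow> (AE x in M. u x = 0)"
  using integral_nonneg_eq_0_iff_AE[OF assms] by simp

text \<open>A bump vanishing a.e. would vanish everywhere in the domain, its zero set being closed.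
  The function makes the set of Sobolev quotients nonempty and later yields a negative
  energy.\<close>

lemma nonzero_test_function:
  obtains \<phi> where "\<phi> \<in> test_functions \<Omega>" "\<not> (AE x in M. \<phi> x = 0)"
proof -
  obtain x0 where x0: "x0 \<in> \<Omega>" using nonempty_dom by blast
  obtain a b where ab: "cbox a b \<subseteq> \<Omega>" "x0 \<in> box a b"
    using open_contains_cbox[OF open_dom x0] by metis
  let ?\<phi> = "bump 1 a b (\<lambda>_. 0) (\<lambda>_. 0)"
  have t: "?\<phi> \<in> test_functions \<Omega>" by (rule bump_test_function[OF _ ab(1)]) simp
  have "\<not> (AE x in M. ?\<phi> x = 0)"
  proof
    assume "AE x in M. ?\<phi> x = 0"
    then have ae: "AE x\<in>\<Omega> in lebesgue. x \<in> {x. ?\<phi> x = 0}" using dom_sets by (simp add: AE_restrict_space_iff)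
    have "closed {x. ?\<phi> x = 0}"
      using C1cD(2)[OF test_C1c[OF t]] by (intro closed_Collect_eq) auto
    then have "x0 \<in> {x. ?\<phi> x = 0}"
      by (rule mem_closed_if_AE_lebesgue_open[OF open_dom _ ae x0])
    then show False using ab(2) bump_nonzero_iff by blast
  qed
  with t that show thesis by blast
qed

lemma test_H10: "\<phi> \<in> test_functions \<Omega> \<Longrightarrow> \<phi> \<in> H10 \<Omega>"
  by (rule H1_limit_H10[OF H1_limit_const])

lemma dirichlet_test: "\<phi> \<in> test_functions \<Omega> \<Longrightarrow> dirichlet_integral \<Omega> \<phi> = l2sq \<Omega> (grad \<phi>)"
  by (rule dirichlet_integral_eq[OF test_weak_gradient])

text \<open>A real \<open>Inf\<close> says something only about a nonempty set that is bounded
  below. The Sobolev inequality supplies the lower bound \<open>1 / C\<close>, which also makes the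
  constant positive; the inequality with the best constant is then the infimum property
  rearranged.\<close>

lemma best_sobolev:
  shows "best_sobolev_const \<Omega> > 0"
    "u \<in> H10 \<Omega> \<Longrightarrow> integrable M (\<lambda>x. \<bar>u x\<bar> powr q)"
    "u \<in> H10 \<Omega> \<Longrightarrow> (LINT x|M. \<bar>u x\<bar> powr q) \<le> best_sobolev_const \<Omega> powr (- q / 2) * dirichlet_integral \<Omega> u powr (q / 2)"
proof -
  obtain C where C: "C > 0"
    and int: "\<And>u. u \<in> H10 \<Omega> \<Longrightarrow> integrable M (\<lambda>x. \<bar>u x\<bar> powr q)"
    and le: "\<And>u. u \<in> H10 \<Omega> \<Longrightarrow> (LINT x|M. \<bar>u x\<bar> powr q) \<le> (C * dirichlet_integral \<Omega> u) powr (q / 2)"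
    using sobolev_H10 by blast
  let ?I = "\<lambda>u. LINT x|M. \<bar>u x\<bar> powr q" and ?S = "best_sobolev_const \<Omega>"
  define Q where "Q = {dirichlet_integral \<Omega> u / ?I u powr (2 / q) | u. u \<in> H10 \<Omega> \<and> \<not> (AE x in M. u x = 0)}"
  have S: "?S = Inf Q" by (simp add: best_sobolev_const_def Q_def q_eq)
  have I0: "?I u \<ge> 0" for u by simp
  have Ipos: "?I u > 0" if "u \<in> H10 \<Omega>" "\<not> (AE x in M. u x = 0)" for u
    using AE_zero_iff[OF int[OF that(1)]] that(2) I0[of u] by linarith
  have lb: "1 / C \<le> y" if "y \<in> Q" for y
  proof -
    obtain u where u: "u \<in> H10 \<Omega>" "\<not> (AE x in M. u x = 0)" "y = dirichlet_integral \<Omega> u / ?I u powr (2 / q)"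
      using \<open>y \<in> Q\<close> by (auto simp: Q_def)
    have "?I u powr (2 / q) \<le> ((C * dirichlet_integral \<Omega> u) powr (q / 2)) powr (2 / q)"
      using le[OF u(1)] q_gt_2 by (intro powr_mono2) auto
    also have "\<dots> = C * dirichlet_integral \<Omega> u"
      using q_gt_2 C dirichlet_nonneg[of u] by (simp add: powr_powr)
    finally have *: "?I u powr (2 / q) \<le> C * dirichlet_integral \<Omega> u" .
    have "?I u powr (2 / q) > 0" using Ipos[OF u(1,2)] by simp
    then show ?thesis using * C unfolding u(3) by (simp add: field_simps)
  qed
  have ne: "Q \<noteq> {}"
  proof -
    obtain \<phi> where "\<phi> \<in> test_functions \<Omega>" "\<not> (AE x in M. \<phi> x = 0)" using nonzero_test_function .
    then show ?thesis using test_H10 by (auto simp: Q_def)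
  qed
  have "1 / C \<le> ?S" unfolding S by (rule cInf_greatest[OF ne lb])
  then show S0: "?S > 0" using C by (smt (verit) zero_less_divide_1_iff)
  have bdd: "bdd_below Q" using lb by (rule bdd_belowI)
  show "u \<in> H10 \<Omega> \<Longrightarrow> integrable M (\<lambda>x. \<bar>u x\<bar> powr q)" by (rule int)
  assume u: "u \<in> H10 \<Omega>"
  show "?I u \<le> ?S powr (- q / 2) * dirichlet_integral \<Omega> u powr (q / 2)"
  proof (cases "AE x in M. u x = 0")
    case True
    then have "?I u = 0" using AE_zero_iff[OF int[OF u]] by simp
    then show ?thesis by simp
  next
    case False
    have "?S \<le> dirichlet_integral \<Omega> u / ?I u powr (2 / q)"
      unfolding S by (rule cInf_lower[OF _ bdd]) (use u False in \<open>auto simp: Q_def\<close>)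
    moreover have p: "?I u powr (2 / q) > 0" using Ipos[OF u False] by simp
    ultimately have "?I u powr (2 / q) \<le> dirichlet_integral \<Omega> u / ?S"
      using S0 by (simp add: field_simps)
    then have "(?I u powr (2 / q)) powr (q / 2) \<le> (dirichlet_integral \<Omega> u / ?S) powr (q / 2)"
      using q_gt_2 by (intro powr_mono2) auto
    moreover have "(?I u powr (2 / q)) powr (q / 2) = ?I u"
      using q_gt_2 Ipos[OF u False] by (simp add: powr_powr)
    moreover have "(dirichlet_integral \<Omega> u / ?S) powr (q / 2) = ?S powr (- q / 2) * dirichlet_integral \<Omega> u powr (q / 2)"
    proof -
      have "- q / 2 = - (q / 2)" by simp
      then show ?thesis
        using S0 dirichlet_nonneg[of u] by (simp only: powr_minus_divide powr_divide less_imp_le) simp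
    qed
    ultimately show ?thesis by simp
  qed
qed

text \<open>Comes from the Sobolev inequality and the finite volume, with a pointwise splitting at
  height \<open>sqrt s\<close> in the role of Hoelder's inequality.\<close>

lemma poincare_test:
  obtains C where "C > 0"
    "\<And>\<phi>. \<phi> \<in> test_functions \<Omega> \<Longrightarrow> l2sq \<Omega> \<phi> \<le> C * l2sq \<Omega> (grad \<phi>)"
proof -
  obtain C0 where C0: "C0 > 0"
    and int: "\<And>\<phi>. \<phi> \<in> test_functions \<Omega> \<Longrightarrow> integrable M (\<lambda>x. \<bar>\<phi> x\<bar> powr q)"
    and le: "\<And>\<phi>. \<phi> \<in> test_functions \<Omega> \<Longrightarrow> (LINT x|M. \<bar>\<phi> x\<bar> powr q) \<le> (C0 * l2sq \<Omega> (grad \<phi>)) powr (q / 2)"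
    using sobolev_test by blast
  define C1 where "C1 = C0 powr (q / 2)"
  define m where "m = measure M \<Omega>"
  define C where "C = m + C1"
  have C1: "C1 > 0" using C0 by (simp add: C1_def)
  have m: "m \<ge> 0" by (simp add: m_def)
  have sp: "space M = \<Omega>" by simp
  have C: "C > 0" using C1 m by (simp add: C_def)
  have "l2sq \<Omega> \<phi> \<le> C * l2sq \<Omega> (grad \<phi>)" if \<phi>: "\<phi> \<in> test_functions \<Omega>" for \<phi>
  proof -
    define D where "D = l2sq \<Omega> (grad \<phi>)"
    have D: "D \<ge> 0" by (simp add: D_def)
    \<comment> \<open>A value strictly above \<open>D\<close> is positive even if
      \<open>D = 0\<close>, as the power \<open>s powr (1 - q / 2)\<close> demands; at the end
      \<open>s\<close> descends to \<open>D\<close>.\<close>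
    have *: "l2sq \<Omega> \<phi> \<le> C * s" if s: "s > D" for s
    proof -
      have s0: "s > 0" using s D by simp
      \<comment> \<open>Homogeneity: the right-hand side has degree 1 in \<open>s\<close> when \<open>\<bar>y\<bar> powr q\<close> is of the order of \<open>s powr (q / 2)\<close>.\<close>
      have pw: "y * y \<le> s + s powr (1 - q / 2) * \<bar>y\<bar> powr q" for y :: real
      proof (cases "y\<^sup>2 \<le> s")
        case True
        then show ?thesis by (simp add: power2_eq_square add_increasing2)
      next
        case False
        then have y: "y\<^sup>2 > s" "\<bar>y\<bar> > 0" using s0 by (auto simp: not_le)
        have "s powr (q / 2 - 1) \<le> (y\<^sup>2) powr (q / 2 - 1)"
          using y s0 q_gt_2 by (intro powr_mono2) auto
        also have "\<dots> = \<bar>y\<bar> powr (q - 2)"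
        proof -
          have "y\<^sup>2 = \<bar>y\<bar> powr 2" using y by (simp add: powr_numeral)
          moreover have "2 * (q / 2 - 1) = q - 2" by simp
          ultimately show ?thesis by (simp only: powr_powr)
        qed
        finally have "s powr (1 - q / 2) * s powr (q / 2 - 1) \<le> s powr (1 - q / 2) * \<bar>y\<bar> powr (q - 2)"
          by (rule mult_left_mono) simp
        then have "1 \<le> s powr (1 - q / 2) * \<bar>y\<bar> powr (q - 2)"
          using s0 by (simp flip: powr_add)
        then have "y\<^sup>2 * 1 \<le> y\<^sup>2 * (s powr (1 - q / 2) * \<bar>y\<bar> powr (q - 2))"
          by (rule mult_left_mono) simp
        also have "\<dots> = s powr (1 - q / 2) * (\<bar>y\<bar> powr 2 * \<bar>y\<bar> powr (q - 2))"
          using y by (simp add: powr_numeral)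
        also have "\<bar>y\<bar> powr 2 * \<bar>y\<bar> powr (q - 2) = \<bar>y\<bar> powr q"
          by (simp only: powr_add[symmetric]) simp
        finally show ?thesis using s0 by (simp add: power2_eq_square)
      qed
      have "l2sq \<Omega> \<phi> \<le> (LINT x|M. s + s powr (1 - q / 2) * \<bar>\<phi> x\<bar> powr q)"
        unfolding l2in_def inner_real_def
        using L2_integrable_inner[OF test_L2(1)[OF \<phi>] test_L2(1)[OF \<phi>]] int[OF \<phi>]
        by (intro integral_mono pw) auto
      also have "\<dots> = s * m + s powr (1 - q / 2) * (LINT x|M. \<bar>\<phi> x\<bar> powr q)"
        using int[OF \<phi>] sp by (simp add: m_def mult.commute)
      also have "\<dots> \<le> s * m + s powr (1 - q / 2) * (C0 * D) powr (q / 2)"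
        using le[OF \<phi>] by (intro add_left_mono mult_left_mono) (auto simp: D_def)
      also have "(C0 * D) powr (q / 2) = C1 * D powr (q / 2)"
        using C0 D by (simp add: C1_def powr_mult)
      also have "s * m + s powr (1 - q / 2) * (C1 * D powr (q / 2)) \<le> s * m + s powr (1 - q / 2) * (C1 * s powr (q / 2))"
        using s D C1 q_gt_2 by (intro add_left_mono mult_left_mono powr_mono2) auto
      also have "\<dots> = s * m + C1 * (s powr (1 - q / 2) * s powr (q / 2))" by simp
      also have "\<dots> = C * s" using s0 by (simp add: C_def algebra_simps flip: powr_add)
      finally show ?thesis .
    qed
    have "l2sq \<Omega> \<phi> / C \<le> D"
      by (rule dense_ge) (use * C in \<open>auto simp: pos_divide_le_eq mult.commute\<close>)
    then show ?thesis using C by (simp add: pos_divide_le_eq mult.commute D_def)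
  qed
  with C that show thesis by blast
qed

lemma L1_le_L2:
  fixes f :: "real ^ 'n \<Rightarrow> 'b::euclidean_space"
  assumes f: "f \<in> L2 \<Omega>"
  shows "(\<integral>\<^sup>+x. ennreal (norm (f x)) \<partial>M) \<le> ennreal (sqrt (measure M \<Omega> * l2sq \<Omega> f))"
proof -
  have n: "(\<lambda>x. norm (f x)) \<in> L2 \<Omega>"
    using L2_D[OF f] by (intro L2_I) (auto simp: power2_norm_eq_inner simp flip: power2_eq_square)
  have o: "(\<lambda>x. 1 :: real) \<in> L2 \<Omega>" by (intro L2_I) auto
  have "(LINT x|M. norm (f x))\<^sup>2 \<le> l2sq \<Omega> f * measure M \<Omega>"
    using l2in_Cauchy_Schwarz[OF n o] by (simp add: l2in_def power2_norm_eq_inner flip: power2_eq_square)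
  then have "LINT x|M. norm (f x) \<le> sqrt (measure M \<Omega> * l2sq \<Omega> f)"
    by (intro real_le_rsqrt) (simp add: mult.commute)
  then show ?thesis
    using L2_integrable[OF f] by (subst nn_integral_eq_integral) (auto intro!: ennreal_leI)
qed

text \<open>On a domain of finite measure the sequence is also Cauchy in \<open>L\<^sup>1\<close>,
  which gives an a.e. limit of a subsequence; Fatou's lemma turns the Cauchy bounds into distances
  to that limit.\<close>

lemma L2_complete:
  fixes f :: "nat \<Rightarrow> real ^ 'n \<Rightarrow> 'b::euclidean_space"
  assumes f: "\<And>n. f n \<in> L2 \<Omega>"
    and C: "\<And>e. e > 0 \<Longrightarrow> \<exists>N. \<forall>m\<ge>N. \<forall>n\<ge>N. l2sq \<Omega> (\<lambda>x. f m x - f n x) \<le> e"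
  obtains g where "g \<in> L2 \<Omega>" "(\<lambda>n. l2sq \<Omega> (\<lambda>x. f n x - g x)) \<longlonglongrightarrow> 0"
proof -
  define m where "m = measure M \<Omega> + 1"
  have m: "m > 0" "measure M \<Omega> \<le> m" by (simp_all add: m_def add_nonneg_pos)
  note meas[measurable] = L2_D(1)[OF f]
  have "\<exists>N. \<forall>i\<ge>N. \<forall>j\<ge>N. (\<integral>\<^sup>+x. ennreal (norm (f i x - f j x)) \<partial>M) \<le> ennreal \<delta>" if \<delta>: "\<delta> > 0" for \<delta>
  proof -
    obtain N where N: "\<And>i j. i \<ge> N \<Longrightarrow> j \<ge> N \<Longrightarrow> l2sq \<Omega> (\<lambda>x. f i x - f j x) \<le> \<delta>\<^sup>2 / m"
      using C[of "\<delta>\<^sup>2 / m"] \<delta> m by auto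
    have "(\<integral>\<^sup>+x. ennreal (norm (f i x - f j x)) \<partial>M) \<le> ennreal \<delta>" if "i \<ge> N" "j \<ge> N" for i j
    proof -
      have "measure M \<Omega> * l2sq \<Omega> (\<lambda>x. f i x - f j x) \<le> m * (\<delta>\<^sup>2 / m)"
        using N[OF that] m by (intro mult_mono) auto
      then have "sqrt (measure M \<Omega> * l2sq \<Omega> (\<lambda>x. f i x - f j x)) \<le> \<delta>"
        using m \<delta> by (intro real_le_lsqrt) auto
      then show ?thesis
        by (intro order_trans[OF L1_le_L2[OF L2_diff[OF f f]]] ennreal_leI)
    qed
    then show ?thesis by blast
  qed
  from L1_Cauchy_AE_convergent_subseq[OF meas this]
  obtain r :: "nat \<Rightarrow> nat" and g where r: "strict_mono r" and g[measurable]: "g \<in> borel_measurable M"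
    and lim: "AE x in M. (\<lambda>n. f (r n) x) \<longlonglongrightarrow> g x" .
  \<comment> \<open>The index \<open>n\<close> is kept fixed and arbitrary while only the other
    index runs along the subsequence; hence the bound holds for the full sequence.\<close>
  have key: "integrable M (\<lambda>x. (f n x - g x) \<bullet> (f n x - g x)) \<and> l2sq \<Omega> (\<lambda>x. f n x - g x) \<le> e"
    if N: "\<And>i j. i \<ge> N \<Longrightarrow> j \<ge> N \<Longrightarrow> l2sq \<Omega> (\<lambda>x. f i x - f j x) \<le> e" and n: "n \<ge> N" for n N e
  proof -
    have rN: "r (k + N) \<ge> N" for k
      using seq_suble[OF r, of "k + N"] by linarith
    have "AE x in M. (\<lambda>k. (f n x - f (r (k + N)) x) \<bullet> (f n x - f (r (k + N)) x)) \<longlonglongrightarrow> (f n x - g x) \<bullet> (f n x - g x)"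
      using lim by eventually_elim (intro tendsto_intros LIMSEQ_ignore_initial_segment)
    moreover have "(LINT x|M. (f n x - f (r (k + N)) x) \<bullet> (f n x - f (r (k + N)) x)) \<le> e" for k
      using N[OF n rN] by (simp add: l2in_def)
    ultimately show ?thesis
      unfolding l2in_def
      using Fatou_real[of M "\<lambda>k x. (f n x - f (r (k + N)) x) \<bullet> (f n x - f (r (k + N)) x)"
          "\<lambda>x. (f n x - g x) \<bullet> (f n x - g x)" "\<lambda>_. e" e] L2_integrable_inner[OF L2_diff[OF f f] L2_diff[OF f f]]
      by auto
  qed
  obtain N1 where N1: "\<And>i j. i \<ge> N1 \<Longrightarrow> j \<ge> N1 \<Longrightarrow> l2sq \<Omega> (\<lambda>x. f i x - f j x) \<le> 1"
    using C[of 1] by auto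
  have "(\<lambda>x. f N1 x - g x) \<in> L2 \<Omega>"
    using key[OF N1, of N1] by (intro L2_I) auto
  \<comment> \<open>\<open>g\<close> is the difference of \<open>f N1\<close> and
    \<open>f N1 - g\<close>, both square integrable.\<close>
  from L2_diff[OF f[of N1] this] have gL: "g \<in> L2 \<Omega>" by simp
  have "(\<lambda>n. l2sq \<Omega> (\<lambda>x. f n x - g x)) \<longlonglongrightarrow> 0"
  proof (rule LIMSEQ_I)
    fix e :: real assume e: "e > 0"
    obtain N where N: "\<And>i j. i \<ge> N \<Longrightarrow> j \<ge> N \<Longrightarrow> l2sq \<Omega> (\<lambda>x. f i x - f j x) \<le> e / 2"
      using C[of "e / 2"] e by auto
    show "\<exists>no. \<forall>n\<ge>no. norm (l2sq \<Omega> (\<lambda>x. f n x - g x) - 0) < e"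
    proof (intro exI allI impI)
      fix n assume "n \<ge> N"
      then show "norm (l2sq \<Omega> (\<lambda>x. f n x - g x) - 0) < e"
        using key[where N = N and e = "e / 2" and n = n, OF N] e by auto
    qed
  qed
  with gL that show thesis by blast
qed

lemma grad_diff:
  assumes "\<phi> \<in> test_functions \<Omega>" "\<psi> \<in> test_functions \<Omega>"
  shows "(\<lambda>x. \<phi> x - \<psi> x) \<in> test_functions \<Omega>" "grad (\<lambda>x. \<phi> x - \<psi> x) = (\<lambda>x. grad \<phi> x - grad \<psi> x)"
  using test_functions_linear[OF assms, of 1 "-1"] grad_linear[OF test_C1c[OF assms(1)] test_C1c[OF assms(2)], of 1 "-1"]
  by auto

text \<open>By the Poincare inequality the functions are Cauchy along with their gradients.\<close>

lemma gradient_Cauchy_H1_limit: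
  assumes \<phi>: "\<And>n. \<phi> n \<in> test_functions \<Omega>"
    and C: "\<And>e. e > 0 \<Longrightarrow> \<exists>N. \<forall>m\<ge>N. \<forall>n\<ge>N. l2sq \<Omega> (\<lambda>x. grad (\<phi> m) x - grad (\<phi> n) x) \<le> e"
  obtains u G where "H1_limit \<phi> u G"
proof -
  obtain P where P: "P > 0" "\<And>\<phi>. \<phi> \<in> test_functions \<Omega> \<Longrightarrow> l2sq \<Omega> \<phi> \<le> P * l2sq \<Omega> (grad \<phi>)"
    using poincare_test by blast
  have "\<exists>N. \<forall>m\<ge>N. \<forall>n\<ge>N. l2sq \<Omega> (\<lambda>x. \<phi> m x - \<phi> n x) \<le> e" if e: "e > 0" for e
  proof -
    obtain N where N: "\<And>m n. m \<ge> N \<Longrightarrow> n \<ge> N \<Longrightarrow> l2sq \<Omega> (\<lambda>x. grad (\<phi> m) x - grad (\<phi> n) x) \<le> e / P"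
      using C[of "e / P"] e P(1) by auto
    have "l2sq \<Omega> (\<lambda>x. \<phi> m x - \<phi> n x) \<le> e" if "m \<ge> N" "n \<ge> N" for m n
    proof -
      have "l2sq \<Omega> (\<lambda>x. \<phi> m x - \<phi> n x) \<le> P * (e / P)"
        using order_trans[OF P(2)[OF grad_diff(1)[OF \<phi> \<phi>], unfolded grad_diff(2)[OF \<phi> \<phi>]]
            mult_left_mono[OF N[OF that] less_imp_le[OF P(1)]]] .
      then show ?thesis using P(1) by simp
    qed
    then show ?thesis by blast
  qed
  from L2_complete[OF test_L2(1)[OF \<phi>] this] obtain u where u: "u \<in> L2 \<Omega>"
    "(\<lambda>n. l2sq \<Omega> (\<lambda>x. \<phi> n x - u x)) \<longlonglongrightarrow> 0" .
  from L2_complete[OF test_L2(2)[OF \<phi>] C] obtain G where G: "G \<in> L2 \<Omega>"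
    "(\<lambda>n. l2sq \<Omega> (\<lambda>x. grad (\<phi> n) x - G x)) \<longlonglongrightarrow> 0" .
  show thesis by (rule that[of u G]) (use u G \<phi> in \<open>auto simp: H1_limit_def\<close>)
qed

text \<open>
  A substitute for the weak compactness of bounded sets: elements of almost minimal Dirichlet integral in the
  convex hulls of the tails form a Cauchy sequence by the parallelogram law, for which midpoints suffice.
\<close>

inductive_set tail_hull :: "(nat \<Rightarrow> real ^ 'n \<Rightarrow> real) \<Rightarrow> nat \<Rightarrow> (real ^ 'n \<Rightarrow> real) set" for \<psi> n where
  base: "k \<ge> n \<Longrightarrow> \<psi> k \<in> tail_hull \<psi> n"
| midpoint: "f \<in> tail_hull \<psi> n \<Longrightarrow> g \<in> tail_hull \<psi> n \<Longrightarrow> (\<lambda>x. 1 / 2 * f x + 1 / 2 * g x) \<in> tail_hull \<psi> n"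

lemma tail_hull_mono:
  assumes "n \<le> m"
  shows "tail_hull \<psi> m \<subseteq> tail_hull \<psi> n"
proof
  fix f assume "f \<in> tail_hull \<psi> m"
  then show "f \<in> tail_hull \<psi> n"
    by induction (use assms tail_hull.intros in \<open>auto simp del: times_divide_eq_left\<close>)
qed

lemma tail_hull_test:
  assumes "\<And>n. \<psi> n \<in> test_functions \<Omega>" "f \<in> tail_hull \<psi> n"
  shows "f \<in> test_functions \<Omega>"
  using assms(2)
proof induction
  case (midpoint f g)
  show ?case using test_functions_linear[OF midpoint.IH, of "1 / 2" "1 / 2"] by simp
qed (rule assms(1))

text \<open>An interval around \<open>l\<close> that contains the tail of the sequence contains all
  midpoints formed from it. The same convexity argument serves for the linear functional in
  \<open>tail_hull_l2in_tendsto\<close>.\<close>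

lemma tail_hull_tendsto:
  assumes "(\<lambda>n. \<psi> n x) \<longlonglongrightarrow> l" "\<And>n. w n \<in> tail_hull \<psi> n"
  shows "(\<lambda>n. w n x) \<longlonglongrightarrow> l"
proof (rule LIMSEQ_I)
  fix e :: real assume e: "e > 0"
  obtain N where N: "\<And>k. k \<ge> N \<Longrightarrow> \<bar>\<psi> k x - l\<bar> < e"
    using LIMSEQ_D[OF assms(1) e] by auto
  have *: "\<bar>f x - l\<bar> < e" if "f \<in> tail_hull \<psi> N" for f
    using that by induction (use N in \<open>auto simp: abs_less_iff field_simps\<close>)
  show "\<exists>no. \<forall>n\<ge>no. norm (w n x - l) < e"
  proof (intro exI allI impI)
    fix n assume "n \<ge> N"
    then show "norm (w n x - l) < e" using * assms(2)[of n] tail_hull_mono[of N n \<psi>] by auto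
  qed
qed

lemma tail_hull_l2in_tendsto:
  assumes \<psi>: "\<And>n. \<psi> n \<in> test_functions \<Omega>" and G: "G \<in> L2 \<Omega>"
    and lim: "(\<lambda>n. l2in \<Omega> (grad (\<psi> n)) G) \<longlonglongrightarrow> l" and w: "\<And>n. w n \<in> tail_hull \<psi> n"
  shows "(\<lambda>n. l2in \<Omega> (grad (w n)) G) \<longlonglongrightarrow> l"
proof (rule LIMSEQ_I)
  fix e :: real assume e: "e > 0"
  obtain N where N: "\<And>k. k \<ge> N \<Longrightarrow> \<bar>l2in \<Omega> (grad (\<psi> k)) G - l\<bar> < e"
    using LIMSEQ_D[OF lim e] by auto
  have *: "\<bar>l2in \<Omega> (grad f) G - l\<bar> < e" if "f \<in> tail_hull \<psi> N" for f
    using that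
  proof induction
    case (midpoint f g)
    note t = tail_hull_test[OF \<psi> midpoint.hyps(1)] tail_hull_test[OF \<psi> midpoint.hyps(2)]
    have "grad (\<lambda>x. 1 / 2 * f x + 1 / 2 * g x) = (\<lambda>x. (1 / 2) *\<^sub>R grad f x + (1 / 2) *\<^sub>R grad g x)"
      by (rule ext) (rule grad_linear[OF test_C1c[OF t(1)] test_C1c[OF t(2)]])
    then have "l2in \<Omega> (grad (\<lambda>x. 1 / 2 * f x + 1 / 2 * g x)) G = 1 / 2 * l2in \<Omega> (grad f) G + 1 / 2 * l2in \<Omega> (grad g) G"
      using l2in_linear[OF test_L2(2)[OF t(1)] test_L2(2)[OF t(2)] G] by simp
    then show ?case using midpoint.IH by (simp add: abs_less_iff field_simps)
  qed (rule N)
  show "\<exists>no. \<forall>n\<ge>no. norm (l2in \<Omega> (grad (w n)) G - l) < e"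
  proof (intro exI allI impI)
    fix n assume "n \<ge> N"
    then show "norm (l2in \<Omega> (grad (w n)) G - l) < e" using * w[of n] tail_hull_mono[of N n \<psi>] by auto
  qed
qed

text \<open>The hulls shrink, so the infima \<open>d n\<close> increase to some \<open>L\<close>.
  The midpoint of two late elements lies in the hull of index \<open>N\<close> and has Dirichlet
  integral at least \<open>d N\<close>, while both elements stay below \<open>L + 1 / Suc N\<close>;
  the parallelogram law leaves at most \<open>4 * (L - d N) + 4 / Suc N\<close> for their
  difference.\<close>

lemma tail_hull_H1_limit:
  assumes \<psi>: "\<And>n. \<psi> n \<in> test_functions \<Omega>" and K: "\<And>n. l2sq \<Omega> (grad (\<psi> n)) \<le> K"
  obtains w u G where "\<And>n. w n \<in> tail_hull \<psi> n" "H1_limit w u G"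
proof -
  define D where "D f = l2sq \<Omega> (grad f)" for f
  define d where "d n = Inf (D ` tail_hull \<psi> n)" for n
  have bdd: "bdd_below (D ` tail_hull \<psi> n)" for n by (rule bdd_belowI[of _ 0]) (auto simp: D_def)
  have ne: "D ` tail_hull \<psi> n \<noteq> {}" for n using tail_hull.base[of n n \<psi>] by auto
  have dle: "d n \<le> D f" if "f \<in> tail_hull \<psi> n" for n f
    unfolding d_def using that by (intro cInf_lower bdd) auto
  have "mono d"
    unfolding d_def by (intro monoI cInf_superset_mono ne bdd image_mono tail_hull_mono)
  moreover have "d n \<le> K" for n
    using dle[OF tail_hull.base[of n n \<psi>]] K[of n] by (simp add: D_def)
  ultimately obtain L where L: "d \<longlonglongrightarrow> L" "\<And>n. d n \<le> L"
    using incseq_convergent[of d K] by auto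
  have "\<exists>w. w \<in> tail_hull \<psi> n \<and> D w < d n + 1 / real (Suc n)" for n
    using cInf_lessD[OF ne, of n "d n + 1 / real (Suc n)"] unfolding d_def by auto
  then obtain w where w: "\<And>n. w n \<in> tail_hull \<psi> n" "\<And>n. D (w n) < d n + 1 / real (Suc n)" by metis
  note wt = tail_hull_test[OF \<psi> w(1)]
  have par: "l2sq \<Omega> (\<lambda>x. grad (w m) x - grad (w n) x) \<le>
      2 * (L - d N) + 4 * (1 / real (Suc N)) + 2 * (L - d N)" if "m \<ge> N" "n \<ge> N" for m n N
  proof -
    have "(\<lambda>x. 1 / 2 * w m x + 1 / 2 * w n x) \<in> tail_hull \<psi> N"
      using w(1)[of m] w(1)[of n] tail_hull_mono[OF that(1), of \<psi>] tail_hull_mono[OF that(2), of \<psi>]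
      by (intro tail_hull.midpoint) auto
    then have "d N \<le> D (\<lambda>x. 1 / 2 * w m x + 1 / 2 * w n x)" by (rule dle)
    also have "\<dots> = 1 / 4 * D (w m) + 1 / 2 * l2in \<Omega> (grad (w m)) (grad (w n)) + 1 / 4 * D (w n)"
    proof -
      have "grad (\<lambda>x. 1 / 2 * w m x + 1 / 2 * w n x) = (\<lambda>x. (1 / 2) *\<^sub>R grad (w m) x + (1 / 2) *\<^sub>R grad (w n) x)"
        by (rule ext) (rule grad_linear[OF test_C1c[OF wt] test_C1c[OF wt]])
      then show ?thesis
        unfolding D_def by (simp only: l2in_square[OF test_L2(2)[OF wt] test_L2(2)[OF wt]]) (simp add: power2_eq_square)
    qed
    finally have 1: "4 * d N \<le> D (w m) + 2 * l2in \<Omega> (grad (w m)) (grad (w n)) + D (w n)" by simp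
    have 2: "l2sq \<Omega> (\<lambda>x. grad (w m) x - grad (w n) x) =
       D (w m) - 2 * l2in \<Omega> (grad (w m)) (grad (w n)) + D (w n)"
      unfolding D_def by (rule l2in_square_diff[OF test_L2(2)[OF wt] test_L2(2)[OF wt]])
    define \<eta> where "\<eta> = 1 / real (Suc N)"
    have 3: "D (w k) \<le> L + \<eta>" if "k \<ge> N" for k
    proof -
      have "1 / real (Suc k) \<le> 1 / real (Suc N)" using that by (simp add: frac_le)
      then show ?thesis using w(2)[of k] L(2)[of k] unfolding \<eta>_def by linarith
    qed
    show ?thesis
      unfolding 2 \<eta>_def[symmetric] using 1 3[OF that(1)] 3[OF that(2)] by argo
  qed
  have "\<exists>N. \<forall>m\<ge>N. \<forall>n\<ge>N. l2sq \<Omega> (\<lambda>x. grad (w m) x - grad (w n) x) \<le> e" if e: "e > 0" for e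
  proof -
    have "(\<lambda>N. 2 * (L - d N) + 4 * (1 / real (Suc N)) + 2 * (L - d N)) \<longlonglongrightarrow> 2 * (L - L) + 4 * 0 + 2 * (L - L)"
      by (intro tendsto_intros L(1) LIMSEQ_Suc[OF lim_1_over_n])
    then have "\<forall>\<^sub>F N in sequentially. 2 * (L - d N) + 4 * (1 / real (Suc N)) + 2 * (L - d N) < e"
      using e by (intro order_tendstoD(2)) auto
    then obtain N where N: "2 * (L - d N) + 4 * (1 / real (Suc N)) + 2 * (L - d N) < e"
      by (auto simp: eventually_sequentially)
    show ?thesis
      by (intro exI[of _ N] allI impI order_trans[OF par less_imp_le[OF N]])
  qed
  from gradient_Cauchy_H1_limit[OF wt this] obtain u G where "H1_limit w u G" .
  with w(1) that show thesis by blast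
qed

lemma H1_limit_AE_unique:
  assumes "H1_limit w u G" "AE x in M. (\<lambda>n. w n x) \<longlonglongrightarrow> g x"
  shows "AE x in M. u x = g x"
proof -
  obtain r :: "nat \<Rightarrow> nat" where r: "strict_mono r" "AE x in M. (\<lambda>n. w (r n) x) \<longlonglongrightarrow> u x"
    using H1_limit_AE_subseq[OF assms(1)] .
  show ?thesis using r(2) assms(2)
  proof eventually_elim
    case (elim x)
    from LIMSEQ_unique[OF elim(1) LIMSEQ_subseq_LIMSEQ[OF elim(2) r(1), unfolded o_def]] show ?case .
  qed
qed

lemma weak_gradient_cong_AE:
  assumes "has_weak_gradient \<Omega> u G" "AE x in M. u x = v x" "u \<in> L2 \<Omega>" "v \<in> L2 \<Omega>"
  shows "has_weak_gradient \<Omega> v G"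
  unfolding has_weak_gradient_def
proof (intro conjI ballI allI)
  show "G \<in> L2 \<Omega>" using assms(1) by (simp add: has_weak_gradient_def)
  fix \<phi> i assume \<phi>: "\<phi> \<in> test_functions \<Omega>"
  have p: "partial_deriv i \<phi> \<in> L2 \<Omega>"
    using component_L2[OF test_L2(2)[OF \<phi>], of i] by (simp add: partial_deriv_grad[abs_def])
  have "(LINT x|M. v x * partial_deriv i \<phi> x) = (LINT x|M. u x * partial_deriv i \<phi> x)"
  proof (rule integral_cong_AE)
    show "AE x in M. v x * partial_deriv i \<phi> x = u x * partial_deriv i \<phi> x"
      using assms(2) by eventually_elim simp
  qed (use L2_D(1)[OF assms(3)] L2_D(1)[OF assms(4)] L2_D(1)[OF p] in auto)
  then show "(LINT x|M. v x * partial_deriv i \<phi> x) = - (LINT x|M. G x $ i * \<phi> x)"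
    using assms(1) \<phi> by (simp add: has_weak_gradient_def)
qed

text \<open>The finite volume and the Poincare inequality turn the Dirichlet bound into bounds in
  \<open>L\<^sup>1\<close> for functions and gradients, to which the compactness argument with ball
  averages applies.\<close>

lemma test_AE_convergent_subseq:
  assumes \<phi>: "\<And>n. \<phi> n \<in> test_functions \<Omega>" and K: "\<And>n. l2sq \<Omega> (grad (\<phi> n)) \<le> K"
  obtains r :: "nat \<Rightarrow> nat" and g where "strict_mono r" "AE x in M. (\<lambda>n. \<phi> (r n) x) \<longlonglongrightarrow> g x"
proof -
  obtain P where P: "P > 0" "\<And>\<phi>. \<phi> \<in> test_functions \<Omega> \<Longrightarrow> l2sq \<Omega> \<phi> \<le> P * l2sq \<Omega> (grad \<phi>)"
    using poincare_test by blast
  define m where "m = measure M \<Omega>"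
  have m: "m \<ge> 0" by (simp add: m_def)
  define K1 where "K1 = sqrt (m * (P * K)) + sqrt (m * K) + 1"
  have K0: "K \<ge> 0" using order_trans[OF l2in_nonneg K] .
  have K1: "K1 > 0" "sqrt (m * (P * K)) \<le> K1" "sqrt (m * K) \<le> K1"
    using K0 m P(1) by (auto simp: K1_def add_nonneg_pos add_increasing2)
  have nn: "(\<integral>\<^sup>+x. ennreal (norm (f x)) \<partial>lborel) = (\<integral>\<^sup>+x. ennreal (norm (f x)) \<partial>M)"
    if "continuous_on UNIV f" "\<And>x. x \<notin> \<Omega> \<Longrightarrow> f x = 0" for f :: "real ^ 'n \<Rightarrow> 'b::euclidean_space"
    using borel_measurable_continuous_onI[OF that(1)] that(2)
    by (intro nn_integral_lebesgue_on[symmetric] dom_sets) auto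
  have c: "continuous_on UNIV (\<phi> n)" "continuous_on UNIV (grad (\<phi> n))" for n
    by (intro C1cD test_C1c \<phi>)+
  have b1: "(\<integral>\<^sup>+x. ennreal \<bar>\<phi> n x\<bar> \<partial>lborel) \<le> ennreal K1" for n
  proof -
    have "(\<integral>\<^sup>+x. ennreal \<bar>\<phi> n x\<bar> \<partial>lborel) = (\<integral>\<^sup>+x. ennreal (norm (\<phi> n x)) \<partial>M)"
      using nn[OF c(1) test_functionsD(2)[OF \<phi>]] by simp
    also have "\<dots> \<le> ennreal (sqrt (m * l2sq \<Omega> (\<phi> n)))"
      unfolding m_def by (rule L1_le_L2[OF test_L2(1)[OF \<phi>]])
    also have "\<dots> \<le> ennreal K1"
    proof (intro ennreal_leI order_trans[OF _ K1(2)] real_sqrt_le_mono mult_left_mono m)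
      show "l2sq \<Omega> (\<phi> n) \<le> P * K"
        using order_trans[OF P(2)[OF \<phi>] mult_left_mono[OF K]] P(1) by simp
    qed
    finally show ?thesis .
  qed
  have b2: "(\<integral>\<^sup>+x. ennreal (norm (grad (\<phi> n) x)) \<partial>lborel) \<le> ennreal K1" for n
  proof -
    have "(\<integral>\<^sup>+x. ennreal (norm (grad (\<phi> n) x)) \<partial>lborel) = (\<integral>\<^sup>+x. ennreal (norm (grad (\<phi> n) x)) \<partial>M)"
      using nn[OF c(2) test_functionsD(3)[OF \<phi>]] by simp
    also have "\<dots> \<le> ennreal (sqrt (m * l2sq \<Omega> (grad (\<phi> n))))"
      unfolding m_def by (rule L1_le_L2[OF test_L2(2)[OF \<phi>]])
    also have "\<dots> \<le> ennreal K1"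
      by (intro ennreal_leI order_trans[OF _ K1(3)] real_sqrt_le_mono mult_left_mono m K)
    finally show ?thesis .
  qed
  obtain r0 :: "nat \<Rightarrow> nat" where r0: "strict_mono r0"
    and C: "\<And>\<delta>. \<delta> > 0 \<Longrightarrow> \<exists>N. \<forall>i\<ge>N. \<forall>j\<ge>N. (\<integral>\<^sup>+x. ennreal \<bar>\<phi> (r0 i) x - \<phi> (r0 j) x\<bar> \<partial>lborel) \<le> ennreal \<delta>"
    using C1c_L1_Cauchy_subseq[of \<Omega> \<phi>, OF bounded_dom open_dom test_C1c[OF \<phi>] test_functionsD(2)[OF \<phi>] b1 b2 K1(1)] by blast
  have eq: "(\<integral>\<^sup>+x. ennreal \<bar>\<phi> (r0 i) x - \<phi> (r0 j) x\<bar> \<partial>lborel) = (\<integral>\<^sup>+x. ennreal (norm (\<phi> (r0 i) x - \<phi> (r0 j) x)) \<partial>M)" for i j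
    unfolding real_norm_def[symmetric]
    by (rule nn) (auto intro!: continuous_intros c simp: test_functionsD(2)[OF \<phi>])
  obtain r1 :: "nat \<Rightarrow> nat" and g where r1: "strict_mono r1"
    and g: "AE x in M. (\<lambda>n. \<phi> (r0 (r1 n)) x) \<longlonglongrightarrow> g x"
    using L1_Cauchy_AE_convergent_subseq[of "\<lambda>n. \<phi> (r0 n)" M, OF L2_D(1)[OF test_L2(1)[OF \<phi>]] C[unfolded eq]] by blast
  show thesis
    by (rule that[of "r0 \<circ> r1" g]) (use g in \<open>auto intro: strict_mono_o r0 r1\<close>)
qed

text \<open>Weak convergence is recorded only against the limit gradient itself, which is all that
  the expansion of the Dirichlet integral of \<open>\<phi> - u\<close> uses. Hull sequences converge
  in norm and share the a.e. limit of the sequence, so this limit lies in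
  \<open>H10\<close>.\<close>

lemma test_weakly_convergent_subseq:
  assumes \<phi>: "\<And>n. \<phi> n \<in> test_functions \<Omega>" and K: "\<And>n. l2sq \<Omega> (grad (\<phi> n)) \<le> K"
  obtains r :: "nat \<Rightarrow> nat" and u G where "strict_mono r" "u \<in> H10 \<Omega>" "has_weak_gradient \<Omega> u G"
    "AE x in M. (\<lambda>n. \<phi> (r n) x) \<longlonglongrightarrow> u x" "(\<lambda>n. l2in \<Omega> (grad (\<phi> (r n))) G) \<longlonglongrightarrow> l2sq \<Omega> G"
proof -
  obtain r1 :: "nat \<Rightarrow> nat" and g where r1: "strict_mono r1" and g: "AE x in M. (\<lambda>n. \<phi> (r1 n) x) \<longlonglongrightarrow> g x"
    using test_AE_convergent_subseq[OF \<phi> K] .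
  define \<phi>1 where "\<phi>1 n = \<phi> (r1 n)" for n
  have \<phi>1: "\<And>n. \<phi>1 n \<in> test_functions \<Omega>" "\<And>n. l2sq \<Omega> (grad (\<phi>1 n)) \<le> K"
    "AE x in M. (\<lambda>n. \<phi>1 n x) \<longlonglongrightarrow> g x"
    using \<phi> K g by (auto simp: \<phi>1_def)
  obtain w u G where w: "\<And>n. w n \<in> tail_hull \<phi>1 n" and lim: "H1_limit w u G"
    using tail_hull_H1_limit[of \<phi>1 K, OF \<phi>1(1,2)] by blast
  have "AE x in M. (\<lambda>n. w n x) \<longlonglongrightarrow> g x"
    using \<phi>1(3) by eventually_elim (rule tail_hull_tendsto[OF _ w])
  then have ug: "AE x in M. u x = g x" by (rule H1_limit_AE_unique[OF lim])
  note H = H1_limitD[OF lim]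
  have "bounded (range (\<lambda>n. l2in \<Omega> (grad (\<phi>1 n)) G))"
  proof -
    have "\<bar>l2in \<Omega> (grad (\<phi>1 n)) G\<bar> \<le> sqrt (K * l2sq \<Omega> G)" for n
    proof (rule real_le_rsqrt)
      have "(l2in \<Omega> (grad (\<phi>1 n)) G)\<^sup>2 \<le> l2sq \<Omega> (grad (\<phi>1 n)) * l2sq \<Omega> G"
        by (intro l2in_Cauchy_Schwarz test_L2 \<phi>1 H)
      also have "\<dots> \<le> K * l2sq \<Omega> G" by (intro mult_right_mono \<phi>1) simp
      finally show "\<bar>l2in \<Omega> (grad (\<phi>1 n)) G\<bar>\<^sup>2 \<le> K * l2sq \<Omega> G" by simp
    qed
    then show ?thesis by (auto simp: bounded_iff)
  qed
  then obtain c r2 where r2: "strict_mono (r2 :: nat \<Rightarrow> nat)" and c: "(\<lambda>n. l2in \<Omega> (grad (\<phi>1 (r2 n))) G) \<longlonglongrightarrow> c"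
    using bounded_imp_convergent_subsequence[of "\<lambda>n. l2in \<Omega> (grad (\<phi>1 n)) G"] by (auto simp: o_def)
  define \<phi>2 where "\<phi>2 n = \<phi>1 (r2 n)" for n
  have ae2: "AE x in M. (\<lambda>n. \<phi>2 n x) \<longlonglongrightarrow> g x"
    using \<phi>1(3) unfolding \<phi>2_def by eventually_elim (rule LIMSEQ_subseq_LIMSEQ[OF _ r2, unfolded o_def])
  have \<phi>2: "\<And>n. \<phi>2 n \<in> test_functions \<Omega>" "\<And>n. l2sq \<Omega> (grad (\<phi>2 n)) \<le> K"
    using \<phi>1 by (auto simp: \<phi>2_def)
  \<comment> \<open>The limit \<open>c\<close> is identified along a second hull sequence, taken from the subsequence on which it exists.\<close>
  obtain w2 u2 G2 where w2: "\<And>n. w2 n \<in> tail_hull \<phi>2 n" and lim2: "H1_limit w2 u2 G2"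
    using tail_hull_H1_limit[of \<phi>2 K, OF \<phi>2] by blast
  note H2 = H1_limitD[OF lim2]
  have "AE x in M. (\<lambda>n. w2 n x) \<longlonglongrightarrow> g x"
    using ae2 by eventually_elim (rule tail_hull_tendsto[OF _ w2])
  then have "AE x in M. u2 x = g x" by (rule H1_limit_AE_unique[OF lim2])
  then have "AE x in M. u2 x = u x" using ug by eventually_elim simp
  then have "has_weak_gradient \<Omega> u G2"
    by (rule weak_gradient_cong_AE[OF H1_limit_weak_gradient[OF lim2] _ H2(1) H(1)])
  then have "AE x in M. G2 x = G x"
    by (rule weak_gradient_unique[OF _ H1_limit_weak_gradient[OF lim]])
  then have G2: "l2in \<Omega> G2 G = l2sq \<Omega> G"
    by (rule l2in_cong_AE) (use H H2 in auto)
  have "(\<lambda>n. l2in \<Omega> (grad (w2 n)) G) \<longlonglongrightarrow> l2in \<Omega> G2 G"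
    by (intro l2in_tendsto test_L2 H2 H)
  moreover have "(\<lambda>n. l2in \<Omega> (grad (w2 n)) G) \<longlonglongrightarrow> c"
    by (rule tail_hull_l2in_tendsto[OF \<phi>2(1) H(2) _ w2]) (use c in \<open>simp add: \<phi>2_def\<close>)
  ultimately have "c = l2sq \<Omega> G" unfolding G2 by (rule LIMSEQ_unique[rotated])
  then have c': "(\<lambda>n. l2in \<Omega> (grad (\<phi>2 n)) G) \<longlonglongrightarrow> l2sq \<Omega> G" using c by (simp add: \<phi>2_def)
  have ae3: "AE x in M. (\<lambda>n. \<phi>2 n x) \<longlonglongrightarrow> u x" using ae2 ug by eventually_elim simp
  show thesis
    by (rule that[of "r1 \<circ> r2" u G])
       (use r1 r2 ae3 c' H1_limit_H10[OF lim] H1_limit_weak_gradient[OF lim] in \<open>auto intro: strict_mono_o simp: \<phi>2_def \<phi>1_def\<close>)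
qed

end

section \<open>The nonlinearity\<close>

lemma floor_approx_tendsto:
  fixes y :: real
  shows "(\<lambda>k. real_of_int \<lfloor>real (Suc k) * y\<rfloor> / real (Suc k)) \<longlonglongrightarrow> y"
proof (rule LIM_zero_cancel, rule Lim_null_comparison)
  show "\<forall>\<^sub>F k in sequentially. norm (real_of_int \<lfloor>real (Suc k) * y\<rfloor> / real (Suc k) - y) \<le> 1 / real (Suc k)"
  proof (intro always_eventually allI)
    fix k
    have "real_of_int \<lfloor>real (Suc k) * y\<rfloor> / real (Suc k) - y = (real_of_int \<lfloor>real (Suc k) * y\<rfloor> - real (Suc k) * y) / real (Suc k)"
      by (simp add: diff_divide_distrib del: of_nat_Suc)
    moreover have "\<bar>real_of_int \<lfloor>real (Suc k) * y\<rfloor> - real (Suc k) * y\<bar> \<le> 1" by linarith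
    ultimately show "norm (real_of_int \<lfloor>real (Suc k) * y\<rfloor> / real (Suc k) - y) \<le> 1 / real (Suc k)"
      by (simp add: abs_divide divide_right_mono del: of_nat_Suc)
  qed
  show "(\<lambda>k. 1 / real (Suc k)) \<longlonglongrightarrow> 0" using LIMSEQ_Suc[OF lim_1_over_n] .
qed

text \<open>The function \<open>w\<close> is approximated by functions with countably many values,
  for which the composition is glued from measurable pieces; continuity in the second argument gives
  the limit. The map \<open>\<pi>\<close> admits product spaces, where the integrand of
  \<open>G\<close> lives.\<close>

lemma caratheodory_compose_measurable:
  fixes g :: "'a \<Rightarrow> real \<Rightarrow> real"
  assumes g: "\<And>t. (\<lambda>x. g x t) \<in> borel_measurable M" "\<And>x. continuous_on UNIV (g x)"
    and \<pi>: "\<pi> \<in> N \<rightarrow>\<^sub>M M" and w[measurable]: "w \<in> borel_measurable N"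
  shows "(\<lambda>z. g (\<pi> z) (w z)) \<in> borel_measurable N"
proof (rule borel_measurable_LIMSEQ_real)
  fix k
  show "(\<lambda>z. g (\<pi> z) (real_of_int \<lfloor>real (Suc k) * w z\<rfloor> / real (Suc k))) \<in> borel_measurable N"
    by (rule measurable_compose_countable[where f = "\<lambda>i z. g (\<pi> z) (real_of_int i / real (Suc k))"])
       (use measurable_compose[OF \<pi> g(1)] in measurable)
next
  fix z
  have "isCont (g (\<pi> z)) (w z)" using g(2) by (simp add: continuous_on_eq_continuous_at)
  then show "(\<lambda>k. g (\<pi> z) (real_of_int \<lfloor>real (Suc k) * w z\<rfloor> / real (Suc k))) \<longlonglongrightarrow> g (\<pi> z) (w z)"
    by (rule isCont_tendsto_compose[OF _ floor_approx_tendsto])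
qed

text \<open>\<open>T\<close> is the point where the two powers balance: beyond it the higher power
  dominates, below it the lower one is bounded.\<close>

lemma abs_powr_absorb:
  fixes A r q \<epsilon> :: real
  assumes "0 < r" "r < q" "0 \<le> A" "0 < \<epsilon>"
  obtains C where "C \<ge> 0" "\<And>t :: real. A * \<bar>t\<bar> powr r \<le> \<epsilon> * \<bar>t\<bar> powr q + C"
proof -
  define T where "T = (A / \<epsilon>) powr (1 / (q - r))"
  have T: "T \<ge> 0" "T powr (q - r) = A / \<epsilon>"
    using assms by (auto simp: T_def powr_powr)
  have "A * \<bar>t\<bar> powr r \<le> \<epsilon> * \<bar>t\<bar> powr q + A * T powr r" for t :: real
  proof (cases "\<bar>t\<bar> \<le> T")
    case True
    then have "A * \<bar>t\<bar> powr r \<le> A * T powr r"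
      using assms by (intro mult_left_mono powr_mono2) auto
    moreover have "0 \<le> \<epsilon> * \<bar>t\<bar> powr q" using assms by simp
    ultimately show ?thesis by linarith
  next
    case False
    then have "A / \<epsilon> \<le> \<bar>t\<bar> powr (q - r)"
      unfolding T(2)[symmetric] using T(1) assms by (intro powr_mono2) auto
    then have "A \<le> \<epsilon> * \<bar>t\<bar> powr (q - r)" using assms by (simp add: pos_divide_le_eq mult.commute)
    then have "A * \<bar>t\<bar> powr r \<le> \<epsilon> * \<bar>t\<bar> powr (q - r) * \<bar>t\<bar> powr r" by (rule mult_right_mono) simp
    also have "\<dots> = \<epsilon> * \<bar>t\<bar> powr q" by (simp add: mult.assoc flip: powr_add)
    finally have "A * \<bar>t\<bar> powr r \<le> \<epsilon> * \<bar>t\<bar> powr q" .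
    moreover have "0 \<le> A * T powr r" using assms by simp
    ultimately show ?thesis by linarith
  qed
  then show thesis by (rule that[rotated]) (use assms in auto)
qed

lemma abs_powr_le_one_add:
  fixes t r R :: real
  assumes "0 \<le> r" "r \<le> R"
  shows "\<bar>t\<bar> powr r \<le> 1 + \<bar>t\<bar> powr R"
proof (cases "\<bar>t\<bar> \<le> 1")
  case True
  then have "\<bar>t\<bar> powr r \<le> 1 powr r" using assms by (intro powr_mono2) auto
  then have "\<bar>t\<bar> powr r \<le> 1" by simp
  moreover have "0 \<le> \<bar>t\<bar> powr R" by simp
  ultimately show ?thesis by linarith
next
  case False
  then have "\<bar>t\<bar> powr r \<le> \<bar>t\<bar> powr R" using assms by (intro powr_mono) auto
  then show ?thesis by simp
qed

text \<open>Either \<open>b\<close> is small relative to \<open>a\<close>, or \<open>a\<close> is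
  controlled by \<open>b\<close>. What matters is a leading constant arbitrarily close to 1: the
  strict inequality on the Kirchhoff coefficient tolerates just that.\<close>

lemma abs_powr_add_le:
  fixes q \<epsilon> :: real
  assumes "q > 0" "\<epsilon> > 0"
  obtains C where "C \<ge> 0" "\<And>a b :: real. \<bar>a + b\<bar> powr q \<le> (1 + \<epsilon>) * \<bar>a\<bar> powr q + C * \<bar>b\<bar> powr q"
proof -
  \<comment> \<open>The ratio at which the cases split, chosen so that
    \<open>(1 + \<eta>) powr q = 1 + \<epsilon>\<close>.\<close>
  define \<eta> where "\<eta> = (1 + \<epsilon>) powr (1 / q) - 1"
  have "1 powr (1 / q) < (1 + \<epsilon>) powr (1 / q)" using assms by (intro powr_less_mono2) auto
  then have \<eta>: "\<eta> > 0" by (simp add: \<eta>_def)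
  have \<eta>q: "(1 + \<eta>) powr q = 1 + \<epsilon>" using assms by (simp add: \<eta>_def powr_powr)
  have "\<bar>a + b\<bar> powr q \<le> (1 + \<epsilon>) * \<bar>a\<bar> powr q + (1 + 1 / \<eta>) powr q * \<bar>b\<bar> powr q" for a b :: real
  proof (cases "\<bar>b\<bar> \<le> \<eta> * \<bar>a\<bar>")
    case True
    then have "\<bar>a + b\<bar> \<le> (1 + \<eta>) * \<bar>a\<bar>" by (simp add: distrib_right)
    then have "\<bar>a + b\<bar> powr q \<le> ((1 + \<eta>) * \<bar>a\<bar>) powr q" using assms by (intro powr_mono2) auto
    also have "\<dots> = (1 + \<epsilon>) * \<bar>a\<bar> powr q" using \<eta> by (simp add: powr_mult \<eta>q)
    finally show ?thesis by (rule order_trans) simp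
  next
    case False
    then have "\<bar>a\<bar> \<le> \<bar>b\<bar> / \<eta>" using \<eta> by (simp add: pos_le_divide_eq mult.commute)
    then have "\<bar>a + b\<bar> \<le> (1 + 1 / \<eta>) * \<bar>b\<bar>" by (simp add: distrib_right)
    then have "\<bar>a + b\<bar> powr q \<le> ((1 + 1 / \<eta>) * \<bar>b\<bar>) powr q" using assms by (intro powr_mono2) auto
    also have "\<dots> = (1 + 1 / \<eta>) powr q * \<bar>b\<bar> powr q" using \<eta> by (simp add: powr_mult)
    finally show ?thesis using assms by (simp add: add_increasing)
  qed
  then show thesis by (rule that[rotated]) simp
qed

text \<open>The conditions on \<open>g\<close> hold at every point; the theorem is reduced to this
  case by a change on a null set. The constant \<open>lam / 4\<close> leaves half of the quadratic
  term \<open>lam / 2 * t\<^sup>2\<close> of \<open>H\<close> near 0.\<close>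

locale kirchhoff_problem = sobolev_domain \<Omega> q
  for \<Omega> :: "(real ^ 'n) set" and q :: real +
  fixes g :: "real ^ 'n \<Rightarrow> real \<Rightarrow> real" and lam p c8 c9 :: real
  assumes g_measurable: "\<And>t. (\<lambda>x. g x t) \<in> borel_measurable (lebesgue_on \<Omega>)"
    and g_continuous: "\<And>x. continuous_on UNIV (g x)"
    and c8: "c8 > 0" and c9: "c9 > 0" and p: "2 < p" "p < q"
    and g_growth: "\<And>x t. \<bar>g x t\<bar> \<le> c8 * \<bar>t\<bar> powr (p - 1) + c9"
    and lam: "lam > 0"
    and g_small: "\<exists>\<delta>>0. \<forall>x t. \<bar>t\<bar> < \<delta> \<longrightarrow> \<bar>g x t\<bar> \<le> lam / 4 * \<bar>t\<bar>"
begin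

text \<open>
  The primitive of \<open>g x\<close> vanishing at 0, in a form in which the measurability of \<open>x \<mapsto> G x (u x)\<close> follows from
  that of parameter integrals.
\<close>

definition G :: "real ^ 'n \<Rightarrow> real \<Rightarrow> real" where
  "G x t = (LINT \<theta>|lborel. indicator {0..1} \<theta> *\<^sub>R (t * g x (\<theta> * t)))"

lemma G_antiderivative:
  shows "(G x has_real_derivative g x t) (at t)" "G x 0 = 0"
proof -
  show "G x 0 = 0" by (simp add: G_def)
  \<comment> \<open>An abstract primitive \<open>A\<close>, with which the integral defining
    \<open>G\<close> is evaluated; it then follows that \<open>G x\<close> differs from
    \<open>A\<close> by a constant.\<close>
  have "\<exists>F. \<forall>y :: real. - \<infinity> < ereal y \<longrightarrow> ereal y < \<infinity> \<longrightarrow> (F has_vector_derivative g x y) (at y)"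
    by (rule einterval_antiderivative) (use g_continuous in \<open>auto simp: continuous_on_eq_continuous_at\<close>)
  then obtain A where A: "\<And>y. (A has_real_derivative g x y) (at y)"
    by (auto simp: has_real_derivative_iff_has_vector_derivative)
  have "G x s = A s - A 0" for s
  proof -
    have "(LINT \<theta>|lborel. indicator {0..1} \<theta> *\<^sub>R (s * g x (\<theta> * s))) = A (1 * s) - A (0 * s)"
    proof (rule integral_FTC_atLeastAtMost)
      fix \<theta> :: real
      have "((\<lambda>\<theta>. A (\<theta> * s)) has_real_derivative (s * g x (\<theta> * s))) (at \<theta>)"
        by (rule DERIV_cong[OF DERIV_chain2[OF A]]) (auto intro!: derivative_eq_intros simp: mult.commute)
      then show "((\<lambda>\<theta>. A (\<theta> * s)) has_vector_derivative (s * g x (\<theta> * s))) (at \<theta> within {0..1})"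
        by (simp add: has_field_derivative_at_within flip: has_real_derivative_iff_has_vector_derivative)
    next
      show "continuous_on {0..1} (\<lambda>\<theta>. s * g x (\<theta> * s))"
        by (intro continuous_intros continuous_on_compose2[OF g_continuous]) auto
    qed simp
    then show ?thesis by (simp add: G_def)
  qed
  then have "G x = (\<lambda>s. A s - A 0)" by auto
  then show "(G x has_real_derivative g x t) (at t)"
    by (auto intro!: derivative_eq_intros A)
qed

lemma g_compose_measurable:
  assumes "u \<in> borel_measurable M"
  shows "(\<lambda>x. g x (u x)) \<in> borel_measurable M"
  by (rule caratheodory_compose_measurable[OF g_measurable g_continuous measurable_ident assms, simplified])

lemma G_compose_measurable:
  assumes [measurable]: "u \<in> borel_measurable M"
  shows "(\<lambda>x. G x (u x)) \<in> borel_measurable M"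
proof -
  have "(\<lambda>z. g (fst z) (snd z * u (fst z))) \<in> borel_measurable (M \<Otimes>\<^sub>M lborel)"
    by (rule caratheodory_compose_measurable[OF g_measurable g_continuous measurable_fst]) measurable
  then have "(\<lambda>z. indicator {0..1} (snd z) *\<^sub>R (u (fst z) * g (fst z) (snd z * u (fst z)))) \<in> borel_measurable (M \<Otimes>\<^sub>M lborel)"
    by measurable
  then show ?thesis
    unfolding G_def by (intro lborel.borel_measurable_lebesgue_integral) (simp add: case_prod_beta)
qed

lemma G_bound:
  assumes "\<And>s. \<bar>s\<bar> \<le> \<bar>t\<bar> \<Longrightarrow> \<bar>g x s\<bar> \<le> B"
  shows "\<bar>G x t\<bar> \<le> B * \<bar>t\<bar>"
proof -
  have "norm (G x t - G x 0) \<le> B * norm (t - 0)"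
  proof (rule field_differentiable_bound)
    show "convex {- \<bar>t\<bar>..\<bar>t\<bar>}" by (rule convex_real_interval)
    show "(G x has_real_derivative g x s) (at s within {- \<bar>t\<bar>..\<bar>t\<bar>})" for s
      by (rule has_field_derivative_at_within[OF G_antiderivative(1)])
    show "norm (g x s) \<le> B" if "s \<in> {- \<bar>t\<bar>..\<bar>t\<bar>}" for s
      using that assms[of s] by auto
  qed auto
  then show ?thesis by (simp add: G_antiderivative(2))
qed

definition H :: "real ^ 'n \<Rightarrow> real \<Rightarrow> real" where
  "H x t = lam / 2 * t\<^sup>2 + G x t + \<bar>t\<bar> powr q / q"

definition f :: "real ^ 'n \<Rightarrow> real \<Rightarrow> real" where
  "f x t = lam * t + g x t + \<bar>t\<bar> powr (q - 2) * t"

lemma H_0 [simp]: "H x 0 = 0"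
  by (simp add: H_def G_antiderivative)

lemma H_deriv: "(H x has_real_derivative f x t) (at t)"
proof -
  have "((\<lambda>t. \<bar>t\<bar> powr q / q) has_real_derivative (\<bar>t\<bar> powr (q - 2) * t)) (at t)"
    using DERIV_cdivide[OF has_real_derivative_abs_powr[of q t], of q] q_gt_2 by simp
  moreover have "((\<lambda>t. lam / 2 * t\<^sup>2) has_real_derivative (lam * t)) (at t)"
    by (auto intro!: derivative_eq_intros)
  ultimately show ?thesis
    unfolding H_def[abs_def] f_def by (intro DERIV_add G_antiderivative)
qed

lemma H_tendsto: "(s \<longlonglongrightarrow> t) \<Longrightarrow> (\<lambda>n. H x (s n)) \<longlonglongrightarrow> H x t"
  by (rule isCont_tendsto_compose[OF DERIV_isCont[OF H_deriv]])

lemma H_compose_measurable: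
  assumes [measurable]: "u \<in> borel_measurable M"
  shows "(\<lambda>x. H x (u x)) \<in> borel_measurable M"
  using G_compose_measurable[OF assms] unfolding H_def by measurable

lemma f_compose_measurable:
  assumes [measurable]: "u \<in> borel_measurable M"
  shows "(\<lambda>x. f x (u x)) \<in> borel_measurable M"
  using g_compose_measurable[OF assms] unfolding f_def by measurable

lemma G_growth: "\<bar>G x t\<bar> \<le> c8 * \<bar>t\<bar> powr p + c9 * \<bar>t\<bar>"
proof -
  have "\<bar>G x t\<bar> \<le> (c8 * \<bar>t\<bar> powr (p - 1) + c9) * \<bar>t\<bar>"
  proof (rule G_bound)
    fix s assume "\<bar>s\<bar> \<le> \<bar>t\<bar>"
    then have "c8 * \<bar>s\<bar> powr (p - 1) \<le> c8 * \<bar>t\<bar> powr (p - 1)"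
      using c8 p by (intro mult_left_mono powr_mono2) auto
    then show "\<bar>g x s\<bar> \<le> c8 * \<bar>t\<bar> powr (p - 1) + c9" using g_growth[of x s] by linarith
  qed
  then show ?thesis by (simp add: distrib_right mult.assoc abs_powr_mult_abs)
qed

text \<open>The exponents 2, \<open>p\<close> and 1 all lie below \<open>q\<close>; each of the
  three terms receives a third of \<open>\<epsilon>\<close>.\<close>

lemma lower_order_bound:
  assumes "\<epsilon> > 0"
  obtains C where "C \<ge> 0" "\<And>x t. lam / 2 * t\<^sup>2 + \<bar>G x t\<bar> \<le> \<epsilon> * \<bar>t\<bar> powr q + C"
proof -
  have e: "\<epsilon> / 3 > 0" using assms by simp
  obtain C1 where C1: "C1 \<ge> 0" "\<And>t :: real. lam / 2 * \<bar>t\<bar> powr 2 \<le> \<epsilon> / 3 * \<bar>t\<bar> powr q + C1"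
    by (rule abs_powr_absorb[of 2 q "lam / 2" "\<epsilon> / 3"]) (use q_gt_2 lam e in auto)
  obtain C2 where C2: "C2 \<ge> 0" "\<And>t :: real. c8 * \<bar>t\<bar> powr p \<le> \<epsilon> / 3 * \<bar>t\<bar> powr q + C2"
    by (rule abs_powr_absorb[of p q c8 "\<epsilon> / 3"]) (use p c8 e in auto)
  obtain C3 where C3: "C3 \<ge> 0" "\<And>t :: real. c9 * \<bar>t\<bar> powr 1 \<le> \<epsilon> / 3 * \<bar>t\<bar> powr q + C3"
    by (rule abs_powr_absorb[of 1 q c9 "\<epsilon> / 3"]) (use q_gt_2 c9 e in auto)
  show thesis
  proof (rule that[of "C1 + C2 + C3"])
    fix x t
    have "lam / 2 * t\<^sup>2 \<le> \<epsilon> / 3 * \<bar>t\<bar> powr q + C1"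
      using C1(2)[of t] by (cases "t = 0") (auto simp: powr_numeral)
    moreover have "c9 * \<bar>t\<bar> powr 1 = c9 * \<bar>t\<bar>" by simp
    ultimately show "lam / 2 * t\<^sup>2 + \<bar>G x t\<bar> \<le> \<epsilon> * \<bar>t\<bar> powr q + (C1 + C2 + C3)"
      using C2(2)[of t] C3(2)[of t] G_growth[of x t] by linarith
  qed (use C1 C2 C3 in auto)
qed

text \<open>The source of all upper bounds on the potential: \<open>s = 0\<close> gives
  integrability and coercivity, and \<open>s = u x\<close> gives the bound for the reverse Fatou
  argument, where only the critical part of \<open>t - s\<close> carries a sharp constant.\<close>

lemma H_upper:
  assumes "\<epsilon> > 0"
  obtains C2 C3 where "C2 \<ge> 0" "C3 \<ge> 0"
    "\<And>x s t. H x t \<le> (1 + \<epsilon>) / q * \<bar>t - s\<bar> powr q + C3 * \<bar>s\<bar> powr q + C2"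
proof -
  \<comment> \<open>\<open>1 + \<epsilon>\<close> is split into two equal factors, one for absorbing
    the lower-order terms and one for passing from \<open>t\<close> to \<open>t - s\<close>.\<close>
  define \<eta> where "\<eta> = sqrt (1 + \<epsilon>) - 1"
  have \<eta>: "\<eta> > 0" "(1 + \<eta>) * (1 + \<eta>) = 1 + \<epsilon>" using assms by (auto simp: \<eta>_def)
  have q: "q > 0" using q_gt_2 by simp
  obtain C where C: "C \<ge> 0" "\<And>x t. lam / 2 * t\<^sup>2 + \<bar>G x t\<bar> \<le> \<eta> / q * \<bar>t\<bar> powr q + C"
    using lower_order_bound[of "\<eta> / q"] \<eta> q by auto
  obtain C' where C': "C' \<ge> 0" "\<And>a b :: real. \<bar>a + b\<bar> powr q \<le> (1 + \<eta>) * \<bar>a\<bar> powr q + C' * \<bar>b\<bar> powr q"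
    using abs_powr_add_le[OF q \<eta>(1)] by blast
  show thesis
  proof (rule that[of C "(1 + \<eta>) / q * C'"])
    show "(1 + \<eta>) / q * C' \<ge> 0" using \<eta> q C' by simp
    fix x s t
    have "H x t \<le> \<eta> / q * \<bar>t\<bar> powr q + C + \<bar>t\<bar> powr q / q"
      using C(2)[of t x] by (simp add: H_def)
    also have "\<dots> = (1 + \<eta>) / q * \<bar>t\<bar> powr q + C" by (simp add: add_divide_distrib distrib_right)
    also have "(1 + \<eta>) / q * \<bar>t\<bar> powr q \<le> (1 + \<eta>) / q * ((1 + \<eta>) * \<bar>t - s\<bar> powr q + C' * \<bar>s\<bar> powr q)"
      using C'(2)[of "t - s" s] \<eta> q by (intro mult_left_mono) auto
    also have "\<dots> = (1 + \<epsilon>) / q * \<bar>t - s\<bar> powr q + (1 + \<eta>) / q * C' * \<bar>s\<bar> powr q"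
      by (simp add: distrib_left \<eta>(2)[symmetric] mult.assoc)
    finally show "H x t \<le> (1 + \<epsilon>) / q * \<bar>t - s\<bar> powr q + (1 + \<eta>) / q * C' * \<bar>s\<bar> powr q + C" by simp
  qed (rule C)
qed

text \<open>The nonnegative critical term absorbs the possible negativity of \<open>G\<close>. The
  bound permits Fatou's lemma along approximating sequences.\<close>

lemma H_lower:
  obtains C where "C \<ge> 0" "\<And>x t. H x t \<ge> - C"
proof -
  have q: "q > 0" using q_gt_2 by simp
  obtain C where C: "C \<ge> 0" "\<And>x t. lam / 2 * t\<^sup>2 + \<bar>G x t\<bar> \<le> 1 / q * \<bar>t\<bar> powr q + C"
    using lower_order_bound[of "1 / q"] q by auto
  have "H x t \<ge> - C" for x t
  proof -
    have "0 \<le> lam / 2 * t\<^sup>2" using lam by simp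
    then show ?thesis using C(2)[of t x] by (simp add: H_def)
  qed
  with C(1) that show thesis by blast
qed

lemma H_small:
  obtains \<delta> where "\<delta> > 0" "\<And>x t. \<bar>t\<bar> < \<delta> \<Longrightarrow> H x t \<ge> lam / 4 * t\<^sup>2"
proof -
  obtain \<delta> where \<delta>: "\<delta> > 0" "\<And>x t. \<bar>t\<bar> < \<delta> \<Longrightarrow> \<bar>g x t\<bar> \<le> lam / 4 * \<bar>t\<bar>" using g_small by blast
  have "H x t \<ge> lam / 4 * t\<^sup>2" if t: "\<bar>t\<bar> < \<delta>" for x t
  proof -
    have "\<bar>G x t\<bar> \<le> lam / 4 * \<bar>t\<bar> * \<bar>t\<bar>"
    proof (rule G_bound)
      fix s assume s: "\<bar>s\<bar> \<le> \<bar>t\<bar>"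
      then have "\<bar>g x s\<bar> \<le> lam / 4 * \<bar>s\<bar>" using \<delta>(2) t by simp
      also have "\<dots> \<le> lam / 4 * \<bar>t\<bar>" using s lam by (intro mult_left_mono) auto
      finally show "\<bar>g x s\<bar> \<le> lam / 4 * \<bar>t\<bar>" .
    qed
    then have "\<bar>G x t\<bar> \<le> lam / 4 * t\<^sup>2" by (simp add: power2_eq_square)
    moreover have "0 \<le> \<bar>t\<bar> powr q / q" using q_gt_2 by simp
    ultimately show ?thesis unfolding H_def by linarith
  qed
  with \<delta>(1) that show thesis by blast
qed

lemma f_growth:
  obtains C where "C > 0" "\<And>x t. \<bar>f x t\<bar> \<le> C * (1 + \<bar>t\<bar> powr (q - 1))"
proof (rule that[of "lam + c8 + c9 + 1"])
  show "lam + c8 + c9 + 1 > 0" using lam c8 c9 by simp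
  fix x t
  let ?z = "1 + \<bar>t\<bar> powr (q - 1)"
  have z: "1 \<le> ?z" by simp
  have "\<bar>t\<bar> powr 1 \<le> ?z" using q_gt_2 by (intro abs_powr_le_one_add) auto
  then have "lam * \<bar>t\<bar> \<le> lam * ?z" using lam by (intro mult_left_mono) auto
  moreover have "\<bar>t\<bar> powr (p - 1) \<le> ?z" using p by (intro abs_powr_le_one_add) auto
  then have "c8 * \<bar>t\<bar> powr (p - 1) \<le> c8 * ?z" using c8 by (intro mult_left_mono) auto
  moreover have "c9 * 1 \<le> c9 * ?z" using c9 z by (intro mult_left_mono) auto
  moreover have "\<bar>\<bar>t\<bar> powr (q - 2) * t\<bar> = \<bar>t\<bar> powr (q - 1)"
    using abs_powr_mult_abs[of t "q - 1"] by (simp add: abs_mult)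
  moreover have "\<bar>f x t\<bar> \<le> lam * \<bar>t\<bar> + \<bar>g x t\<bar> + \<bar>\<bar>t\<bar> powr (q - 2) * t\<bar>"
    unfolding f_def using lam abs_mult[of lam t] by linarith
  ultimately have "\<bar>f x t\<bar> \<le> lam * ?z + (c8 * ?z + c9 * ?z) + ?z" using g_growth[of x t] by linarith
  then show "\<bar>f x t\<bar> \<le> (lam + c8 + c9 + 1) * ?z" by (simp add: distrib_right distrib_left)
qed

end

section \<open>Minimization of the energy\<close>

text \<open>Write \<open>a powr r\<close> as \<open>a * a powr (r - 1)\<close> and enlarge the
  second factor to \<open>(a + b) powr (r - 1)\<close>; likewise for \<open>b\<close>.\<close>

lemma powr_superadditive:
  fixes a b r :: real
  assumes "a \<ge> 0" "b \<ge> 0" "r \<ge> 1"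
  shows "a powr r + b powr r \<le> (a + b) powr r"
proof -
  have eq: "x * x powr (r - 1) = x powr r" if "x \<ge> 0" for x
    using that abs_powr_mult_abs[of x r] by (simp add: mult.commute)
  have "a powr r \<le> a * (a + b) powr (r - 1)"
    unfolding eq[OF assms(1), symmetric] using assms by (intro mult_left_mono powr_mono2) auto
  moreover have "b powr r \<le> b * (a + b) powr (r - 1)"
    unfolding eq[OF assms(2), symmetric] using assms by (intro mult_left_mono powr_mono2) auto
  ultimately have "a powr r + b powr r \<le> (a + b) * (a + b) powr (r - 1)" by (simp add: distrib_right)
  then show ?thesis using eq[of "a + b"] assms by simp
qed

locale kirchhoff_energy = kirchhoff_problem \<Omega> q g lam p c8 c9
  for \<Omega> :: "(real ^ 'n) set" and q :: real and g :: "real ^ 'n \<Rightarrow> real \<Rightarrow> real" and lam p c8 c9 :: real +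
  fixes b :: real
  assumes b_large: "b > best_sobolev_const \<Omega> powr (- q / 2)"
begin

abbreviation (input) D :: "(real ^ 'n \<Rightarrow> real) \<Rightarrow> real" where "D \<equiv> dirichlet_integral \<Omega>"
abbreviation (input) \<kappa> :: real where "\<kappa> \<equiv> best_sobolev_const \<Omega> powr (- q / 2)"
abbreviation (input) vol :: real where "vol \<equiv> measure M \<Omega>"

definition E :: "(real ^ 'n \<Rightarrow> real) \<Rightarrow> real" where
  "E u = b / q * D u powr (q / 2) - (LINT x|M. H x (u x))"

lemma kappa_pos: "\<kappa> > 0" and b_pos: "b > 0" and q_pos: "q > 0"
proof -
  show k: "\<kappa> > 0" using best_sobolev(1) by simp
  show "b > 0" using k b_large by linarith
  show "q > 0" using q_gt_2 by simp
qed

lemma H10_measurable: "u \<in> H10 \<Omega> \<Longrightarrow> u \<in> borel_measurable M"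
  by (rule L2_D(1)[OF H10_L2])

lemma H_integrable:
  assumes "u \<in> H10 \<Omega>"
  shows "integrable M (\<lambda>x. H x (u x))"
proof -
  obtain C2 C3 where C2: "C2 \<ge> 0" and "C3 \<ge> 0" and H: "\<And>x s t. H x t \<le> (1 + 1) / q * \<bar>t - s\<bar> powr q + C3 * \<bar>s\<bar> powr q + C2"
    by (rule H_upper[OF zero_less_one]) (rule that; simp)
  obtain C where C: "C \<ge> 0" "\<And>x t. H x t \<ge> - C" using H_lower by blast
  show ?thesis
  proof (rule Bochner_Integration.integrable_bound[where f = "\<lambda>x. 2 / q * \<bar>u x\<bar> powr q + (C2 + C)"])
    show "integrable M (\<lambda>x. 2 / q * \<bar>u x\<bar> powr q + (C2 + C))"
      using best_sobolev(2)[OF assms] by simp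
    show "(\<lambda>x. H x (u x)) \<in> borel_measurable M" by (rule H_compose_measurable[OF H10_measurable[OF assms]])
    show "AE x in M. norm (H x (u x)) \<le> norm (2 / q * \<bar>u x\<bar> powr q + (C2 + C))"
    proof (rule AE_I2)
      fix x
      have "H x (u x) \<le> 2 / q * \<bar>u x\<bar> powr q + C2" using H[of x "u x" 0] by simp
      moreover have "- C \<le> H x (u x)" by (rule C)
      moreover have "0 \<le> 2 / q * \<bar>u x\<bar> powr q" using q_pos by simp
      ultimately show "norm (H x (u x)) \<le> norm (2 / q * \<bar>u x\<bar> powr q + (C2 + C))"
        using C(1) C2 by (simp only: real_norm_def)
    qed
  qed
qed

lemma energy_coercive:
  obtains c C where "c > 0" "\<And>u. u \<in> H10 \<Omega> \<Longrightarrow> c * D u powr (q / 2) - C \<le> E u"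
proof -
  \<comment> \<open>Half of the available gap: \<open>(1 + \<epsilon>) * \<kappa>\<close> is the
    midpoint of \<open>\<kappa>\<close> and \<open>b\<close>, so the coefficient
    \<open>(b - \<kappa>) / (2 * q)\<close> survives.\<close>
  define \<epsilon> where "\<epsilon> = (b / \<kappa> - 1) / 2"
  have e: "\<epsilon> > 0" using b_large kappa_pos by (simp add: \<epsilon>_def)
  have ek: "(1 + \<epsilon>) * \<kappa> = (\<kappa> + b) / 2" using kappa_pos by (simp add: \<epsilon>_def field_simps)
  obtain C2 C3 where C2: "C2 \<ge> 0" and "C3 \<ge> 0" and H: "\<And>x s t. H x t \<le> (1 + \<epsilon>) / q * \<bar>t - s\<bar> powr q + C3 * \<bar>s\<bar> powr q + C2"
    by (rule H_upper[OF e]) (rule that; simp)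
  show thesis
  proof (rule that[of "(b - \<kappa>) / (2 * q)" "C2 * vol"])
    show "(b - \<kappa>) / (2 * q) > 0" using b_large q_pos by simp
    fix u assume u: "u \<in> H10 \<Omega>"
    have i: "integrable M (\<lambda>x. (1 + \<epsilon>) / q * \<bar>u x\<bar> powr q + C2)"
      using best_sobolev(2)[OF u] by simp
    have "(LINT x|M. H x (u x)) \<le> (LINT x|M. (1 + \<epsilon>) / q * \<bar>u x\<bar> powr q + C2)"
      using H[of _ _ 0] by (intro integral_mono[OF H_integrable[OF u] i]) simp
    also have "\<dots> = (1 + \<epsilon>) / q * (LINT x|M. \<bar>u x\<bar> powr q) + C2 * vol"
      using best_sobolev(2)[OF u] by simp
    also have "\<dots> \<le> (1 + \<epsilon>) / q * (\<kappa> * D u powr (q / 2)) + C2 * vol"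
      using e q_pos best_sobolev(3)[OF u] by (intro add_right_mono mult_left_mono) auto
    also have "(1 + \<epsilon>) / q * (\<kappa> * D u powr (q / 2)) = ((1 + \<epsilon>) * \<kappa>) / q * D u powr (q / 2)" by simp
    also have "\<dots> = b / q * D u powr (q / 2) - (b - \<kappa>) / (2 * q) * D u powr (q / 2)"
      unfolding ek using q_pos by (simp add: field_simps)
    finally show "(b - \<kappa>) / (2 * q) * D u powr (q / 2) - C2 * vol \<le> E u" by (simp add: E_def)
  qed
qed

lemma H1_limit_dirichlet_tendsto:
  assumes "H1_limit \<phi> u G'"
  shows "(\<lambda>n. D (\<phi> n)) \<longlonglongrightarrow> D u"
proof -
  note h = H1_limitD[OF assms]
  show ?thesis
    unfolding dirichlet_test[OF h(3)] dirichlet_integral_eq[OF H1_limit_weak_gradient[OF assms]]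
    by (intro l2in_self_tendsto test_L2 h)
qed

text \<open>Transfers minimality from test functions to \<open>H10\<close>. Along an approximating
  sequence the Dirichlet integrals converge, and what is needed for the potential is an upper bound
  on its integral at the limit, the direction that Fatou's lemma gives.\<close>

lemma energy_ge_of_test:
  assumes v: "v \<in> H10 \<Omega>" and m: "\<And>\<phi>. \<phi> \<in> test_functions \<Omega> \<Longrightarrow> m \<le> E \<phi>"
  shows "m \<le> E v"
proof -
  obtain C where C: "C \<ge> 0" "\<And>x t. H x t \<ge> - C" using H_lower by blast
  obtain \<phi> where \<phi>: "H1_limit \<phi> v (weak_grad \<Omega> v)" using H10_H1_limit[OF v] .
  obtain r :: "nat \<Rightarrow> nat" where r: "strict_mono r" "AE x in M. (\<lambda>n. \<phi> (r n) x) \<longlonglongrightarrow> v x"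
    using H1_limit_AE_subseq[OF \<phi>] .
  note t = H1_limitD(3)[OF \<phi>]
  note i = H_integrable[OF test_H10[OF t]]
  let ?c = "\<lambda>n. b / q * D (\<phi> (r n)) powr (q / 2) - m + C * vol"
  have lim: "?c \<longlonglongrightarrow> b / q * D v powr (q / 2) - m + C * vol"
    by (intro tendsto_intros LIMSEQ_subseq_LIMSEQ[OF H1_limit_dirichlet_tendsto[OF \<phi>] r(1), unfolded o_def])
       (use q_pos dirichlet_nonneg in auto)
  have le: "(LINT x|M. H x (\<phi> (r n) x) + C) \<le> ?c n" for n
    using i m[OF t, of "r n"] by (simp add: E_def)
  have "AE x in M. (\<lambda>n. H x (\<phi> (r n) x) + C) \<longlonglongrightarrow> H x (v x) + C"
    using r(2) by eventually_elim (intro tendsto_intros H_tendsto)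
  from Fatou_real(2)[OF _ _ _ this le lim] i H_compose_measurable[OF H10_measurable[OF v]] C(2)
  have "(LINT x|M. H x (v x) + C) \<le> b / q * D v powr (q / 2) - m + C * vol"
    by (simp add: minus_le_iff) (smt (verit) AE_I2)
  then show ?thesis using H_integrable[OF v] by (simp add: E_def)
qed

text \<open>Expressed with an arbitrary weak gradient of \<open>u\<close>, so that it fits the limit
  gradient delivered by weak compactness.\<close>

lemma dirichlet_diff:
  assumes "\<phi> \<in> test_functions \<Omega>" "u \<in> H10 \<Omega>" "has_weak_gradient \<Omega> u G'"
  shows "(\<lambda>x. \<phi> x - u x) \<in> H10 \<Omega>" "D (\<lambda>x. \<phi> x - u x) = D \<phi> - 2 * l2in \<Omega> (grad \<phi>) G' + l2sq \<Omega> G'"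
proof -
  note l = H10_linear[OF test_H10[OF assms(1)] assms(2), of 1 "-1"]
  have G: "G' \<in> L2 \<Omega>" using assms(3) by (simp add: has_weak_gradient_def)
  have "l2in \<Omega> (weak_grad \<Omega> \<phi>) (weak_grad \<Omega> u) = l2in \<Omega> (grad \<phi>) G'"
    by (intro l2in_cong_AE weak_gradient_weak_grad[OF test_weak_gradient[OF assms(1)]] weak_gradient_weak_grad[OF assms(3)] test_L2 assms(1) G)
  then show "(\<lambda>x. \<phi> x - u x) \<in> H10 \<Omega>" "D (\<lambda>x. \<phi> x - u x) = D \<phi> - 2 * l2in \<Omega> (grad \<phi>) G' + l2sq \<Omega> G'"
    using l dirichlet_integral_eq[OF assms(3)] by simp_all
qed

lemma minimizer_exists:
  obtains u where "u \<in> H10 \<Omega>" "\<And>\<phi>. \<phi> \<in> test_functions \<Omega> \<Longrightarrow> E u \<le> E \<phi>"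
proof -
  obtain c C where c: "c > 0" and coer: "\<And>u. u \<in> H10 \<Omega> \<Longrightarrow> c * D u powr (q / 2) - C \<le> E u"
    using energy_coercive by blast
  define m where "m = Inf (E ` test_functions \<Omega>)"
  have lb: "- C \<le> E \<phi>" if "\<phi> \<in> test_functions \<Omega>" for \<phi>
  proof -
    have "0 \<le> c * D \<phi> powr (q / 2)" using c by simp
    then show ?thesis using coer[OF test_H10[OF that]] by linarith
  qed
  have bdd: "bdd_below (E ` test_functions \<Omega>)" by (rule bdd_belowI[of _ "- C"]) (use lb in auto)
  have ne: "E ` test_functions \<Omega> \<noteq> {}" using nonzero_test_function by (metis empty_iff image_is_empty)
  have m_le: "m \<le> E \<phi>" if "\<phi> \<in> test_functions \<Omega>" for \<phi>
    unfolding m_def using that by (intro cInf_lower bdd) auto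
  have "\<exists>\<phi>. \<phi> \<in> test_functions \<Omega> \<and> E \<phi> < m + 1 / real (Suc n)" for n
    using cInf_lessD[OF ne, of "m + 1 / real (Suc n)"] unfolding m_def by auto
  then obtain \<phi> where \<phi>: "\<And>n. \<phi> n \<in> test_functions \<Omega>" "\<And>n. E (\<phi> n) < m + 1 / real (Suc n)" by metis
  \<comment> \<open>Coercivity solved for the Dirichlet integral at the level \<open>m + 1\<close>,
    which lies above all energies of the sequence.\<close>
  define K where "K = ((m + 1 + C) / c) powr (2 / q)"
  have K: "D (\<phi> n) \<le> K" for n
  proof -
    have "1 / real (Suc n) \<le> 1" by simp
    then have "c * D (\<phi> n) powr (q / 2) \<le> m + 1 + C"
      using coer[OF test_H10[OF \<phi>(1)[of n]]] \<phi>(2)[of n] by linarith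
    then have "D (\<phi> n) powr (q / 2) \<le> (m + 1 + C) / c" using c by (simp add: pos_le_divide_eq mult.commute)
    then have "(D (\<phi> n) powr (q / 2)) powr (2 / q) \<le> K"
      unfolding K_def using q_pos by (intro powr_mono2) auto
    then show ?thesis using q_pos dirichlet_nonneg[of "\<phi> n"] by (simp add: powr_powr)
  qed
  obtain r :: "nat \<Rightarrow> nat" and u G' where r: "strict_mono r" and u: "u \<in> H10 \<Omega>" "has_weak_gradient \<Omega> u G'"
    and ae: "AE x in M. (\<lambda>n. \<phi> (r n) x) \<longlonglongrightarrow> u x"
    and wk: "(\<lambda>n. l2in \<Omega> (grad (\<phi> (r n))) G') \<longlonglongrightarrow> l2sq \<Omega> G'"
    using test_weakly_convergent_subseq[of \<phi> K, OF \<phi>(1) K[unfolded dirichlet_test[OF \<phi>(1)]]] .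
  \<comment> \<open>Weak convergence does not determine the limit of the Dirichlet integrals; a
    further subsequence provides it as \<open>l\<close>, and \<open>l - D u\<close> is the amount
    lost in the limit.\<close>
  have "bounded (range (\<lambda>n. D (\<phi> (r n))))"
    using K dirichlet_nonneg by (auto simp: bounded_iff intro!: exI[of _ K])
  then obtain s l where s: "strict_mono (s :: nat \<Rightarrow> nat)" and l: "(\<lambda>n. D (\<phi> (r (s n)))) \<longlonglongrightarrow> l"
    using bounded_imp_convergent_subsequence[of "\<lambda>n. D (\<phi> (r n))"] by (auto simp: o_def)
  define w where "w n = \<phi> (r (s n))" for n
  have wt: "w n \<in> test_functions \<Omega>" for n by (simp add: w_def \<phi>)
  have Ew: "E (w n) \<le> m + 1 / real (Suc n)" for n
  proof -
    have "n \<le> r (s n)" using seq_suble[OF strict_mono_o[OF r s], of n] by simp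
    then have "1 / real (Suc (r (s n))) \<le> 1 / real (Suc n)" by (simp add: frac_le)
    then show ?thesis using \<phi>(2)[of "r (s n)"] unfolding w_def by linarith
  qed
  have wae: "AE x in M. (\<lambda>n. w n x) \<longlonglongrightarrow> u x"
    using ae unfolding w_def by eventually_elim (rule LIMSEQ_subseq_LIMSEQ[OF _ s, unfolded o_def])
  have Du: "D u = l2sq \<Omega> G'" by (rule dirichlet_integral_eq[OF u(2)])
  note dd = dirichlet_diff[OF wt u]
  define d where "d n = D (\<lambda>x. w n x - u x)" for n
  have "(\<lambda>n. D (w n) - 2 * l2in \<Omega> (grad (w n)) G' + l2sq \<Omega> G') \<longlonglongrightarrow> l - 2 * l2sq \<Omega> G' + l2sq \<Omega> G'"
    using l LIMSEQ_subseq_LIMSEQ[OF wk s, unfolded o_def] unfolding w_def by (intro tendsto_intros)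
  then have dlim: "d \<longlonglongrightarrow> l - D u" unfolding d_def dd(2) Du by (simp add: algebra_simps)
  have d0: "d n \<ge> 0" for n by (simp add: d_def dirichlet_nonneg)
  then have l0: "l - D u \<ge> 0" by (intro LIMSEQ_le_const[OF dlim]) auto
  \<comment> \<open>The whole gap this time: the Sobolev bound for the critical mass of
    \<open>w n - u\<close> then has the coefficient \<open>b / q\<close>, exactly that of the
    Kirchhoff term, as the comparison through superadditivity requires.\<close>
  define \<epsilon> where "\<epsilon> = b / \<kappa> - 1"
  have e: "\<epsilon> > 0" using b_large kappa_pos by (simp add: \<epsilon>_def)
  have ek: "(1 + \<epsilon>) * \<kappa> = b" using kappa_pos by (simp add: \<epsilon>_def)
  obtain C2 C3 where Cs: "C2 \<ge> 0" "C3 \<ge> 0"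
    and up: "\<And>x s t. H x t \<le> (1 + \<epsilon>) / q * \<bar>t - s\<bar> powr q + C3 * \<bar>s\<bar> powr q + C2"
    by (rule H_upper[OF e]) (rule that; simp)
  define I where "I = (LINT x|M. \<bar>u x\<bar> powr q)"
  \<comment> \<open>Nonnegative by \<open>H_upper\<close> at \<open>t = w n x\<close> and
    \<open>s = u x\<close>; its \<open>\<epsilon>\<close> term vanishes in the pointwise
    limit.\<close>
  let ?F = "\<lambda>n x. C2 + C3 * \<bar>u x\<bar> powr q + (1 + \<epsilon>) / q * \<bar>w n x - u x\<bar> powr q - H x (w n x)"
  let ?c = "\<lambda>n. C2 * vol + C3 * I + b / q * d n powr (q / 2) + (m + 1 / real (Suc n) - b / q * D (w n) powr (q / 2))"
  let ?c' = "C2 * vol + C3 * I + b / q * (l - D u) powr (q / 2) + (m + 0 - b / q * l powr (q / 2))"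
  have iF: "integrable M (?F n)" for n
    using best_sobolev(2)[OF u(1)] best_sobolev(2)[OF dd(1)] H_integrable[OF test_H10[OF wt]] by simp
  have F0: "?F n x \<ge> 0" for n x using up[of x "w n x" "u x"] by linarith
  have Fle: "(LINT x|M. ?F n x) \<le> ?c n" for n
  proof -
    have "(LINT x|M. ?F n x) = C2 * vol + C3 * I + (1 + \<epsilon>) / q * (LINT x|M. \<bar>w n x - u x\<bar> powr q) - (LINT x|M. H x (w n x))"
      using best_sobolev(2)[OF u(1)] best_sobolev(2)[OF dd(1)] H_integrable[OF test_H10[OF wt]] by (simp add: I_def)
    moreover have "(1 + \<epsilon>) / q * (LINT x|M. \<bar>w n x - u x\<bar> powr q) \<le> (1 + \<epsilon>) / q * (\<kappa> * d n powr (q / 2))"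
      unfolding d_def using e q_pos by (intro mult_left_mono best_sobolev(3) dd) auto
    moreover have "(1 + \<epsilon>) / q * (\<kappa> * d n powr (q / 2)) = b / q * d n powr (q / 2)"
      by (simp flip: ek)
    moreover have "(LINT x|M. H x (w n x)) = b / q * D (w n) powr (q / 2) - E (w n)" by (simp add: E_def)
    ultimately show ?thesis using Ew[of n] by linarith
  qed
  have clim: "?c \<longlonglongrightarrow> ?c'"
    using l unfolding w_def[symmetric]
    by (intro tendsto_intros dlim LIMSEQ_Suc[OF lim_1_over_n])
       (use q_pos d0 dirichlet_nonneg in auto)
  have Flim: "AE x in M. (\<lambda>n. ?F n x) \<longlonglongrightarrow> C2 + C3 * \<bar>u x\<bar> powr q - H x (u x)"
    using wae
  proof eventually_elim
    case (elim x)
    have "(\<lambda>n. ?F n x) \<longlonglongrightarrow> C2 + C3 * \<bar>u x\<bar> powr q + (1 + \<epsilon>) / q * \<bar>u x - u x\<bar> powr q - H x (u x)"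
      by (intro tendsto_intros H_tendsto elim) (use q_pos in auto)
    then show ?case by simp
  qed
  have mF: "(\<lambda>x. C2 + C3 * \<bar>u x\<bar> powr q - H x (u x)) \<in> borel_measurable M"
    using H_compose_measurable[OF H10_measurable[OF u(1)]] H10_measurable[OF u(1)] by measurable
  have "(LINT x|M. C2 + C3 * \<bar>u x\<bar> powr q - H x (u x)) \<le> ?c'"
    by (rule Fatou_real(2)[OF iF _ mF Flim Fle clim]) (use F0 in auto)
  then have 1: "- (LINT x|M. H x (u x)) \<le> b / q * (l - D u) powr (q / 2) + (m - b / q * l powr (q / 2))"
    using best_sobolev(2)[OF u(1)] H_integrable[OF u(1)] by (simp add: I_def)
  have "(l - D u) powr (q / 2) + D u powr (q / 2) \<le> ((l - D u) + D u) powr (q / 2)"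
    by (rule powr_superadditive) (use l0 dirichlet_nonneg q_gt_2 in auto)
  then have "b / q * ((l - D u) powr (q / 2) + D u powr (q / 2)) \<le> b / q * l powr (q / 2)"
    using b_pos q_pos by (intro mult_left_mono) auto
  then have "E u \<le> m" using 1 unfolding E_def distrib_left by linarith
  with u(1) m_le that show thesis by (meson order_trans)
qed

lemma energy_negative:
  obtains \<phi> where "\<phi> \<in> test_functions \<Omega>" "E \<phi> < 0"
proof -
  obtain \<phi> where \<phi>: "\<phi> \<in> test_functions \<Omega>" "\<not> (AE x in M. \<phi> x = 0)" using nonzero_test_function .
  obtain \<delta> where \<delta>: "\<delta> > 0" "\<And>x t. \<bar>t\<bar> < \<delta> \<Longrightarrow> H x t \<ge> lam / 4 * t\<^sup>2" using H_small by blast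
  obtain B where B: "B > 0" "\<And>x. norm (\<phi> x) \<le> B"
    using bounded_range_of_support[OF C1cD(2,4)[OF test_C1c[OF \<phi>(1)]]] by blast
  define J where "J = l2sq \<Omega> \<phi>"
  note i2 = L2_integrable_inner[OF test_L2(1)[OF \<phi>(1)] test_L2(1)[OF \<phi>(1)]]
  have J: "J > 0"
  proof -
    have "J \<noteq> 0"
      using \<phi>(2) integral_nonneg_eq_0_iff_AE[OF i2] by (auto simp: J_def l2in_def)
    then show ?thesis using l2in_nonneg[of \<Omega> \<phi>] unfolding J_def by linarith
  qed
  define t where "t n = 1 / real (Suc n)" for n
  have t: "t n > 0" for n by (simp add: t_def)
  have tlim: "t \<longlonglongrightarrow> 0" unfolding t_def by (rule LIMSEQ_Suc[OF lim_1_over_n])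
  define A where "A = b / q * D \<phi> powr (q / 2)"
  \<comment> \<open>The Kirchhoff term scales like the power \<open>q\<close> of \<open>t n\<close>.
    Divided by the square of \<open>t n\<close> it tends to 0, whereas the quadratic gain
    \<open>lam / 4 * J\<close> stays; the bound \<open>\<delta> / B\<close> below keeps the values
    in the range of \<open>H_small\<close>.\<close>
  have "(\<lambda>n. A * t n powr (q - 2)) \<longlonglongrightarrow> A * 0 powr (q - 2)"
    by (intro tendsto_intros tlim) (use q_gt_2 t in \<open>auto simp: less_imp_le\<close>)
  then have "\<forall>\<^sub>F n in sequentially. A * t n powr (q - 2) < lam / 4 * J"
    using J lam by (intro order_tendstoD(2)) auto
  moreover have "\<forall>\<^sub>F n in sequentially. t n < \<delta> / B"
    using \<delta> B by (intro order_tendstoD(2)[OF tlim]) auto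
  ultimately have "\<forall>\<^sub>F n in sequentially. A * t n powr (q - 2) < lam / 4 * J \<and> t n < \<delta> / B"
    by (rule eventually_conj)
  then obtain n where n: "A * t n powr (q - 2) < lam / 4 * J" "t n < \<delta> / B"
    by (auto simp: eventually_sequentially)
  \<comment> \<open>The zero summand makes the multiple an instance of the lemmas on linear
    combinations.\<close>
  let ?\<psi> = "\<lambda>x. t n * \<phi> x + 0 * \<phi> x"
  have \<psi>: "?\<psi> \<in> test_functions \<Omega>" by (rule test_functions_linear[OF \<phi>(1) \<phi>(1)])
  have D\<psi>: "D ?\<psi> = (t n)\<^sup>2 * D \<phi>"
    using H10_linear(2)[OF test_H10[OF \<phi>(1)] test_H10[OF \<phi>(1)], of "t n" 0] by simp
  have "lam / 4 * (t n)\<^sup>2 * J = (LINT x|M. lam / 4 * (t n)\<^sup>2 * (\<phi> x \<bullet> \<phi> x))"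
    using i2 by (simp add: J_def l2in_def)
  also have "\<dots> \<le> (LINT x|M. H x (?\<psi> x))"
  proof (rule integral_mono[OF _ H_integrable[OF test_H10[OF \<psi>]]])
    fix x
    have "\<bar>t n * \<phi> x\<bar> \<le> t n * B" using t[of n] B(2)[of x] by (simp add: abs_mult)
    also have "\<dots> < \<delta>" using n(2) B(1) by (simp add: pos_less_divide_eq)
    finally have "lam / 4 * (t n * \<phi> x)\<^sup>2 \<le> H x (t n * \<phi> x)" by (rule \<delta>(2))
    then show "lam / 4 * (t n)\<^sup>2 * (\<phi> x \<bullet> \<phi> x) \<le> H x (?\<psi> x)" by (simp add: power2_eq_square mult_ac)
  qed (use i2 in simp)
  finally have 1: "E ?\<psi> \<le> b / q * ((t n)\<^sup>2 * D \<phi>) powr (q / 2) - lam / 4 * (t n)\<^sup>2 * J"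
    unfolding E_def D\<psi> by linarith
  have "((t n)\<^sup>2 * D \<phi>) powr (q / 2) = (t n)\<^sup>2 * t n powr (q - 2) * D \<phi> powr (q / 2)"
  proof -
    have "(t n)\<^sup>2 = t n powr 2" using t[of n] by (simp add: powr_numeral)
    then have "((t n)\<^sup>2) powr (q / 2) = t n powr 2 * t n powr (q - 2)"
      by (simp only: powr_powr powr_add[symmetric]) simp
    then show ?thesis using t[of n] dirichlet_nonneg[of \<phi>] by (simp add: powr_mult powr_numeral)
  qed
  then have "b / q * ((t n)\<^sup>2 * D \<phi>) powr (q / 2) = (t n)\<^sup>2 * (A * t n powr (q - 2))" by (simp add: A_def)
  also have "\<dots> < (t n)\<^sup>2 * (lam / 4 * J)" using t[of n] n(1) by (intro mult_strict_left_mono) auto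
  finally have "b / q * ((t n)\<^sup>2 * D \<phi>) powr (q / 2) < (t n)\<^sup>2 * (lam / 4 * J)" .
  moreover have "lam / 4 * (t n)\<^sup>2 * J = (t n)\<^sup>2 * (lam / 4 * J)" by simp
  ultimately have "E ?\<psi> < 0" using 1 by linarith
  with \<psi> that show thesis by blast
qed

lemma minimizer_nonzero:
  assumes "u \<in> H10 \<Omega>" "E u < 0"
  shows "\<not> (AE x in M. u x = 0)"
proof
  assume "AE x in M. u x = 0"
  then have "AE x in M. H x (u x) = 0" by eventually_elim simp
  then have "(LINT x|M. H x (u x)) = 0" by (rule integral_eq_zero_AE)
  moreover have "b / q * D u powr (q / 2) \<ge> 0" using b_pos q_pos by simp
  ultimately show False using assms(2) by (simp add: E_def)
qed

text \<open>The directional derivative of the energy, along sequences so that dominated convergence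
  applies. The condition \<open>\<bar>t n\<bar> \<le> 1\<close> keeps all arguments within
  \<open>\<bar>u x\<bar> + \<bar>v x\<bar>\<close>. The domination also proves the integrability
  that \<open>weak_solution\<close> demands.\<close>

lemma energy_difference_quotient:
  assumes u: "u \<in> H10 \<Omega>" and v: "v \<in> H10 \<Omega>"
    and t: "t \<longlonglongrightarrow> 0" "\<And>n. t n \<noteq> 0" "\<And>n. \<bar>t n\<bar> \<le> 1"
  shows "integrable M (\<lambda>x. f x (u x) * v x)"
    "(\<lambda>n. (E (\<lambda>x. 1 * u x + t n * v x) - E u) / t n) \<longlonglongrightarrow>
       b * D u powr (q / 2 - 1) * l2in \<Omega> (weak_grad \<Omega> u) (weak_grad \<Omega> v) - (LINT x|M. f x (u x) * v x)"
proof -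
  have t0: "filterlim t (at 0) sequentially" using t by (auto simp: filterlim_at)
  define B where "B = l2in \<Omega> (weak_grad \<Omega> u) (weak_grad \<Omega> v)"
  define z where "z s = D u + 2 * s * B + s\<^sup>2 * D v" for s
  note uv = H10_linear[OF u v, of 1]
  have z: "D (\<lambda>x. 1 * u x + s * v x) = z s" for s using uv(2)[of s] by (simp add: z_def B_def)
  have z0: "z s \<ge> 0" for s unfolding z[symmetric] by (rule dirichlet_nonneg)
  \<comment> \<open>The absolute value makes the chain rule valid also when \<open>z 0 = D u\<close>
    is 0, because \<open>q / 2 > 1\<close>.\<close>
  have d: "((\<lambda>s. \<bar>z s\<bar> powr (q / 2)) has_real_derivative ((q / 2) * \<bar>z 0\<bar> powr (q / 2 - 2) * z 0) * (2 * B)) (at 0)"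
    by (rule DERIV_chain2[OF has_real_derivative_abs_powr])
       (use q_gt_2 in \<open>auto simp: z_def intro!: derivative_eq_intros\<close>)
  have "\<bar>z 0\<bar> powr (q / 2 - 2) * z 0 = D u powr (q / 2 - 1)"
    using abs_powr_mult_abs[of "D u" "q / 2 - 1"] dirichlet_nonneg[of u] by (simp add: z_def)
  then have e: "((q / 2) * \<bar>z 0\<bar> powr (q / 2 - 2) * z 0) * (2 * B) = q * D u powr (q / 2 - 1) * B"
    unfolding mult.assoc[of "q / 2"] by simp
  have "((\<lambda>s. z s powr (q / 2)) has_real_derivative q * D u powr (q / 2 - 1) * B) (at 0)"
    using d z0 unfolding e by simp
  then have "(\<lambda>h. (z h powr (q / 2) - z 0 powr (q / 2)) / h) \<midarrow>0\<rightarrow> q * D u powr (q / 2 - 1) * B"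
    by (simp add: DERIV_def)
  from tendsto_mult_left[OF filterlim_compose[OF this t0], of "b / q"]
  have lim1: "(\<lambda>n. b / q * ((z (t n) powr (q / 2) - z 0 powr (q / 2)) / t n)) \<longlonglongrightarrow> b * D u powr (q / 2 - 1) * B"
    using q_pos by (simp add: mult.assoc)
  let ?Q = "\<lambda>n x. (H x (1 * u x + t n * v x) - H x (u x)) / t n"
  obtain C where C: "C > 0" "\<And>x t. \<bar>f x t\<bar> \<le> C * (1 + \<bar>t\<bar> powr (q - 1))" using f_growth by blast
  obtain C' where C': "C' \<ge> 0" "\<And>a b :: real. \<bar>a + b\<bar> powr q \<le> (1 + 1) * \<bar>a\<bar> powr q + C' * \<bar>b\<bar> powr q"
    using abs_powr_add_le[of q 1] q_pos by auto
  \<comment> \<open>By the growth of \<open>f\<close>, a quotient is at most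
    \<open>C * (1 + y powr (q - 1)) * \<bar>v x\<bar>\<close> with
    \<open>y = \<bar>u x\<bar> + \<bar>v x\<bar>\<close>; bounding the last factor by
    \<open>y\<close> in the power term leaves \<open>y powr q\<close>, which splits into the two
    critical powers.\<close>
  let ?w = "\<lambda>x. C * (\<bar>v x\<bar> + (2 * \<bar>u x\<bar> powr q + C' * \<bar>v x\<bar> powr q))"
  have Hm: "(\<lambda>x. H x (1 * u x + t n * v x)) \<in> borel_measurable M" for n
    by (rule H_compose_measurable[OF H10_measurable[OF uv(1)]])
  have Qm: "?Q n \<in> borel_measurable M" for n
    using Hm H_compose_measurable[OF H10_measurable[OF u]] by (intro borel_measurable_divide borel_measurable_diff) auto
  have fm: "(\<lambda>x. f x (u x) * v x) \<in> borel_measurable M"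
    using f_compose_measurable[OF H10_measurable[OF u]] H10_measurable[OF v] by simp
  have wi: "integrable M ?w"
    using L2_integrable[OF H10_L2[OF v]] best_sobolev(2)[OF u] best_sobolev(2)[OF v] by simp
  have Qlim: "AE x in M. (\<lambda>n. ?Q n x) \<longlonglongrightarrow> f x (u x) * v x"
  proof (rule AE_I2)
    fix x
    have "((\<lambda>s. H x (1 * u x + s * v x)) has_real_derivative f x (1 * u x + 0 * v x) * v x) (at 0)"
      by (rule DERIV_chain2[OF H_deriv]) (auto intro!: derivative_eq_intros)
    then have "(\<lambda>h. (H x (1 * u x + h * v x) - H x (u x)) / h) \<midarrow>0\<rightarrow> f x (u x) * v x"
      by (simp add: DERIV_def)
    from filterlim_compose[OF this t0] show "(\<lambda>n. ?Q n x) \<longlonglongrightarrow> f x (u x) * v x" .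
  qed
  have Qbound: "AE x in M. norm (?Q n x) \<le> ?w x" for n
  proof (rule AE_I2)
    fix x
    define y where "y = \<bar>u x\<bar> + \<bar>v x\<bar>"
    have y: "y \<ge> 0" "\<bar>v x\<bar> \<le> y" by (simp_all add: y_def)
    have tv: "\<bar>t n * v x\<bar> \<le> \<bar>v x\<bar>" using t(3)[of n] by (simp add: abs_mult mult_left_le_one_le)
    have "norm (H x (1 * u x + t n * v x) - H x (u x)) \<le> C * (1 + y powr (q - 1)) * norm ((1 * u x + t n * v x) - u x)"
    proof (rule field_differentiable_bound)
      show "convex {- y..y}" by (rule convex_real_interval)
      show "(H x has_real_derivative f x s) (at s within {- y..y})" for s
        by (rule has_field_derivative_at_within[OF H_deriv])
      show "norm (f x s) \<le> C * (1 + y powr (q - 1))" if "s \<in> {- y..y}" for s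
      proof -
        have "\<bar>s\<bar> powr (q - 1) \<le> y powr (q - 1)" using that q_gt_2 by (intro powr_mono2) auto
        then have "C * (1 + \<bar>s\<bar> powr (q - 1)) \<le> C * (1 + y powr (q - 1))" using C(1) by (intro mult_left_mono) auto
        then show ?thesis using C(2)[of x s] by simp
      qed
      show "1 * u x + t n * v x \<in> {- y..y}" "u x \<in> {- y..y}" using tv by (auto simp: y_def abs_le_iff)
    qed
    then have "\<bar>H x (1 * u x + t n * v x) - H x (u x)\<bar> \<le> (C * (1 + y powr (q - 1)) * \<bar>v x\<bar>) * \<bar>t n\<bar>"
      by (simp add: abs_mult mult_ac)
    then have "norm (?Q n x) \<le> C * (1 + y powr (q - 1)) * \<bar>v x\<bar>"
      using t(2)[of n] by (simp add: pos_divide_le_eq)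
    also have "\<dots> = C * (\<bar>v x\<bar> + y powr (q - 1) * \<bar>v x\<bar>)" by (simp add: algebra_simps)
    also have "\<dots> \<le> C * (\<bar>v x\<bar> + y powr (q - 1) * y)"
      using C(1) y by (intro mult_left_mono add_left_mono) auto
    also have "y powr (q - 1) * y = y powr q" using abs_powr_mult_abs[of y q] y(1) by simp
    also have "y powr q \<le> 2 * \<bar>u x\<bar> powr q + C' * \<bar>v x\<bar> powr q"
      using C'(2)[of "\<bar>u x\<bar>" "\<bar>v x\<bar>"] by (simp add: y_def)
    finally show "norm (?Q n x) \<le> ?w x" using C(1) by (simp add: mult_left_mono)
  qed
  show "integrable M (\<lambda>x. f x (u x) * v x)"
    by (rule integrable_dominated_convergence[OF fm Qm wi Qlim Qbound])
  have lim2: "(\<lambda>n. LINT x|M. ?Q n x) \<longlonglongrightarrow> (LINT x|M. f x (u x) * v x)"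
    by (rule integral_dominated_convergence[OF fm Qm wi Qlim Qbound])
  have "(E (\<lambda>x. 1 * u x + t n * v x) - E u) / t n =
      b / q * ((z (t n) powr (q / 2) - z 0 powr (q / 2)) / t n) - (LINT x|M. ?Q n x)" for n
  proof -
    have "(LINT x|M. ?Q n x) = ((LINT x|M. H x (1 * u x + t n * v x)) - (LINT x|M. H x (u x))) / t n"
      using H_integrable[OF uv(1)[of "t n"]] H_integrable[OF u] by simp
    moreover have "z 0 = D u" by (simp add: z_def)
    ultimately show ?thesis
      unfolding E_def z by (simp add: diff_divide_distrib right_diff_distrib)
  qed
  then show "(\<lambda>n. (E (\<lambda>x. 1 * u x + t n * v x) - E u) / t n) \<longlonglongrightarrow>
       b * D u powr (q / 2 - 1) * l2in \<Omega> (weak_grad \<Omega> u) (weak_grad \<Omega> v) - (LINT x|M. f x (u x) * v x)"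
    using tendsto_diff[OF lim1 lim2] by (simp only: B_def)
qed

text \<open>At a minimizer the quotients are nonnegative for positive steps and nonpositive for
  negative ones, and both tend to the same limit.\<close>

lemma euler_lagrange:
  assumes u: "u \<in> H10 \<Omega>" and min: "\<And>v. v \<in> H10 \<Omega> \<Longrightarrow> E u \<le> E v" and v: "v \<in> H10 \<Omega>"
  shows "b * D u powr (q / 2 - 1) * l2in \<Omega> (weak_grad \<Omega> u) (weak_grad \<Omega> v) = (LINT x|M. f x (u x) * v x)"
proof -
  let ?L = "b * D u powr (q / 2 - 1) * l2in \<Omega> (weak_grad \<Omega> u) (weak_grad \<Omega> v) - (LINT x|M. f x (u x) * v x)"
  have m: "E u \<le> E (\<lambda>x. 1 * u x + s * v x)" for s by (intro min H10_linear u v)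
  have t: "(\<lambda>n. 1 / real (Suc n)) \<longlonglongrightarrow> 0" by (rule LIMSEQ_Suc[OF lim_1_over_n])
  have t': "(\<lambda>n. - (1 / real (Suc n))) \<longlonglongrightarrow> 0" using tendsto_minus[OF t] by (simp only: minus_zero)
  have l: "(\<lambda>n. (E (\<lambda>x. 1 * u x + 1 / real (Suc n) * v x) - E u) / (1 / real (Suc n))) \<longlonglongrightarrow> ?L"
    by (rule energy_difference_quotient(2)[OF u v t]) (auto simp del: of_nat_Suc)
  have l': "(\<lambda>n. (E (\<lambda>x. 1 * u x + - (1 / real (Suc n)) * v x) - E u) / (- (1 / real (Suc n)))) \<longlonglongrightarrow> ?L"
    by (rule energy_difference_quotient(2)[OF u v t']) (auto simp del: of_nat_Suc)
  have "0 \<le> ?L"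
  proof (rule LIMSEQ_le_const[OF l], intro exI[of _ 0] allI impI divide_nonneg_nonneg)
    show "0 \<le> E (\<lambda>x. 1 * u x + 1 / real (Suc n) * v x) - E u" for n using m[of "1 / real (Suc n)"] by linarith
  qed auto
  moreover have "?L \<le> 0"
  proof (rule LIMSEQ_le_const2[OF l'], intro exI[of _ 0] allI impI divide_nonneg_nonpos)
    show "0 \<le> E (\<lambda>x. 1 * u x + - (1 / real (Suc n)) * v x) - E u" for n using m[of "- (1 / real (Suc n))"] by linarith
  qed auto
  ultimately show ?thesis by linarith
qed

lemma nontrivial_weak_solution:
  "\<exists>u. weak_solution \<Omega> 0 b (q / 2) lam g u \<and> \<not> (AE x in M. u x = 0)"
proof -
  obtain u where u: "u \<in> H10 \<Omega>" and min: "\<And>\<phi>. \<phi> \<in> test_functions \<Omega> \<Longrightarrow> E u \<le> E \<phi>"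
    using minimizer_exists by blast
  obtain \<phi> where "\<phi> \<in> test_functions \<Omega>" "E \<phi> < 0" using energy_negative .
  then have "E u < 0" using min by (meson le_less_trans)
  then have nz: "\<not> (AE x in M. u x = 0)" by (rule minimizer_nonzero[OF u])
  have min': "E u \<le> E v" if "v \<in> H10 \<Omega>" for v by (rule energy_ge_of_test[OF that min])
  have rhs: "kirchhoff_rhs lam g u x = f x (u x)" for x
    by (simp add: kirchhoff_rhs_def f_def flip: q_eq)
  have t: "(\<lambda>n. 1 / real (Suc n)) \<longlonglongrightarrow> 0" by (rule LIMSEQ_Suc[OF lim_1_over_n])
  have "weak_solution \<Omega> 0 b (q / 2) lam g u"
    unfolding weak_solution_def rhs
  proof (intro conjI ballI u)
    fix v assume v: "v \<in> H10 \<Omega>"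
    show "integrable M (\<lambda>x. f x (u x) * v x)"
      by (rule energy_difference_quotient(1)[OF u v t]) (auto simp del: of_nat_Suc)
    show "(0 + b * D u powr (q / 2 - 1)) * (LINT x|M. weak_grad \<Omega> u x \<bullet> weak_grad \<Omega> v x) = (LINT x|M. f x (u x) * v x)"
      using euler_lagrange[OF u min' v] by (simp add: l2in_def)
  qed
  with nz show ?thesis by blast
qed

end

text \<open>Rests on the completeness of Lebesgue measure. It keeps \<open>g\<close> measurable in
  \<open>x\<close> when modified on a null set, and brings the result back to the original
  \<open>g\<close>.\<close>

lemma borel_measurable_lebesgue_on_AE_cong:
  fixes f h :: "real ^ 'n \<Rightarrow> real"
  assumes S: "S \<in> sets lebesgue" and f: "f \<in> borel_measurable (lebesgue_on S)"
    and ae: "AE x in lebesgue_on S. f x = h x"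
  shows "h \<in> borel_measurable (lebesgue_on S)"
proof -
  have "(\<lambda>x. indicator S x *\<^sub>R f x) \<in> borel_measurable lebesgue"
    using f S by (simp add: borel_measurable_restrict_space_iff)
  moreover have "AE x in lebesgue. indicator S x *\<^sub>R f x = indicator S x *\<^sub>R h x"
    using ae S by (auto simp: AE_restrict_space_iff indicator_def elim!: eventually_mono)
  ultimately have "(\<lambda>x. indicator S x *\<^sub>R h x) \<in> borel_measurable lebesgue"
    by (rule borel_measurable_AE)
  then show ?thesis using S by (simp add: borel_measurable_restrict_space_iff)
qed

theorem theorem3p10:
  fixes \<Omega> :: "(real ^ 'n) set"
    and g :: "real ^ 'n \<Rightarrow> real \<Rightarrow> real"
    and a b \<gamma> p c8 c9 :: real
  assumes "CARD('n) \<ge> 3"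
    and "bounded_domain \<Omega>"
    and "caratheodory \<Omega> g"
    and "\<forall>\<epsilon>>0. \<exists>\<delta>>0. AE x in lebesgue_on \<Omega>. \<forall>t. 0 < \<bar>t\<bar> \<and> \<bar>t\<bar> < \<delta> \<longrightarrow> \<bar>g x t\<bar> \<le> \<epsilon> * \<bar>t\<bar>"
    and "c8 > 0" and "c9 > 0" and "2 < p" and "p < crit_exp CARD('n)"
    and "AE x in lebesgue_on \<Omega>. \<forall>t. \<bar>g x t\<bar> \<le> c8 * \<bar>t\<bar> powr (p - 1) + c9"
    and "\<gamma> = crit_exp CARD('n) / 2"
    and "a = 0"
    and "b > best_sobolev_const \<Omega> powr (- crit_exp CARD('n) / 2)"
  shows "\<forall>lam>0. \<exists>u. weak_solution \<Omega> a b \<gamma> lam g u \<and> \<not> (AE x in lebesgue_on \<Omega>. u x = 0)"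
proof (intro allI impI)
  fix lam :: real assume lam: "lam > 0"
  let ?M = "lebesgue_on \<Omega>"
  have \<Omega>: "open \<Omega>" "bounded \<Omega>" "\<Omega> \<noteq> {}" using assms(2) by (auto simp: bounded_domain_def)
  have \<Omega>s: "\<Omega> \<in> sets lebesgue" using \<Omega>(1) by auto
  have gm: "(\<lambda>x. g x t) \<in> borel_measurable ?M" for t
    using assms(3) by (simp add: caratheodory_def)
  obtain \<delta> where \<delta>: "\<delta> > 0" "AE x in ?M. \<forall>t. 0 < \<bar>t\<bar> \<and> \<bar>t\<bar> < \<delta> \<longrightarrow> \<bar>g x t\<bar> \<le> lam / 4 * \<bar>t\<bar>"
    using assms(4)[rule_format, of "lam / 4"] lam by auto
  define good where "good x \<longleftrightarrow> continuous_on UNIV (g x) \<and> (\<forall>t. \<bar>g x t\<bar> \<le> c8 * \<bar>t\<bar> powr (p - 1) + c9) \<and>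
     (\<forall>t. 0 < \<bar>t\<bar> \<and> \<bar>t\<bar> < \<delta> \<longrightarrow> \<bar>g x t\<bar> \<le> lam / 4 * \<bar>t\<bar>)" for x
  have ae: "AE x in ?M. good x"
    using assms(3)[unfolded caratheodory_def, THEN conjunct2] assms(9) \<delta>(2)
    by eventually_elim (simp add: good_def)
  \<comment> \<open>All conditions on \<open>g\<close> hold everywhere after a modification on a null set.\<close>
  define h where "h x t = (if good x then g x t else 0)" for x t
  \<comment> \<open>The smallness hypothesis excludes \<open>t = 0\<close>, whereas the locale
    condition includes it; continuity supplies the value there.\<close>
  have good0: "g x 0 = 0" if "good x" for x
  proof -
    have "isCont (g x) 0" using that by (simp add: good_def continuous_on_eq_continuous_at)
    then have 1: "(\<lambda>n. \<bar>g x (1 / real (Suc n))\<bar>) \<longlonglongrightarrow> \<bar>g x 0\<bar>"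
      by (intro tendsto_rabs isCont_tendsto_compose[OF _ LIMSEQ_Suc[OF lim_1_over_n]])
    have 2: "(\<lambda>n. lam / 4 * (1 / real (Suc n))) \<longlonglongrightarrow> lam / 4 * 0"
      by (intro tendsto_intros LIMSEQ_Suc[OF lim_1_over_n])
    have 3: "\<forall>\<^sub>F n in sequentially. \<bar>g x (1 / real (Suc n))\<bar> \<le> lam / 4 * (1 / real (Suc n))"
      using order_tendstoD(2)[OF LIMSEQ_Suc[OF lim_1_over_n] \<delta>(1)]
    proof eventually_elim
      case (elim n)
      have "\<bar>1 / real (Suc n)\<bar> = 1 / real (Suc n)" "0 < 1 / real (Suc n)" by auto
      then show ?case using that elim unfolding good_def by metis
    qed
    have "\<bar>g x 0\<bar> \<le> lam / 4 * 0" by (rule tendsto_le[OF sequentially_bot 2 1 3])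
    then show ?thesis by simp
  qed
  have aeh: "AE x in ?M. \<forall>t. g x t = h x t" using ae by eventually_elim (simp add: h_def)
  interpret kirchhoff_energy \<Omega> "crit_exp CARD('n)" h lam p c8 c9 b
  proof
    show "open \<Omega>" "bounded \<Omega>" "\<Omega> \<noteq> {}" "CARD('n) \<ge> 3" by (fact \<Omega> assms(1))+
    show "crit_exp CARD('n) = crit_exp CARD('n)" ..
    show "(\<lambda>x. h x t) \<in> borel_measurable ?M" for t
      by (rule borel_measurable_lebesgue_on_AE_cong[OF \<Omega>s gm[of t]]) (use aeh in \<open>auto elim!: eventually_mono\<close>)
    show "continuous_on UNIV (h x)" for x
    proof (cases "good x")
      case True
      then have "h x = g x" by (auto simp: h_def)
      then show ?thesis using True by (simp add: good_def)
    next
      case False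
      then have "h x = (\<lambda>_. 0)" by (auto simp: h_def)
      then show ?thesis by simp
    qed
    show "c8 > 0" "c9 > 0" "2 < p" "p < crit_exp CARD('n)" "lam > 0" by (fact assms lam)+
    show "\<bar>h x t\<bar> \<le> c8 * \<bar>t\<bar> powr (p - 1) + c9" for x t
      using assms(5,6) by (cases "good x") (auto simp: h_def good_def)
    show "\<exists>\<delta>>0. \<forall>x t. \<bar>t\<bar> < \<delta> \<longrightarrow> \<bar>h x t\<bar> \<le> lam / 4 * \<bar>t\<bar>"
    proof (intro exI conjI allI impI)
      fix x t assume "\<bar>t\<bar> < \<delta>"
      then show "\<bar>h x t\<bar> \<le> lam / 4 * \<bar>t\<bar>"
        using good0[of x] lam by (cases "good x"; cases "t = 0") (auto simp: h_def good_def)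
    qed (rule \<delta>)
    show "best_sobolev_const \<Omega> powr (- crit_exp CARD('n) / 2) < b" by (fact assms)
  qed
  obtain u where u: "weak_solution \<Omega> 0 b (crit_exp CARD('n) / 2) lam h u" and nz: "\<not> (AE x in ?M. u x = 0)"
    using nontrivial_weak_solution by blast
  \<comment> \<open>The solution found for \<open>h\<close> serves for \<open>g\<close> as well,
    since \<open>g\<close> enters the weak formulation only through integrals.\<close>
  have rhs: "AE x in ?M. kirchhoff_rhs lam h u x = kirchhoff_rhs lam g u x"
    using aeh by eventually_elim (simp add: kirchhoff_rhs_def)
  have "weak_solution \<Omega> a b \<gamma> lam g u"
    unfolding weak_solution_def
  proof (intro conjI ballI)
    show "u \<in> H10 \<Omega>" using u by (simp add: weak_solution_def)
    fix v assume v: "v \<in> H10 \<Omega>"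
    have i: "integrable ?M (\<lambda>x. kirchhoff_rhs lam h u x * v x)"
      and eq: "b * dirichlet_integral \<Omega> u powr (crit_exp CARD('n) / 2 - 1) *
          (LINT x|?M. weak_grad \<Omega> u x \<bullet> weak_grad \<Omega> v x) = (LINT x|?M. kirchhoff_rhs lam h u x * v x)"
      using u v by (simp_all add: weak_solution_def)
    have ae': "AE x in ?M. kirchhoff_rhs lam h u x * v x = kirchhoff_rhs lam g u x * v x"
      using rhs by eventually_elim simp
    have m: "(\<lambda>x. kirchhoff_rhs lam g u x * v x) \<in> borel_measurable ?M"
      by (rule borel_measurable_lebesgue_on_AE_cong[OF \<Omega>s borel_measurable_integrable[OF i] ae'])
    show "integrable ?M (\<lambda>x. kirchhoff_rhs lam g u x * v x)"
      using integrable_cong_AE[OF borel_measurable_integrable[OF i] m ae'] i by simp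
    show "(a + b * dirichlet_integral \<Omega> u powr (\<gamma> - 1)) * (LINT x|?M. weak_grad \<Omega> u x \<bullet> weak_grad \<Omega> v x) =
        (LINT x|?M. kirchhoff_rhs lam g u x * v x)"
      using eq integral_cong_AE[OF borel_measurable_integrable[OF i] m ae'] by (simp add: assms(10,11))
  qed
  with nz show "\<exists>u. weak_solution \<Omega> a b \<gamma> lam g u \<and> \<not> (AE x in ?M. u x = 0)" by blast
qed

end
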